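(* Let $k=\mathbb{C}$, and let $\mathcal{C}$ be a Hom-finite, 2-Calabi--Yau, Krull--Schmidt triangulated $k$-category which admits a basic cluster tilting object, and assume moreover that $\mathcal{C}$ is the stable category of a $k$-linear Hom-finite, Frobenius, Krull--Schmidt category $\mathcal{E}$. Let $T$, $L$ and $M$ be arbitrary objects of $\mathcal{C}$, and put $B=\operatorname{End}_{\mathcal{C}}(T)$, $F=\mathcal{C}(T,?)$. Let $\mathcal{D}$ be the set of $d=(d_1,d_2,d_3,d_4)$ of non-negative integers such that $d_1=\dim\mathcal{C}(T,M)$, $d_3=\dim\mathcal{C}(T,L)$, $d_2\le d_1+d_3$ and $d_4=\dim\mathcal{C}(T,\Sigma M)$. Then there exists a constructible map $$\varphi:\mathcal{C}(L,\Sigma M)\longrightarrow\coprod_{d\in\mathcal{D}}\operatorname{rep}_dB\overrightarrow{A_4}$$ which lifts the map sending $\varepsilon$ to the orbit of the representation $$\mathcal{C}(T,M)\xrightarrow{Fi}\mathcal{C}(T,Y)\xrightarrow{Fp}\mathcal{C}(T,L)\xrightarrow{F\varepsilon}\mathcal{C}(T,\Sigma M),$$ where $M\xrightarrow{i}Y\xrightarrow{p}L\xrightarrow{\varepsilon}\Sigma M$ is a triangle in $\mathcal{C}$.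
   Context: $\Sigma$ is the suspension of $\mathcal{C}$. An object $T_0$ of $\mathcal{C}$ is cluster tilting if $\mathcal{C}(T_0,\Sigma T_0)=0$ and $\mathcal{C}(T_0,\Sigma X)=0$ implies $X\in\operatorname{add}T_0$. $\overrightarrow{A_4}$ is the quiver $1\to2\to3\to4$. For a finite quiver $Q$ and $d=(d_i)_{i\in Q_0}$ non-negative integers, $\operatorname{rep}_dBQ$ is the affine variety whose points consist of a right $B$-module structure on $k^{d_i}$ for each vertex $i$ and a $B$-linear map $k^{d_i}\to k^{d_j}$ for each arrow $i\to j$; $GL(d)=\prod_iGL_{d_i}(k)$ acts by base change, and "orbit" means the $GL(d)$-orbit in $\operatorname{rep}_dBQ$ determined by a representation up to choice of bases. A map $f:X\to Y$ of algebraic varieties is constructible if $X$ is a finite disjoint union of locally closed subsets on each of which $f$ restricts to a morphism of varieties. *)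

theory Defs
  imports
    "HOL-Algebra.AbelCoset"
    "Jordan_Normal_Form.VS_Connect"
    "Graph_Theory.Digraph"
    "HOL-Analysis.Sum_Topology"
    "HOL-Analysis.Function_Topology"
begin

hide_const (open) Modules.module_hom

section \<open>Linear categories\<close>

text \<open>
  The ground field is \<open>class_ring :: complex ring\<close>. Hom-spaces are HOL-Algebra modules; the
  \<open>mult\<close> and \<open>one\<close> fields of these records carry no meaning. Composition is written in the usual
  order, \<open>g \<cdot> f\<close> for \<open>f : X \<rightarrow> Y\<close> and \<open>g : Y \<rightarrow> Z\<close>.
\<close>

record ('o, 'm) lin_category =
  Ob :: "'o set"
  Hom :: "'o \<Rightarrow> 'o \<Rightarrow> (complex, 'm) module"
  Comp :: "'m \<Rightarrow> 'm \<Rightarrow> 'm"  (infixr \<open>\<cdot>\<index>\<close> 75)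
  Idn :: "'o \<Rightarrow> 'm"

abbreviation mor :: "('o, 'm, 'z) lin_category_scheme \<Rightarrow> 'o \<Rightarrow> 'o \<Rightarrow> 'm set" where
  "mor C X Y \<equiv> carrier (Hom C X Y)"

abbreviation zmor :: "('o, 'm, 'z) lin_category_scheme \<Rightarrow> 'o \<Rightarrow> 'o \<Rightarrow> 'm" where
  "zmor C X Y \<equiv> \<zero>\<^bsub>Hom C X Y\<^esub>"

abbreviation vdim :: "(complex, 'm) module \<Rightarrow> nat" where
  "vdim V \<equiv> vectorspace.dim class_ring V"

locale linear_category =
  fixes C :: "('o, 'm, 'z) lin_category_scheme" (structure)
  assumes hom_vectorspace:
      "\<lbrakk>X \<in> Ob C; Y \<in> Ob C\<rbrakk> \<Longrightarrow> vectorspace class_ring (Hom C X Y)"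
    and id_mor: "X \<in> Ob C \<Longrightarrow> Idn C X \<in> mor C X X"
    and comp_left_linear:
      "\<lbrakk>X \<in> Ob C; Y \<in> Ob C; Z \<in> Ob C; g \<in> mor C Y Z\<rbrakk>
        \<Longrightarrow> (\<lambda>f. g \<cdot> f) \<in> module_hom class_ring (Hom C X Y) (Hom C X Z)"
    and comp_right_linear:
      "\<lbrakk>X \<in> Ob C; Y \<in> Ob C; Z \<in> Ob C; f \<in> mor C X Y\<rbrakk>
        \<Longrightarrow> (\<lambda>g. g \<cdot> f) \<in> module_hom class_ring (Hom C Y Z) (Hom C X Z)"
    and comp_assoc:
      "\<lbrakk>W \<in> Ob C; X \<in> Ob C; Y \<in> Ob C; Z \<in> Ob C;
        f \<in> mor C W X; g \<in> mor C X Y; h \<in> mor C Y Z\<rbrakk> \<Longrightarrow> (h \<cdot> g) \<cdot> f = h \<cdot> (g \<cdot> f)"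
    and id_left: "\<lbrakk>X \<in> Ob C; Y \<in> Ob C; f \<in> mor C X Y\<rbrakk> \<Longrightarrow> Idn C Y \<cdot> f = f"
    and id_right: "\<lbrakk>X \<in> Ob C; Y \<in> Ob C; f \<in> mor C X Y\<rbrakk> \<Longrightarrow> f \<cdot> Idn C X = f"

definition is_iso :: "('o, 'm, 'z) lin_category_scheme \<Rightarrow> 'o \<Rightarrow> 'o \<Rightarrow> 'm \<Rightarrow> bool" where
  "is_iso C X Y f \<longleftrightarrow> f \<in> mor C X Y \<and>
    (\<exists>g \<in> mor C Y X. g \<cdot>\<^bsub>C\<^esub> f = Idn C X \<and> f \<cdot>\<^bsub>C\<^esub> g = Idn C Y)"

definition isomorphic :: "('o, 'm, 'z) lin_category_scheme \<Rightarrow> 'o \<Rightarrow> 'o \<Rightarrow> bool" where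
  "isomorphic C X Y \<longleftrightarrow> (\<exists>f. is_iso C X Y f)"

definition zero_object :: "('o, 'm, 'z) lin_category_scheme \<Rightarrow> 'o \<Rightarrow> bool" where
  "zero_object C X \<longleftrightarrow> X \<in> Ob C \<and> Idn C X = zmor C X X"

definition is_direct_sum ::
  "('o, 'm, 'z) lin_category_scheme \<Rightarrow> 'o \<Rightarrow> nat \<Rightarrow> (nat \<Rightarrow> 'o) \<Rightarrow> (nat \<Rightarrow> 'm) \<Rightarrow> (nat \<Rightarrow> 'm) \<Rightarrow> bool"
where
  "is_direct_sum C X n Y inc prj \<longleftrightarrow>
    X \<in> Ob C \<and>
    (\<forall>i<n. Y i \<in> Ob C \<and> inc i \<in> mor C (Y i) X \<and> prj i \<in> mor C X (Y i)) \<and>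
    (\<forall>i<n. \<forall>j<n. prj i \<cdot>\<^bsub>C\<^esub> inc j = (if i = j then Idn C (Y i) else zmor C (Y j) (Y i))) \<and>
    (\<Oplus>\<^bsub>Hom C X X\<^esub>i\<in>{..<n}. inc i \<cdot>\<^bsub>C\<^esub> prj i) = Idn C X"

text \<open>The case \<open>n = 0\<close> provides a zero object.\<close>

locale additive_category = linear_category +
  assumes direct_sums:
    "\<And>(n::nat) Y. (\<forall>i<n. Y i \<in> Ob C) \<Longrightarrow> \<exists>X inc prj. is_direct_sum C X n Y inc prj"

definition hom_finite :: "('o, 'm, 'z) lin_category_scheme \<Rightarrow> bool" where
  "hom_finite C \<longleftrightarrow> (\<forall>X \<in> Ob C. \<forall>Y \<in> Ob C. vectorspace.fin_dim class_ring (Hom C X Y))"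

text \<open>The endomorphism ring is local: it is nonzero and its non-units are closed under addition.\<close>

definition local_endomorphism_ring :: "('o, 'm, 'z) lin_category_scheme \<Rightarrow> 'o \<Rightarrow> bool" where
  "local_endomorphism_ring C X \<longleftrightarrow> X \<in> Ob C \<and> \<not> zero_object C X \<and>
    (\<forall>f \<in> mor C X X. \<forall>g \<in> mor C X X.
      \<not> is_iso C X X f \<longrightarrow> \<not> is_iso C X X g \<longrightarrow> \<not> is_iso C X X (f \<oplus>\<^bsub>Hom C X X\<^esub> g))"

definition krull_schmidt :: "('o, 'm, 'z) lin_category_scheme \<Rightarrow> bool" where
  "krull_schmidt C \<longleftrightarrow> (\<forall>X \<in> Ob C. \<exists>n Y inc prj. is_direct_sum C X n Y inc prj \<and>
    (\<forall>i<n. local_endomorphism_ring C (Y i)))"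

definition indecomposable :: "('o, 'm, 'z) lin_category_scheme \<Rightarrow> 'o \<Rightarrow> bool" where
  "indecomposable C X \<longleftrightarrow> X \<in> Ob C \<and> \<not> zero_object C X \<and>
    (\<forall>Y inc prj. is_direct_sum C X 2 Y inc prj \<longrightarrow> zero_object C (Y 0) \<or> zero_object C (Y 1))"

definition basic_object :: "('o, 'm, 'z) lin_category_scheme \<Rightarrow> 'o \<Rightarrow> bool" where
  "basic_object C X \<longleftrightarrow> (\<exists>n Y inc prj. is_direct_sum C X n Y inc prj \<and>
    (\<forall>i<n. indecomposable C (Y i)) \<and>
    (\<forall>i<n. \<forall>j<n. i \<noteq> j \<longrightarrow> \<not> isomorphic C (Y i) (Y j)))"

text \<open>\<open>add T\<close>: the direct summands of the finite direct sums of copies of \<open>T\<close>.\<close>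

definition add_closure :: "('o, 'm, 'z) lin_category_scheme \<Rightarrow> 'o \<Rightarrow> 'o set" where
  "add_closure C T = {X. \<exists>W n inc prj Y inc' prj'.
    is_direct_sum C W n (\<lambda>_. T) inc prj \<and> is_direct_sum C W 2 Y inc' prj' \<and> X = Y 0}"

definition End_algebra :: "('o, 'm, 'z) lin_category_scheme \<Rightarrow> 'o \<Rightarrow> (complex, 'm) module" where
  "End_algebra C T = (Hom C T T)\<lparr>mult := Comp C, one := Idn C T\<rparr>"


section \<open>Triangulated categories\<close>

text \<open>
  A tuple \<open>(X, Y, Z, u, v, w)\<close> in \<open>Tri\<close> is a (distinguished) triangle
  \<open>X \<rightarrow> Y \<rightarrow> Z \<rightarrow> \<Sigma>X\<close> with maps \<open>u\<close>, \<open>v\<close>, \<open>w\<close>.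
  The suspension is an autoequivalence, not necessarily an automorphism.
\<close>

record ('o, 'm) tri_category = "('o, 'm) lin_category" +
  Susp :: "'o \<Rightarrow> 'o"
  SuspM :: "'m \<Rightarrow> 'm"
  Tri :: "('o \<times> 'o \<times> 'o \<times> 'm \<times> 'm \<times> 'm) set"

locale triangulated_category = additive_category C
  for C :: "('o, 'm, 'z) tri_category_scheme" (structure) +
  assumes susp_ob: "X \<in> Ob C \<Longrightarrow> Susp C X \<in> Ob C"
    and susp_linear: "\<lbrakk>X \<in> Ob C; Y \<in> Ob C\<rbrakk>
      \<Longrightarrow> SuspM C \<in> module_hom class_ring (Hom C X Y) (Hom C (Susp C X) (Susp C Y))"
    and susp_id: "X \<in> Ob C \<Longrightarrow> SuspM C (Idn C X) = Idn C (Susp C X)"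
    and susp_comp: "\<lbrakk>X \<in> Ob C; Y \<in> Ob C; Z \<in> Ob C; f \<in> mor C X Y; g \<in> mor C Y Z\<rbrakk>
      \<Longrightarrow> SuspM C (g \<cdot> f) = SuspM C g \<cdot> SuspM C f"
    and susp_fully_faithful: "\<lbrakk>X \<in> Ob C; Y \<in> Ob C\<rbrakk>
      \<Longrightarrow> bij_betw (SuspM C) (mor C X Y) (mor C (Susp C X) (Susp C Y))"
    and susp_dense: "Y \<in> Ob C \<Longrightarrow> \<exists>X \<in> Ob C. isomorphic C (Susp C X) Y"
    and tri_typed: "(X, Y, Z, u, v, w) \<in> Tri C \<Longrightarrow>
      X \<in> Ob C \<and> Y \<in> Ob C \<and> Z \<in> Ob C \<and>
      u \<in> mor C X Y \<and> v \<in> mor C Y Z \<and> w \<in> mor C Z (Susp C X)"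
    and TR1_iso: "\<lbrakk>(X, Y, Z, u, v, w) \<in> Tri C; X' \<in> Ob C; Y' \<in> Ob C; Z' \<in> Ob C;
        u' \<in> mor C X' Y'; v' \<in> mor C Y' Z'; w' \<in> mor C Z' (Susp C X');
        is_iso C X X' a; is_iso C Y Y' b; is_iso C Z Z' c;
        b \<cdot> u = u' \<cdot> a; c \<cdot> v = v' \<cdot> b; SuspM C a \<cdot> w = w' \<cdot> c\<rbrakk>
      \<Longrightarrow> (X', Y', Z', u', v', w') \<in> Tri C"
    and TR1_id: "\<lbrakk>X \<in> Ob C; zero_object C Z\<rbrakk>
      \<Longrightarrow> (X, X, Z, Idn C X, zmor C X Z, zmor C Z (Susp C X)) \<in> Tri C"
    and TR1_cone: "\<lbrakk>X \<in> Ob C; Y \<in> Ob C; u \<in> mor C X Y\<rbrakk>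
      \<Longrightarrow> \<exists>Z v w. (X, Y, Z, u, v, w) \<in> Tri C"
    and TR2: "\<lbrakk>X \<in> Ob C; Y \<in> Ob C; Z \<in> Ob C;
        u \<in> mor C X Y; v \<in> mor C Y Z; w \<in> mor C Z (Susp C X)\<rbrakk>
      \<Longrightarrow> (X, Y, Z, u, v, w) \<in> Tri C \<longleftrightarrow>
        (Y, Z, Susp C X, v, w, \<ominus>\<^bsub>Hom C (Susp C X) (Susp C Y)\<^esub> SuspM C u) \<in> Tri C"
    and TR3: "\<lbrakk>(X, Y, Z, u, v, w) \<in> Tri C; (X', Y', Z', u', v', w') \<in> Tri C;
        a \<in> mor C X X'; b \<in> mor C Y Y'; b \<cdot> u = u' \<cdot> a\<rbrakk>
      \<Longrightarrow> \<exists>c \<in> mor C Z Z'. c \<cdot> v = v' \<cdot> b \<and> SuspM C a \<cdot> w = w' \<cdot> c"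
    and TR4: "\<lbrakk>(X, Y, Z', u, u1, u2) \<in> Tri C; (Y, Z, X', v, v1, v2) \<in> Tri C;
        (X, Z, Y', v \<cdot> u, w1, w2) \<in> Tri C\<rbrakk>
      \<Longrightarrow> \<exists>f g. (Z', Y', X', f, g, SuspM C u1 \<cdot> v2) \<in> Tri C \<and>
        f \<cdot> u1 = w1 \<cdot> v \<and> g \<cdot> w1 = v1 \<and> w2 \<cdot> f = u2 \<and> v2 \<cdot> g = SuspM C u \<cdot> w2"

definition linear_functionals :: "(complex, 'm) module \<Rightarrow> ('m \<Rightarrow> complex) set" where
  "linear_functionals V = {h \<in> extensional (carrier V).
    (\<forall>x \<in> carrier V. \<forall>y \<in> carrier V. h (x \<oplus>\<^bsub>V\<^esub> y) = h x + h y) \<and>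
    (\<forall>c. \<forall>x \<in> carrier V. h (c \<odot>\<^bsub>V\<^esub> x) = c * h x)}"

text \<open>
  The 2-Calabi-Yau property: linear isomorphisms \<open>\<eta> X Y\<close> from \<open>C(X, Y)\<close> onto the dual of
  \<open>C(Y, \<Sigma>\<Sigma>X)\<close>, natural in \<open>X\<close> and \<open>Y\<close>.
\<close>

definition two_calabi_yau :: "('o, 'm, 'z) tri_category_scheme \<Rightarrow> bool" where
  "two_calabi_yau C \<longleftrightarrow> (\<exists>\<eta> :: 'o \<Rightarrow> 'o \<Rightarrow> 'm \<Rightarrow> 'm \<Rightarrow> complex.
    (\<forall>X \<in> Ob C. \<forall>Y \<in> Ob C.
      bij_betw (\<eta> X Y) (mor C X Y) (linear_functionals (Hom C Y (Susp C (Susp C X)))) \<and>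
      (\<forall>f \<in> mor C X Y. \<forall>f' \<in> mor C X Y. \<forall>g \<in> mor C Y (Susp C (Susp C X)).
        \<eta> X Y (f \<oplus>\<^bsub>Hom C X Y\<^esub> f') g = \<eta> X Y f g + \<eta> X Y f' g) \<and>
      (\<forall>c. \<forall>f \<in> mor C X Y. \<forall>g \<in> mor C Y (Susp C (Susp C X)).
        \<eta> X Y (c \<odot>\<^bsub>Hom C X Y\<^esub> f) g = c * \<eta> X Y f g)) \<and>
    (\<forall>X \<in> Ob C. \<forall>Y \<in> Ob C. \<forall>X' \<in> Ob C. \<forall>Y' \<in> Ob C.
      \<forall>f \<in> mor C X Y. \<forall>a \<in> mor C Y Y'. \<forall>b \<in> mor C X' X. \<forall>g \<in> mor C Y' (Susp C (Susp C X')).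
        \<eta> X' Y' (a \<cdot>\<^bsub>C\<^esub> f \<cdot>\<^bsub>C\<^esub> b) g = \<eta> X Y f (SuspM C (SuspM C b) \<cdot>\<^bsub>C\<^esub> g \<cdot>\<^bsub>C\<^esub> a)))"

definition cluster_tilting :: "('o, 'm, 'z) tri_category_scheme \<Rightarrow> 'o \<Rightarrow> bool" where
  "cluster_tilting C T \<longleftrightarrow> T \<in> Ob C \<and>
    mor C T (Susp C T) = {zmor C T (Susp C T)} \<and>
    (\<forall>X \<in> Ob C. mor C T (Susp C X) = {zmor C T (Susp C X)} \<longrightarrow> X \<in> add_closure C T)"


section \<open>Exact and Frobenius categories\<close>

text \<open>
  A tuple \<open>(X, Y, Z, i, p)\<close> in \<open>Confl\<close> is a conflation (an admissible short exact sequence)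
  \<open>X \<rightarrow> Y \<rightarrow> Z\<close> with inflation \<open>i\<close> and deflation \<open>p\<close>.
\<close>

record ('o, 'm) exact_category = "('o, 'm) lin_category" +
  Confl :: "('o \<times> 'o \<times> 'o \<times> 'm \<times> 'm) set"

definition is_kernel :: "('o, 'm, 'z) lin_category_scheme \<Rightarrow> 'o \<Rightarrow> 'o \<Rightarrow> 'o \<Rightarrow> 'm \<Rightarrow> 'm \<Rightarrow> bool" where
  "is_kernel C X Y Z i p \<longleftrightarrow> i \<in> mor C X Y \<and> p \<in> mor C Y Z \<and> p \<cdot>\<^bsub>C\<^esub> i = zmor C X Z \<and>
    (\<forall>W \<in> Ob C. \<forall>f \<in> mor C W Y. p \<cdot>\<^bsub>C\<^esub> f = zmor C W Z \<longrightarrow>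
      (\<exists>!g. g \<in> mor C W X \<and> i \<cdot>\<^bsub>C\<^esub> g = f))"

definition is_cokernel :: "('o, 'm, 'z) lin_category_scheme \<Rightarrow> 'o \<Rightarrow> 'o \<Rightarrow> 'o \<Rightarrow> 'm \<Rightarrow> 'm \<Rightarrow> bool" where
  "is_cokernel C X Y Z i p \<longleftrightarrow> i \<in> mor C X Y \<and> p \<in> mor C Y Z \<and> p \<cdot>\<^bsub>C\<^esub> i = zmor C X Z \<and>
    (\<forall>W \<in> Ob C. \<forall>f \<in> mor C Y W. f \<cdot>\<^bsub>C\<^esub> i = zmor C X W \<longrightarrow>
      (\<exists>!g. g \<in> mor C Z W \<and> g \<cdot>\<^bsub>C\<^esub> p = f))"

text \<open>\<open>is_pushout C X Y X' Y' i f i' f'\<close>: the square with \<open>i : X \<rightarrow> Y\<close>, \<open>f : X \<rightarrow> X'\<close>,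
  \<open>i' : X' \<rightarrow> Y'\<close>, \<open>f' : Y \<rightarrow> Y'\<close> is cocartesian.\<close>

definition is_pushout ::
  "('o, 'm, 'z) lin_category_scheme \<Rightarrow> 'o \<Rightarrow> 'o \<Rightarrow> 'o \<Rightarrow> 'o \<Rightarrow> 'm \<Rightarrow> 'm \<Rightarrow> 'm \<Rightarrow> 'm \<Rightarrow> bool"
where
  "is_pushout C X Y X' Y' i f i' f' \<longleftrightarrow>
    {X, Y, X', Y'} \<subseteq> Ob C \<and> i \<in> mor C X Y \<and> f \<in> mor C X X' \<and> i' \<in> mor C X' Y' \<and> f' \<in> mor C Y Y' \<and>
    f' \<cdot>\<^bsub>C\<^esub> i = i' \<cdot>\<^bsub>C\<^esub> f \<and>
    (\<forall>W \<in> Ob C. \<forall>s \<in> mor C Y W. \<forall>t \<in> mor C X' W. s \<cdot>\<^bsub>C\<^esub> i = t \<cdot>\<^bsub>C\<^esub> f \<longrightarrow>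
      (\<exists>!h. h \<in> mor C Y' W \<and> h \<cdot>\<^bsub>C\<^esub> f' = s \<and> h \<cdot>\<^bsub>C\<^esub> i' = t))"

text \<open>\<open>is_pullback C Y Z Y' Z' p f p' f'\<close>: the square with \<open>p : Y \<rightarrow> Z\<close>, \<open>f : Z' \<rightarrow> Z\<close>,
  \<open>p' : Y' \<rightarrow> Z'\<close>, \<open>f' : Y' \<rightarrow> Y\<close> is cartesian.\<close>

definition is_pullback ::
  "('o, 'm, 'z) lin_category_scheme \<Rightarrow> 'o \<Rightarrow> 'o \<Rightarrow> 'o \<Rightarrow> 'o \<Rightarrow> 'm \<Rightarrow> 'm \<Rightarrow> 'm \<Rightarrow> 'm \<Rightarrow> bool"
where
  "is_pullback C Y Z Y' Z' p f p' f' \<longleftrightarrow>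
    {Y, Z, Y', Z'} \<subseteq> Ob C \<and> p \<in> mor C Y Z \<and> f \<in> mor C Z' Z \<and> p' \<in> mor C Y' Z' \<and> f' \<in> mor C Y' Y \<and>
    p \<cdot>\<^bsub>C\<^esub> f' = f \<cdot>\<^bsub>C\<^esub> p' \<and>
    (\<forall>W \<in> Ob C. \<forall>s \<in> mor C W Y. \<forall>t \<in> mor C W Z'. p \<cdot>\<^bsub>C\<^esub> s = f \<cdot>\<^bsub>C\<^esub> t \<longrightarrow>
      (\<exists>!h. h \<in> mor C W Y' \<and> f' \<cdot>\<^bsub>C\<^esub> h = s \<and> p' \<cdot>\<^bsub>C\<^esub> h = t))"

definition inflation :: "('o, 'm, 'z) exact_category_scheme \<Rightarrow> 'o \<Rightarrow> 'o \<Rightarrow> 'm \<Rightarrow> bool" where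
  "inflation E X Y i \<longleftrightarrow> (\<exists>Z p. (X, Y, Z, i, p) \<in> Confl E)"

definition deflation :: "('o, 'm, 'z) exact_category_scheme \<Rightarrow> 'o \<Rightarrow> 'o \<Rightarrow> 'm \<Rightarrow> bool" where
  "deflation E Y Z p \<longleftrightarrow> (\<exists>X i. (X, Y, Z, i, p) \<in> Confl E)"

locale exact_category = additive_category E
  for E :: "('o, 'm, 'z) exact_category_scheme" (structure) +
  assumes confl_kernel_cokernel: "(X, Y, Z, i, p) \<in> Confl E \<Longrightarrow>
      X \<in> Ob E \<and> Y \<in> Ob E \<and> Z \<in> Ob E \<and> is_kernel E X Y Z i p \<and> is_cokernel E X Y Z i p"
    and confl_iso: "\<lbrakk>(X, Y, Z, i, p) \<in> Confl E; X' \<in> Ob E; Y' \<in> Ob E; Z' \<in> Ob E;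
        i' \<in> mor E X' Y'; p' \<in> mor E Y' Z';
        is_iso E X X' a; is_iso E Y Y' b; is_iso E Z Z' c; b \<cdot> i = i' \<cdot> a; c \<cdot> p = p' \<cdot> b\<rbrakk>
      \<Longrightarrow> (X', Y', Z', i', p') \<in> Confl E"
    and id_inflation: "X \<in> Ob E \<Longrightarrow> inflation E X X (Idn E X)"
    and id_deflation: "X \<in> Ob E \<Longrightarrow> deflation E X X (Idn E X)"
    and inflation_comp: "\<lbrakk>inflation E X Y i; inflation E Y Z j\<rbrakk> \<Longrightarrow> inflation E X Z (j \<cdot> i)"
    and deflation_comp: "\<lbrakk>deflation E X Y p; deflation E Y Z q\<rbrakk> \<Longrightarrow> deflation E X Z (q \<cdot> p)"
    and inflation_pushout: "\<lbrakk>inflation E X Y i; X' \<in> Ob E; f \<in> mor E X X'\<rbrakk>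
      \<Longrightarrow> \<exists>Y' i' f'. is_pushout E X Y X' Y' i f i' f' \<and> inflation E X' Y' i'"
    and deflation_pullback: "\<lbrakk>deflation E Y Z p; Z' \<in> Ob E; f \<in> mor E Z' Z\<rbrakk>
      \<Longrightarrow> \<exists>Y' p' f'. is_pullback E Y Z Y' Z' p f p' f' \<and> deflation E Y' Z' p'"

definition projective_object :: "('o, 'm, 'z) exact_category_scheme \<Rightarrow> 'o \<Rightarrow> bool" where
  "projective_object E P \<longleftrightarrow> P \<in> Ob E \<and>
    (\<forall>Y Z p. deflation E Y Z p \<longrightarrow> (\<forall>f \<in> mor E P Z. \<exists>g \<in> mor E P Y. p \<cdot>\<^bsub>E\<^esub> g = f))"

definition injective_object :: "('o, 'm, 'z) exact_category_scheme \<Rightarrow> 'o \<Rightarrow> bool" where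
  "injective_object E J \<longleftrightarrow> J \<in> Ob E \<and>
    (\<forall>X Y i. inflation E X Y i \<longrightarrow> (\<forall>f \<in> mor E X J. \<exists>g \<in> mor E Y J. g \<cdot>\<^bsub>E\<^esub> i = f))"

locale frobenius_category = exact_category +
  assumes enough_projectives: "X \<in> Ob E \<Longrightarrow> \<exists>P p. projective_object E P \<and> deflation E P X p"
    and enough_injectives: "X \<in> Ob E \<Longrightarrow> \<exists>J i. injective_object E J \<and> inflation E X J i"
    and projective_iff_injective: "projective_object E X \<longleftrightarrow> injective_object E X"


section \<open>The stable category of a Frobenius category\<close>

text \<open>
  The suspension depends on the choice, for every object \<open>X\<close>, of a conflation
  \<open>X \<rightarrow> J X \<rightarrow> \<Sigma>X\<close> with injective middle term.
\<close>

record ('o, 'm) susp_choice =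
  inj_ob :: "'o \<Rightarrow> 'o"
  susp_ob :: "'o \<Rightarrow> 'o"
  inj_map :: "'o \<Rightarrow> 'm"
  susp_map :: "'o \<Rightarrow> 'm"

definition valid_susp_choice ::
  "('o, 'm, 'z) exact_category_scheme \<Rightarrow> ('o, 'm) susp_choice \<Rightarrow> bool" where
  "valid_susp_choice E S \<longleftrightarrow> (\<forall>X \<in> Ob E. injective_object E (inj_ob S X) \<and>
    (X, inj_ob S X, susp_ob S X, inj_map S X, susp_map S X) \<in> Confl E)"

definition inj_factoring :: "('o, 'm, 'z) exact_category_scheme \<Rightarrow> 'o \<Rightarrow> 'o \<Rightarrow> 'm set" where
  "inj_factoring E X Y = {h \<cdot>\<^bsub>E\<^esub> g | g h J. injective_object E J \<and> g \<in> mor E X J \<and> h \<in> mor E J Y}"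

text \<open>
  A morphism of the stable category is a coset modulo the morphisms factoring through an
  injective object, tagged with its domain and codomain. Operations are computed on
  representatives.
\<close>

type_synonym ('o, 'm) stable_mor = "'o \<times> 'o \<times> 'm set"

definition stable_class :: "('o, 'm, 'z) exact_category_scheme \<Rightarrow> 'o \<Rightarrow> 'o \<Rightarrow> 'm \<Rightarrow> ('o, 'm) stable_mor" where
  "stable_class E X Y f = (X, Y, inj_factoring E X Y +>\<^bsub>Hom E X Y\<^esub> f)"

definition stable_rep :: "('o, 'm) stable_mor \<Rightarrow> 'm" where
  "stable_rep a = (SOME f. f \<in> snd (snd a))"

definition stable_hom ::
  "('o, 'm, 'z) exact_category_scheme \<Rightarrow> 'o \<Rightarrow> 'o \<Rightarrow> (complex, ('o, 'm) stable_mor) module" where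
  "stable_hom E X Y = \<lparr>carrier = stable_class E X Y ` mor E X Y,
    mult = (\<lambda>_ _. stable_class E X Y (zmor E X Y)),
    one = stable_class E X Y (zmor E X Y),
    zero = stable_class E X Y (zmor E X Y),
    add = (\<lambda>a b. stable_class E X Y (stable_rep a \<oplus>\<^bsub>Hom E X Y\<^esub> stable_rep b)),
    smult = (\<lambda>c a. stable_class E X Y (c \<odot>\<^bsub>Hom E X Y\<^esub> stable_rep a))\<rparr>"

definition stable_lin :: "('o, 'm, 'z) exact_category_scheme \<Rightarrow> ('o, ('o, 'm) stable_mor) lin_category" where
  "stable_lin E = \<lparr>Ob = Ob E, Hom = stable_hom E,
    Comp = (\<lambda>b a. stable_class E (fst a) (fst (snd b)) (stable_rep b \<cdot>\<^bsub>E\<^esub> stable_rep a)),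
    Idn = (\<lambda>X. stable_class E X X (Idn E X))\<rparr>"

text \<open>\<open>\<Sigma>\<close> on morphisms: extend \<open>f : X \<rightarrow> Y\<close> to a morphism \<open>(f, g, h)\<close> between the chosen conflations
  and take the class of \<open>h\<close>, which does not depend on the choices.\<close>

definition stable_suspM ::
  "('o, 'm, 'z) exact_category_scheme \<Rightarrow> ('o, 'm) susp_choice \<Rightarrow> ('o, 'm) stable_mor \<Rightarrow> ('o, 'm) stable_mor"
where
  "stable_suspM E S a = (let X = fst a; Y = fst (snd a); f = stable_rep a in
    stable_class E (susp_ob S X) (susp_ob S Y)
      (SOME h. h \<in> mor E (susp_ob S X) (susp_ob S Y) \<and>
        (\<exists>g \<in> mor E (inj_ob S X) (inj_ob S Y).
          g \<cdot>\<^bsub>E\<^esub> inj_map S X = inj_map S Y \<cdot>\<^bsub>E\<^esub> f \<and> h \<cdot>\<^bsub>E\<^esub> susp_map S X = susp_map S Y \<cdot>\<^bsub>E\<^esub> g)))"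

text \<open>Happel's standard triangles: \<open>Z\<close> is the pushout of the chosen inflation \<open>X \<rightarrow> J X\<close> along
  \<open>u : X \<rightarrow> Y\<close>, and \<open>w : Z \<rightarrow> \<Sigma>X\<close> is induced by \<open>J X \<rightarrow> \<Sigma>X\<close> and \<open>0 : Y \<rightarrow> \<Sigma>X\<close>.\<close>

definition standard_triangles ::
  "('o, 'm, 'z) exact_category_scheme \<Rightarrow> ('o, 'm) susp_choice \<Rightarrow>
    ('o \<times> 'o \<times> 'o \<times> ('o, 'm) stable_mor \<times> ('o, 'm) stable_mor \<times> ('o, 'm) stable_mor) set"
where
  "standard_triangles E S =
    {(X, Y, Z, stable_class E X Y u, stable_class E Y Z v, stable_class E Z (susp_ob S X) w) | X Y Z u v w.
      \<exists>t. is_pushout E X (inj_ob S X) Y Z (inj_map S X) u v t \<and>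
        w \<in> mor E Z (susp_ob S X) \<and> w \<cdot>\<^bsub>E\<^esub> t = susp_map S X \<and> w \<cdot>\<^bsub>E\<^esub> v = zmor E Y (susp_ob S X)}"

definition stable_triangles ::
  "('o, 'm, 'z) exact_category_scheme \<Rightarrow> ('o, 'm) susp_choice \<Rightarrow>
    ('o \<times> 'o \<times> 'o \<times> ('o, 'm) stable_mor \<times> ('o, 'm) stable_mor \<times> ('o, 'm) stable_mor) set"
where
  "stable_triangles E S =
    {(X, Y, Z, u, v, w). X \<in> Ob E \<and> Y \<in> Ob E \<and> Z \<in> Ob E \<and>
      u \<in> mor (stable_lin E) X Y \<and> v \<in> mor (stable_lin E) Y Z \<and>
      w \<in> mor (stable_lin E) Z (susp_ob S X) \<and>
      (\<exists>X' Y' Z' u' v' w' a b c. (X', Y', Z', u', v', w') \<in> standard_triangles E S \<and>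
        is_iso (stable_lin E) X X' a \<and> is_iso (stable_lin E) Y Y' b \<and> is_iso (stable_lin E) Z Z' c \<and>
        b \<cdot>\<^bsub>stable_lin E\<^esub> u = u' \<cdot>\<^bsub>stable_lin E\<^esub> a \<and>
        c \<cdot>\<^bsub>stable_lin E\<^esub> v = v' \<cdot>\<^bsub>stable_lin E\<^esub> b \<and>
        stable_suspM E S a \<cdot>\<^bsub>stable_lin E\<^esub> w = w' \<cdot>\<^bsub>stable_lin E\<^esub> c)}"

definition stable_category ::
  "('o, 'm, 'z) exact_category_scheme \<Rightarrow> ('o, 'm) susp_choice \<Rightarrow> ('o, ('o, 'm) stable_mor) tri_category"
where
  "stable_category E S = \<lparr>Ob = Ob (stable_lin E), Hom = Hom (stable_lin E),
    Comp = Comp (stable_lin E), Idn = Idn (stable_lin E),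
    Susp = susp_ob S, SuspM = stable_suspM E S, Tri = stable_triangles E S\<rparr>"


section \<open>Varieties and constructible maps\<close>

text \<open>
  Varieties are treated as spaces with functions: a topological space together with the set of
  regular functions on every open subset. Only the values of a regular function on the open
  subset matter.
\<close>

record 'p fun_space =
  Top :: "'p topology"
  Reg :: "'p set \<Rightarrow> ('p \<Rightarrow> complex) set"

inductive_set poly_functions :: "('p \<Rightarrow> complex) set \<Rightarrow> ('p \<Rightarrow> complex) set"
  for G :: "('p \<Rightarrow> complex) set" where
  const: "(\<lambda>_. c) \<in> poly_functions G"
| coord: "f \<in> G \<Longrightarrow> f \<in> poly_functions G"
| add: "\<lbrakk>f \<in> poly_functions G; g \<in> poly_functions G\<rbrakk> \<Longrightarrow> (\<lambda>x. f x + g x) \<in> poly_functions G"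
| mult: "\<lbrakk>f \<in> poly_functions G; g \<in> poly_functions G\<rbrakk> \<Longrightarrow> (\<lambda>x. f x * g x) \<in> poly_functions G"

text \<open>The structure of an affine variety on a set \<open>P\<close> with coordinate functions \<open>G\<close>: the Zariski
  topology, and as regular functions those that are locally quotients of polynomials in the
  coordinates. The coordinate functions may be linearly dependent.\<close>

definition affine_structure :: "'p set \<Rightarrow> ('p \<Rightarrow> complex) set \<Rightarrow> 'p fun_space" where
  "affine_structure P G = (let T = topology_generated_by {{x \<in> P. f x \<noteq> 0} | f. f \<in> poly_functions G} in
    \<lparr>Top = T,
     Reg = (\<lambda>U. {f. \<forall>x \<in> U. \<exists>V. openin T V \<and> x \<in> V \<and> V \<subseteq> U \<and>
       (\<exists>g \<in> poly_functions G. \<exists>h \<in> poly_functions G. \<forall>y \<in> V. h y \<noteq> 0 \<and> f y = g y / h y)})\<rparr>)"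

definition affine_space :: "(complex, 'm) module \<Rightarrow> 'm fun_space" where
  "affine_space V = affine_structure (carrier V) (linear_functionals V)"

definition induced_structure :: "'p fun_space \<Rightarrow> 'p set \<Rightarrow> 'p fun_space" where
  "induced_structure X A = \<lparr>Top = subtopology (Top X) A,
    Reg = (\<lambda>U. {f. \<forall>x \<in> U. \<exists>V. openin (Top X) V \<and> x \<in> V \<and> V \<inter> A \<subseteq> U \<and>
      (\<exists>g \<in> Reg X V. \<forall>y \<in> V \<inter> A. f y = g y)})\<rparr>"

definition coproduct :: "'i set \<Rightarrow> ('i \<Rightarrow> 'p fun_space) \<Rightarrow> ('i \<times> 'p) fun_space" where
  "coproduct I X = \<lparr>Top = sum_topology (\<lambda>i. Top (X i)) I,
    Reg = (\<lambda>U. {f. \<forall>i \<in> I. (\<lambda>x. f (i, x)) \<in> Reg (X i) {x. (i, x) \<in> U}})\<rparr>"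

definition morphism :: "'p fun_space \<Rightarrow> 'q fun_space \<Rightarrow> ('p \<Rightarrow> 'q) \<Rightarrow> bool" where
  "morphism X Y f \<longleftrightarrow> continuous_map (Top X) (Top Y) f \<and>
    (\<forall>V. openin (Top Y) V \<longrightarrow> (\<forall>g \<in> Reg Y V. g \<circ> f \<in> Reg X {x \<in> topspace (Top X). f x \<in> V}))"

definition locally_closed_in :: "'p topology \<Rightarrow> 'p set \<Rightarrow> bool" where
  "locally_closed_in T A \<longleftrightarrow> (\<exists>U K. openin T U \<and> closedin T K \<and> A = U \<inter> K)"

definition constructible_map :: "'p fun_space \<Rightarrow> 'q fun_space \<Rightarrow> ('p \<Rightarrow> 'q) \<Rightarrow> bool" where
  "constructible_map X Y f \<longleftrightarrow> (\<exists>\<A>. finite \<A> \<and> pairwise disjnt \<A> \<and> \<Union>\<A> = topspace (Top X) \<and>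
    (\<forall>A \<in> \<A>. locally_closed_in (Top X) A \<and> morphism (induced_structure X A) Y f))"


section \<open>Representations of quivers in modules over an algebra\<close>

text \<open>A right module structure on the space of column vectors of length \<open>n\<close> is given by the matrices
  \<open>\<rho> b\<close> of the maps \<open>v \<mapsto> v b\<close>; hence \<open>\<rho>\<close> reverses products.\<close>

definition right_module_structure ::
  "(complex, 'b) module \<Rightarrow> nat \<Rightarrow> ('b \<Rightarrow> complex mat) \<Rightarrow> bool" where
  "right_module_structure B n \<rho> \<longleftrightarrow> \<rho> \<in> carrier B \<rightarrow>\<^sub>E carrier_mat n n \<and>
    (\<forall>b \<in> carrier B. \<forall>b' \<in> carrier B. \<rho> (b \<oplus>\<^bsub>B\<^esub> b') = \<rho> b + \<rho> b') \<and>
    (\<forall>c. \<forall>b \<in> carrier B. \<rho> (c \<odot>\<^bsub>B\<^esub> b) = c \<cdot>\<^sub>m \<rho> b) \<and>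
    (\<forall>b \<in> carrier B. \<forall>b' \<in> carrier B. \<rho> (b \<otimes>\<^bsub>B\<^esub> b') = \<rho> b' * \<rho> b) \<and>
    \<rho> \<one>\<^bsub>B\<^esub> = 1\<^sub>m n"

text \<open>A point of \<open>rep\<^sub>d BQ\<close> is a pair of the module structures at the vertices and the matrices at the
  arrows.\<close>

type_synonym ('v, 'a, 'b) rep_point = "('v \<Rightarrow> 'b \<Rightarrow> complex mat) \<times> ('a \<Rightarrow> complex mat)"

definition rep_set ::
  "(complex, 'b) module \<Rightarrow> ('v, 'a) pre_digraph \<Rightarrow> ('v \<Rightarrow> nat) \<Rightarrow> ('v, 'a, 'b) rep_point set" where
  "rep_set B Q d = {(\<rho>, A). \<rho> \<in> extensional (verts Q) \<and> A \<in> extensional (arcs Q) \<and>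
    (\<forall>i \<in> verts Q. right_module_structure B (d i) (\<rho> i)) \<and>
    (\<forall>a \<in> arcs Q. A a \<in> carrier_mat (d (head Q a)) (d (tail Q a)) \<and>
      (\<forall>b \<in> carrier B. A a * \<rho> (tail Q a) b = \<rho> (head Q a) b * A a))}"

definition rep_coordinates ::
  "(complex, 'b) module \<Rightarrow> ('v, 'a) pre_digraph \<Rightarrow> ('v \<Rightarrow> nat) \<Rightarrow> (('v, 'a, 'b) rep_point \<Rightarrow> complex) set"
where
  "rep_coordinates B Q d =
    {\<lambda>x. fst x i b $$ (p, q) | i b p q. i \<in> verts Q \<and> b \<in> carrier B \<and> p < d i \<and> q < d i} \<union>
    {\<lambda>x. snd x a $$ (p, q) | a p q. a \<in> arcs Q \<and> p < d (head Q a) \<and> q < d (tail Q a)}"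

definition rep_variety ::
  "(complex, 'b) module \<Rightarrow> ('v, 'a) pre_digraph \<Rightarrow> ('v \<Rightarrow> nat) \<Rightarrow> ('v, 'a, 'b) rep_point fun_space" where
  "rep_variety B Q d = affine_structure (rep_set B Q d) (rep_coordinates B Q d)"

text \<open>\<open>h i\<close> is the inverse of \<open>g i\<close>.\<close>

definition GL_orbit ::
  "(complex, 'b) module \<Rightarrow> ('v, 'a) pre_digraph \<Rightarrow> ('v \<Rightarrow> nat) \<Rightarrow> ('v, 'a, 'b) rep_point \<Rightarrow>
    ('v, 'a, 'b) rep_point set"
where
  "GL_orbit B Q d x =
    {(\<lambda>i \<in> verts Q. \<lambda>b \<in> carrier B. g i * fst x i b * h i,
      \<lambda>a \<in> arcs Q. g (head Q a) * snd x a * h (tail Q a)) | g h.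
      \<forall>i \<in> verts Q. g i \<in> carrier_mat (d i) (d i) \<and> h i \<in> carrier_mat (d i) (d i) \<and>
        g i * h i = 1\<^sub>m (d i) \<and> h i * g i = 1\<^sub>m (d i)}"

text \<open>A representation of a quiver in right \<open>B\<close>-modules, without a choice of bases.\<close>

record ('v, 'a, 'b, 'w) representation =
  space_at :: "'v \<Rightarrow> (complex, 'w) module"
  act_at :: "'v \<Rightarrow> 'w \<Rightarrow> 'b \<Rightarrow> 'w"
  map_at :: "'a \<Rightarrow> 'w \<Rightarrow> 'w"

definition dimension_vector ::
  "('v, 'a) pre_digraph \<Rightarrow> ('v, 'a, 'b, 'w) representation \<Rightarrow> 'v \<Rightarrow> nat" where
  "dimension_vector Q R = (\<lambda>i \<in> verts Q. vdim (space_at R i))"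

definition ordered_basis :: "(complex, 'w) module \<Rightarrow> nat \<Rightarrow> (nat \<Rightarrow> 'w) \<Rightarrow> bool" where
  "ordered_basis V n \<beta> \<longleftrightarrow> inj_on \<beta> {..<n} \<and> vectorspace.basis class_ring V (\<beta> ` {..<n})"

text \<open>\<open>A\<close> is the matrix of \<open>f\<close> with respect to the basis \<open>\<beta>\<close> of the source and the basis \<open>\<gamma>\<close> of the
  target \<open>W\<close>.\<close>

definition is_matrix_of ::
  "nat \<Rightarrow> (nat \<Rightarrow> 'u) \<Rightarrow> (complex, 'w) module \<Rightarrow> nat \<Rightarrow> (nat \<Rightarrow> 'w) \<Rightarrow> ('u \<Rightarrow> 'w) \<Rightarrow> complex mat \<Rightarrow> bool"
where
  "is_matrix_of n \<beta> W m \<gamma> f A \<longleftrightarrow> A \<in> carrier_mat m n \<and>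
    (\<forall>q<n. f (\<beta> q) = (\<Oplus>\<^bsub>W\<^esub>p\<in>{..<m}. A $$ (p, q) \<odot>\<^bsub>W\<^esub> \<gamma> p))"

definition coordinate_point ::
  "(complex, 'b) module \<Rightarrow> ('v, 'a) pre_digraph \<Rightarrow> ('v \<Rightarrow> nat) \<Rightarrow> ('v, 'a, 'b, 'w) representation \<Rightarrow>
    ('v \<Rightarrow> nat \<Rightarrow> 'w) \<Rightarrow> ('v, 'a, 'b) rep_point \<Rightarrow> bool"
where
  "coordinate_point B Q d R \<beta> x \<longleftrightarrow> x \<in> rep_set B Q d \<and>
    (\<forall>i \<in> verts Q. ordered_basis (space_at R i) (d i) (\<beta> i)) \<and>
    (\<forall>i \<in> verts Q. \<forall>b \<in> carrier B.
      is_matrix_of (d i) (\<beta> i) (space_at R i) (d i) (\<beta> i) (\<lambda>v. act_at R i v b) (fst x i b)) \<and>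
    (\<forall>a \<in> arcs Q.
      is_matrix_of (d (tail Q a)) (\<beta> (tail Q a)) (space_at R (head Q a)) (d (head Q a)) (\<beta> (head Q a))
        (map_at R a) (snd x a))"

definition representation_orbit ::
  "(complex, 'b) module \<Rightarrow> ('v, 'a) pre_digraph \<Rightarrow> ('v, 'a, 'b, 'w) representation \<Rightarrow>
    ('v, 'a, 'b) rep_point set"
where
  "representation_orbit B Q R = {y. \<exists>\<beta> x. coordinate_point B Q (dimension_vector Q R) R \<beta> x \<and>
    y \<in> GL_orbit B Q (dimension_vector Q R) x}"

definition A4_quiver :: "(nat, nat) pre_digraph" where
  "A4_quiver = \<lparr>verts = {1, 2, 3, 4}, arcs = {1, 2, 3}, tail = (\<lambda>a. a), head = (\<lambda>a. a + 1)\<rparr>"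

text \<open>The representation of \<open>1 \<rightarrow> 2 \<rightarrow> 3 \<rightarrow> 4\<close> obtained by applying \<open>C(T, ?)\<close> to a sequence
  \<open>M \<rightarrow> Y \<rightarrow> L \<rightarrow> N\<close>; the endomorphism algebra of \<open>T\<close> acts on the right by precomposition.\<close>

definition hom_representation ::
  "('o, 'm, 'z) lin_category_scheme \<Rightarrow> 'o \<Rightarrow> 'o \<Rightarrow> 'o \<Rightarrow> 'o \<Rightarrow> 'o \<Rightarrow> 'm \<Rightarrow> 'm \<Rightarrow> 'm \<Rightarrow>
    (nat, nat, 'm, 'm) representation"
where
  "hom_representation C T M Y L N i p e =
    \<lparr>space_at = (\<lambda>v. Hom C T (if v = 1 then M else if v = 2 then Y else if v = 3 then L else N)),
     act_at = (\<lambda>_ x b. x \<cdot>\<^bsub>C\<^esub> b),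
     map_at = (\<lambda>a x. (if a = 1 then i else if a = 2 then p else e) \<cdot>\<^bsub>C\<^esub> x)\<rparr>"

definition dim_vectors :: "('o, 'm, 'z) tri_category_scheme \<Rightarrow> 'o \<Rightarrow> 'o \<Rightarrow> 'o \<Rightarrow> (nat \<Rightarrow> nat) set" where
  "dim_vectors C T L M = {d \<in> {1, 2, 3, 4} \<rightarrow>\<^sub>E UNIV.
    d 1 = vdim (Hom C T M) \<and> d 3 = vdim (Hom C T L) \<and> d 2 \<le> d 1 + d 3 \<and>
    d 4 = vdim (Hom C T (Susp C M))}"

end

theory Submission
  imports Defs
begin

text \<open>
  Write \<open>F = C(T, ?)\<close>. For fixed objects \<open>L\<close> and \<open>M\<close> the middle term of a triangle
  \<open>M \<rightarrow> Y \<rightarrow> L \<rightarrow> \<Sigma>M\<close> varies with the third map \<open>\<epsilon>\<close>; the point is to describe the module \<open>F Y\<close>, with its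
  maps from \<open>F M\<close> and to \<open>F L\<close>, by linear algebra with coefficients that depend on \<open>\<epsilon>\<close> in an algebraic
  way. The Frobenius category \<open>E\<close> makes this possible.

  Lift \<open>\<epsilon>\<close> linearly to a morphism \<open>\<sigma> \<epsilon> : L \<rightarrow> \<Sigma>M\<close> of \<open>E\<close> with stable class \<open>-\<epsilon>\<close>, and let \<open>\<pi> : J M \<rightarrow> \<Sigma>M\<close> be
  the deflation with injective middle term that defines \<open>\<Sigma>M\<close>. The pullback \<open>Y\<close> of \<open>\<pi>\<close> along \<open>\<sigma> \<epsilon>\<close> is the
  middle term of a triangle over \<open>\<epsilon>\<close> (\<open>pullback_of_susp_map\<close>). By its universal property,
  \<open>E(W, Y)\<close> consists of the pairs \<open>(a, j)\<close> in \<open>E(W, L) \<times> E(W, J M)\<close> with \<open>\<pi> j = \<sigma> \<epsilon> a\<close>, and \<open>C(T, Y)\<close> is the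
  quotient of \<open>E(T, Y)\<close> by the image of \<open>E(J T, Y)\<close>. So \<open>F Y\<close> is a kernel modulo the image of a kernel, where
  the entries of all matrices are affine functions of \<open>\<epsilon>\<close>.

  Bases and matrices for such spaces are found by Gaussian elimination, which uses field operations
  and tests for zero. The functions of \<open>\<epsilon>\<close> that arise are \<open>piecewise_rational\<close>: they form the closure of
  the coordinates under ring operations and the total inverse, and \<open>equations_general_solution\<close> shows
  that linear systems over them can be solved within this class. Finitely many of them can be written
  as quotients of polynomials on the pieces of one finite partition into locally closed sets
  (\<open>piecewise_rational_common_sign_classes\<close>), which is what constructibility of a map requires
  (\<open>constructible_mapI\<close>). The locale \<open>rational_bundle\<close> isolates what has to be known of a family of vector
  spaces in order to choose bases in this way, and \<open>exists_constructible_coordinates\<close> makes the choice for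
  all vertices and arrows of a quiver simultaneously.

  Two questions remain. A different triangle over \<open>\<epsilon>\<close> gives an isomorphic representation, because the
  two triangles are connected by a morphism that is the identity on \<open>M\<close> and \<open>L\<close>, and \<open>F\<close> of its middle
  component is bijective by exactness (\<open>triangle_comparison_bij\<close>). The bound on the dimension of \<open>F Y\<close> is
  also a consequence of the exactness of \<open>F M \<rightarrow> F Y \<rightarrow> F L\<close> (\<open>triangle_dim_le\<close>).
\<close>

section \<open>Piecewise rational functions\<close>

text \<open>Division is total, with \<open>inverse 0 = 0\<close>. Hence \<open>f x * inverse (f x)\<close> is the indicator function of
  \<open>f x \<noteq> 0\<close>, and the class is closed under case distinctions on the vanishing of its members: a
  procedure that uses only field operations and tests for zero, such as Gaussian elimination,
  stays inside it.\<close>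

inductive_set piecewise_rational :: "('p \<Rightarrow> complex) set \<Rightarrow> ('p \<Rightarrow> complex) set"
  for G :: "('p \<Rightarrow> complex) set" where
  const: "(\<lambda>_. c) \<in> piecewise_rational G"
| coord: "f \<in> G \<Longrightarrow> f \<in> piecewise_rational G"
| add: "\<lbrakk>f \<in> piecewise_rational G; g \<in> piecewise_rational G\<rbrakk>
    \<Longrightarrow> (\<lambda>x. f x + g x) \<in> piecewise_rational G"
| mult: "\<lbrakk>f \<in> piecewise_rational G; g \<in> piecewise_rational G\<rbrakk>
    \<Longrightarrow> (\<lambda>x. f x * g x) \<in> piecewise_rational G"
| inverse: "f \<in> piecewise_rational G \<Longrightarrow> (\<lambda>x. inverse (f x)) \<in> piecewise_rational G"

lemma piecewise_rational_uminus:
  "f \<in> piecewise_rational G \<Longrightarrow> (\<lambda>x. - f x) \<in> piecewise_rational G"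
  using piecewise_rational.mult[OF piecewise_rational.const[of "-1"], of f] by simp

lemma piecewise_rational_diff:
  "\<lbrakk>f \<in> piecewise_rational G; g \<in> piecewise_rational G\<rbrakk>
    \<Longrightarrow> (\<lambda>x. f x - g x) \<in> piecewise_rational G"
  using piecewise_rational.add[of f G "\<lambda>x. - g x"] piecewise_rational_uminus[of g G] by simp

lemma piecewise_rational_sum:
  "(\<And>k. k \<in> K \<Longrightarrow> f k \<in> piecewise_rational G) \<Longrightarrow> (\<lambda>x. \<Sum>k\<in>K. f k x) \<in> piecewise_rational G"
  by (induction K rule: infinite_finite_induct)
    (auto intro: piecewise_rational.const piecewise_rational.add)

lemmas piecewise_rational_intros =
  piecewise_rational.const piecewise_rational.add piecewise_rational.mult piecewise_rational.inverse
  piecewise_rational_uminus piecewise_rational_diff piecewise_rational_sum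

lemma poly_functions_prod:
  "(\<And>k. k \<in> K \<Longrightarrow> f k \<in> poly_functions G) \<Longrightarrow> (\<lambda>x. \<Prod>k\<in>K. f k x) \<in> poly_functions G"
  by (induction K rule: infinite_finite_induct)
    (auto intro: poly_functions.const poly_functions.mult)

definition quotients_on :: "('p \<Rightarrow> complex) set \<Rightarrow> 'p set \<Rightarrow> ('p \<Rightarrow> complex) set" where
  "quotients_on G A = {f. \<exists>g \<in> poly_functions G. \<exists>h \<in> poly_functions G. \<forall>x \<in> A. h x \<noteq> 0 \<and> f x = g x / h x}"

lemma quotients_onI:
  "\<lbrakk>g \<in> poly_functions G; h \<in> poly_functions G; \<And>x. x \<in> A \<Longrightarrow> h x \<noteq> 0 \<and> f x = g x / h x\<rbrakk>
    \<Longrightarrow> f \<in> quotients_on G A"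
  unfolding quotients_on_def by blast

lemma quotients_onE:
  assumes "f \<in> quotients_on G A"
  obtains g h where "g \<in> poly_functions G" "h \<in> poly_functions G"
    "\<And>x. x \<in> A \<Longrightarrow> h x \<noteq> 0" "\<And>x. x \<in> A \<Longrightarrow> f x = g x / h x"
  using assms unfolding quotients_on_def by blast

lemma quotients_on_mono: "\<lbrakk>f \<in> quotients_on G A; B \<subseteq> A\<rbrakk> \<Longrightarrow> f \<in> quotients_on G B"
  unfolding quotients_on_def by blast

lemma quotients_on_cong:
  assumes "f \<in> quotients_on G A" "\<And>x. x \<in> A \<Longrightarrow> f x = f' x"
  shows "f' \<in> quotients_on G A"
  using assms unfolding quotients_on_def by (smt (verit, ccfv_threshold) mem_Collect_eq)

lemma quotients_on_poly: "f \<in> poly_functions G \<Longrightarrow> f \<in> quotients_on G A"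
  by (rule quotients_onI[of f _ "\<lambda>_. 1"]) (auto intro: poly_functions.const)

lemma quotients_on_add:
  assumes "f \<in> quotients_on G A" "f' \<in> quotients_on G A"
  shows "(\<lambda>x. f x + f' x) \<in> quotients_on G A"
proof -
  obtain g h where 1: "g \<in> poly_functions G" "h \<in> poly_functions G"
    "\<And>x. x \<in> A \<Longrightarrow> h x \<noteq> 0" "\<And>x. x \<in> A \<Longrightarrow> f x = g x / h x"
    using assms(1) by (rule quotients_onE) blast
  obtain g' h' where 2: "g' \<in> poly_functions G" "h' \<in> poly_functions G"
    "\<And>x. x \<in> A \<Longrightarrow> h' x \<noteq> 0" "\<And>x. x \<in> A \<Longrightarrow> f' x = g' x / h' x"
    using assms(2) by (rule quotients_onE) blast
  show ?thesis
    by (rule quotients_onI[of "\<lambda>x. g x * h' x + g' x * h x" _ "\<lambda>x. h x * h' x"])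
      (use 1 2 in \<open>auto intro!: poly_functions.add poly_functions.mult simp: field_simps\<close>)
qed

lemma quotients_on_mult:
  assumes "f \<in> quotients_on G A" "f' \<in> quotients_on G A"
  shows "(\<lambda>x. f x * f' x) \<in> quotients_on G A"
proof -
  obtain g h where 1: "g \<in> poly_functions G" "h \<in> poly_functions G"
    "\<And>x. x \<in> A \<Longrightarrow> h x \<noteq> 0" "\<And>x. x \<in> A \<Longrightarrow> f x = g x / h x"
    using assms(1) by (rule quotients_onE) blast
  obtain g' h' where 2: "g' \<in> poly_functions G" "h' \<in> poly_functions G"
    "\<And>x. x \<in> A \<Longrightarrow> h' x \<noteq> 0" "\<And>x. x \<in> A \<Longrightarrow> f' x = g' x / h' x"
    using assms(2) by (rule quotients_onE) blast
  show ?thesis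
    by (rule quotients_onI[of "\<lambda>x. g x * g' x" _ "\<lambda>x. h x * h' x"])
      (use 1 2 in \<open>auto intro!: poly_functions.mult\<close>)
qed

lemma quotients_on_const: "(\<lambda>_. c) \<in> quotients_on G A"
  by (intro quotients_on_poly poly_functions.const)

lemma quotients_on_sum:
  "(\<And>k. k \<in> K \<Longrightarrow> f k \<in> quotients_on G A) \<Longrightarrow> (\<lambda>x. \<Sum>k\<in>K. f k x) \<in> quotients_on G A"
  by (induction K rule: infinite_finite_induct) (auto intro: quotients_on_const quotients_on_add)

lemma quotients_on_poly_comp:
  assumes "\<And>g. g \<in> G' \<Longrightarrow> (\<lambda>x. g (f x)) \<in> quotients_on G A" "p \<in> poly_functions G'"
  shows "(\<lambda>x. p (f x)) \<in> quotients_on G A"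
  using assms(2) by induction
    (auto intro: quotients_on_const quotients_on_add quotients_on_mult assms(1))

text \<open>The pieces on which piecewise rational functions become honest quotients: two points lie in the
  same piece if the same members of \<open>\<P>\<close> vanish at them. Enlarging \<open>\<P>\<close> refines the pieces, so that
  finitely many functions can be treated at once.\<close>

definition sign_class :: "'p set \<Rightarrow> ('p \<Rightarrow> complex) set \<Rightarrow> 'p \<Rightarrow> 'p set" where
  "sign_class P \<P> y = {x \<in> P. \<forall>p \<in> \<P>. p x = 0 \<longleftrightarrow> p y = 0}"

lemma sign_class_mono: "\<P> \<subseteq> \<P>' \<Longrightarrow> sign_class P \<P>' y \<subseteq> sign_class P \<P> y"
  by (auto simp: sign_class_def)

lemma finite_sign_classes: "finite \<P> \<Longrightarrow> finite (sign_class P \<P> ` P)"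
proof -
  assume "finite \<P>"
  moreover have "sign_class P \<P> ` P \<subseteq> (\<lambda>Z. {x \<in> P. \<forall>p \<in> \<P>. p x = 0 \<longleftrightarrow> p \<in> Z}) ` Pow \<P>"
  proof
    fix A assume "A \<in> sign_class P \<P> ` P"
    then obtain y where "A = sign_class P \<P> y" by blast
    then have "A = {x \<in> P. \<forall>p \<in> \<P>. p x = 0 \<longleftrightarrow> p \<in> {p \<in> \<P>. p y = 0}}"
      by (auto simp: sign_class_def)
    then show "A \<in> (\<lambda>Z. {x \<in> P. \<forall>p \<in> \<P>. p x = 0 \<longleftrightarrow> p \<in> Z}) ` Pow \<P>" by blast
  qed
  ultimately show ?thesis by (meson finite_Pow_iff finite_imageI finite_subset)
qed

lemma sign_class_eq: "x \<in> sign_class P \<P> y \<Longrightarrow> sign_class P \<P> x = sign_class P \<P> y"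
  by (auto simp: sign_class_def)

text \<open>Adding the numerators of \<open>f\<close> on the finitely many pieces to \<open>\<P>\<close> makes \<open>f\<close> either zero throughout a
  piece or nowhere zero on it; in both cases \<open>inverse \<circ> f\<close> is again a quotient there.\<close>

lemma quotients_on_sign_classes_refine:
  assumes "finite \<P>" "\<P> \<subseteq> poly_functions G" "\<And>y. y \<in> P \<Longrightarrow> f \<in> quotients_on G (sign_class P \<P> y)"
  shows "\<exists>\<P>'. finite \<P>' \<and> \<P>' \<subseteq> poly_functions G \<and>
    (\<forall>y \<in> P. f \<in> quotients_on G (sign_class P \<P>' y) \<and> (\<lambda>x. inverse (f x)) \<in> quotients_on G (sign_class P \<P>' y) \<and>
      (\<forall>x \<in> sign_class P \<P>' y. f x = 0 \<longleftrightarrow> f y = 0))"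
proof -
  have "\<forall>A \<in> sign_class P \<P> ` P. \<exists>g h. g \<in> poly_functions G \<and> h \<in> poly_functions G \<and>
      (\<forall>x \<in> A. h x \<noteq> 0 \<and> f x = g x / h x)"
    using assms(3) unfolding quotients_on_def by blast
  then obtain g h where gh: "\<And>A. A \<in> sign_class P \<P> ` P \<Longrightarrow> g A \<in> poly_functions G \<and> h A \<in> poly_functions G \<and>
      (\<forall>x \<in> A. h A x \<noteq> 0 \<and> f x = g A x / h A x)"
    by metis
  let ?P = "\<P> \<union> g ` (sign_class P \<P> ` P)"
  show ?thesis
  proof (intro exI[of _ ?P] conjI ballI)
    show "finite ?P" using assms(1) finite_sign_classes by blast
    show "?P \<subseteq> poly_functions G" using assms(2) gh by blast
    fix y assume y: "y \<in> P"
    let ?A = "sign_class P \<P> y" and ?B = "sign_class P ?P y"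
    have BA: "?B \<subseteq> ?A" by (rule sign_class_mono) blast
    show "f \<in> quotients_on G ?B" by (rule quotients_on_mono[OF assms(3)[OF y] BA])
    have g0: "g ?A x = 0 \<longleftrightarrow> g ?A y = 0" if "x \<in> ?B" for x
      using that y by (auto simp: sign_class_def)
    have yA: "y \<in> ?A" using y by (simp add: sign_class_def)
    have gh': "g ?A \<in> poly_functions G" "h ?A \<in> poly_functions G"
      "\<And>x. x \<in> ?A \<Longrightarrow> h ?A x \<noteq> 0" "\<And>x. x \<in> ?A \<Longrightarrow> f x = g ?A x / h ?A x"
      using gh[of ?A] y by auto
    show zero: "f x = 0 \<longleftrightarrow> f y = 0" if "x \<in> ?B" for x
      using gh'(3,4)[of x] gh'(3,4)[of y] g0[OF that] that BA yA by auto
    show "(\<lambda>x. inverse (f x)) \<in> quotients_on G ?B"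
    proof (cases "f y = 0")
      case True
      then have "inverse (f x) = 0" if "x \<in> ?B" for x using zero[OF that] by simp
      then show ?thesis using quotients_on_cong[OF quotients_on_const[of 0]] by metis
    next
      case False
      have "g ?A x \<noteq> 0" if "x \<in> ?B" for x
        using False zero[OF that] gh'(4)[of x] BA that by auto
      then show ?thesis
        by (intro quotients_onI[OF gh'(2,1)]) (use gh'(4) BA in auto)
    qed
  qed
qed

lemma piecewise_rational_on_sign_classes:
  assumes "f \<in> piecewise_rational G"
  shows "\<exists>\<P>. finite \<P> \<and> \<P> \<subseteq> poly_functions G \<and> (\<forall>y \<in> P. f \<in> quotients_on G (sign_class P \<P> y))"
  using assms
proof induction
  case (const c)
  then show ?case by (intro exI[of _ "{}"]) (auto intro: quotients_on_const)
next
  case (coord f)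
  then show ?case by (intro exI[of _ "{}"]) (auto intro: quotients_on_poly poly_functions.coord)
next
  case (add f g)
  then obtain \<P> \<Q> where *: "finite \<P>" "\<P> \<subseteq> poly_functions G" "\<forall>y \<in> P. f \<in> quotients_on G (sign_class P \<P> y)"
    "finite \<Q>" "\<Q> \<subseteq> poly_functions G" "\<forall>y \<in> P. g \<in> quotients_on G (sign_class P \<Q> y)" by blast
  have "(\<lambda>x. f x + g x) \<in> quotients_on G (sign_class P (\<P> \<union> \<Q>) y)" if "y \<in> P" for y
    by (rule quotients_on_add; rule quotients_on_mono[OF _ sign_class_mono])
      (use * that in auto)
  then show ?case using * by (intro exI[of _ "\<P> \<union> \<Q>"]) auto
next
  case (mult f g)
  then obtain \<P> \<Q> where *: "finite \<P>" "\<P> \<subseteq> poly_functions G" "\<forall>y \<in> P. f \<in> quotients_on G (sign_class P \<P> y)"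
    "finite \<Q>" "\<Q> \<subseteq> poly_functions G" "\<forall>y \<in> P. g \<in> quotients_on G (sign_class P \<Q> y)" by blast
  have "(\<lambda>x. f x * g x) \<in> quotients_on G (sign_class P (\<P> \<union> \<Q>) y)" if "y \<in> P" for y
    by (rule quotients_on_mult; rule quotients_on_mono[OF _ sign_class_mono])
      (use * that in auto)
  then show ?case using * by (intro exI[of _ "\<P> \<union> \<Q>"]) auto
next
  case (inverse f)
  then obtain \<P> where "finite \<P>" "\<P> \<subseteq> poly_functions G" "\<forall>y \<in> P. f \<in> quotients_on G (sign_class P \<P> y)"
    by blast
  then have "\<exists>\<P>'. finite \<P>' \<and> \<P>' \<subseteq> poly_functions G \<and>
    (\<forall>y \<in> P. f \<in> quotients_on G (sign_class P \<P>' y) \<and> (\<lambda>x. inverse (f x)) \<in> quotients_on G (sign_class P \<P>' y) \<and>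
      (\<forall>x \<in> sign_class P \<P>' y. f x = 0 \<longleftrightarrow> f y = 0))"
    by (intro quotients_on_sign_classes_refine) blast+
  then show ?case by blast
qed

lemma piecewise_rational_common_sign_classes:
  assumes "finite F" "F \<subseteq> piecewise_rational G"
  shows "\<exists>\<P>. finite \<P> \<and> \<P> \<subseteq> poly_functions G \<and>
    (\<forall>y \<in> P. F \<subseteq> quotients_on G (sign_class P \<P> y) \<and>
      (\<forall>f \<in> F. \<forall>x \<in> sign_class P \<P> y. f x = 0 \<longleftrightarrow> f y = 0))"
proof -
  have "\<forall>f \<in> F. \<exists>\<P>. finite \<P> \<and> \<P> \<subseteq> poly_functions G \<and>
    (\<forall>y \<in> P. f \<in> quotients_on G (sign_class P \<P> y) \<and> (\<forall>x \<in> sign_class P \<P> y. f x = 0 \<longleftrightarrow> f y = 0))"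
  proof
    fix f assume "f \<in> F"
    then have "f \<in> piecewise_rational G" using assms(2) by blast
    from piecewise_rational_on_sign_classes[OF this, of P] obtain \<P>
      where "finite \<P>" "\<P> \<subseteq> poly_functions G" "\<forall>y \<in> P. f \<in> quotients_on G (sign_class P \<P> y)" by blast
    then have "\<exists>\<P>'. finite \<P>' \<and> \<P>' \<subseteq> poly_functions G \<and>
    (\<forall>y \<in> P. f \<in> quotients_on G (sign_class P \<P>' y) \<and> (\<lambda>x. inverse (f x)) \<in> quotients_on G (sign_class P \<P>' y) \<and>
      (\<forall>x \<in> sign_class P \<P>' y. f x = 0 \<longleftrightarrow> f y = 0))"
      by (intro quotients_on_sign_classes_refine) blast+
    then show "\<exists>\<P>. finite \<P> \<and> \<P> \<subseteq> poly_functions G \<and>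
    (\<forall>y \<in> P. f \<in> quotients_on G (sign_class P \<P> y) \<and> (\<forall>x \<in> sign_class P \<P> y. f x = 0 \<longleftrightarrow> f y = 0))"
      by blast
  qed
  then obtain \<P> where \<P>: "\<And>f. f \<in> F \<Longrightarrow> finite (\<P> f) \<and> \<P> f \<subseteq> poly_functions G \<and>
    (\<forall>y \<in> P. f \<in> quotients_on G (sign_class P (\<P> f) y) \<and> (\<forall>x \<in> sign_class P (\<P> f) y. f x = 0 \<longleftrightarrow> f y = 0))"
    by metis
  have sub: "sign_class P (\<Union> (\<P> ` F)) y \<subseteq> sign_class P (\<P> f) y" if "f \<in> F" for f y
    by (rule sign_class_mono) (use that in blast)
  show ?thesis
  proof (intro exI[of _ "\<Union> (\<P> ` F)"] conjI ballI subsetI)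
    show "finite (\<Union> (\<P> ` F))" using assms(1) \<P> by blast
    show "p \<in> poly_functions G" if "p \<in> \<Union> (\<P> ` F)" for p using that \<P> by blast
    show "f \<in> quotients_on G (sign_class P (\<Union> (\<P> ` F)) y)" if "y \<in> P" "f \<in> F" for y f
      using quotients_on_mono[OF _ sub] \<P> that by blast
    show "f x = 0 \<longleftrightarrow> f y = 0" if "y \<in> P" "f \<in> F" "x \<in> sign_class P (\<Union> (\<P> ` F)) y" for y f x
      using sub \<P> that by blast
  qed
qed

section \<open>Constructible maps into coproducts of affine varieties\<close>

lemma Top_affine_structure:
  "Top (affine_structure P G) = topology_generated_by {{x \<in> P. f x \<noteq> 0} | f. f \<in> poly_functions G}"
  by (simp add: affine_structure_def Let_def)

lemma topspace_affine_structure [simp]: "topspace (Top (affine_structure P G)) = P"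
proof -
  have "P \<in> {{x \<in> P. f x \<noteq> 0} | f. f \<in> poly_functions G}"
    by (rule CollectI, rule exI[of _ "\<lambda>_. 1"]) (auto intro: poly_functions.const)
  then show ?thesis
    unfolding Top_affine_structure topology_generated_by_topspace by blast
qed

lemma openin_nonzero:
  "f \<in> poly_functions G \<Longrightarrow> openin (Top (affine_structure P G)) {x \<in> P. f x \<noteq> 0}"
  unfolding Top_affine_structure by (rule topology_generated_by_Basis) blast

lemma Reg_affine_structure:
  "Reg (affine_structure P G) U = {f. \<forall>x \<in> U. \<exists>V. openin (Top (affine_structure P G)) V \<and> x \<in> V \<and> V \<subseteq> U \<and>
       f \<in> quotients_on G V}"
  by (simp add: affine_structure_def Let_def quotients_on_def)

text \<open>The conditions \<open>p x \<noteq> 0\<close> amount to the single condition that the product of these \<open>p\<close> does not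
  vanish, which defines a basic open set.\<close>

lemma locally_closed_sign_class:
  assumes "finite \<P>" "\<P> \<subseteq> poly_functions G"
  shows "locally_closed_in (Top (affine_structure P G)) (sign_class P \<P> y)"
proof -
  let ?T = "Top (affine_structure P G)"
  let ?U = "{x \<in> P. (\<Prod>p\<in>{p \<in> \<P>. p y \<noteq> 0}. p x) \<noteq> 0}"
  let ?V = "\<Union>p\<in>{p \<in> \<P>. p y = 0}. {x \<in> P. p x \<noteq> 0}"
  have "openin ?T ?U"
    by (intro openin_nonzero poly_functions_prod) (use assms(2) in auto)
  moreover have "closedin ?T (topspace ?T - ?V)"
    by (intro closedin_diff closedin_topspace openin_Union) (use assms(2) in \<open>auto intro: openin_nonzero\<close>)
  moreover have "sign_class P \<P> y = ?U \<inter> (topspace ?T - ?V)"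
    using assms(1) by (auto simp: sign_class_def)
  ultimately show ?thesis unfolding locally_closed_in_def by blast
qed

text \<open>Quotients without zeros in the denominator can be substituted into polynomials and into locally
  defined quotients; this gives both continuity and the pullback of regular functions.\<close>

lemma morphism_affine_structure:
  assumes AP: "A \<subseteq> P" and f: "\<And>x. x \<in> A \<Longrightarrow> f x \<in> P'"
    and G': "\<And>g. g \<in> G' \<Longrightarrow> (\<lambda>x. g (f x)) \<in> quotients_on G A"
  shows "morphism (induced_structure (affine_structure P G) A) (affine_structure P' G') f"
proof -
  let ?X = "affine_structure P G" and ?Y = "affine_structure P' G'"
  let ?I = "induced_structure ?X A"
  have top: "topspace (Top ?I) = A"
    using AP by (auto simp: induced_structure_def)
  have cont: "continuous_map (Top ?I) (Top ?Y) f"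
    unfolding Top_affine_structure[of P' G']
  proof (rule continuous_on_generated_topo)
    fix U assume "U \<in> {{x \<in> P'. p x \<noteq> 0} | p. p \<in> poly_functions G'}"
    then obtain p where p: "p \<in> poly_functions G'" "U = {x \<in> P'. p x \<noteq> 0}" by blast
    obtain g h where
      gh: "g \<in> poly_functions G" "h \<in> poly_functions G"
      "\<And>x. x \<in> A \<Longrightarrow> h x \<noteq> 0" "\<And>x. x \<in> A \<Longrightarrow> p (f x) = g x / h x"
        using quotients_on_poly_comp[of G' f G A, OF G' p(1)] unfolding quotients_on_def by auto
    have "f -` U \<inter> topspace (Top ?I) = {x \<in> P. g x \<noteq> 0} \<inter> A"
      using gh(3,4) f AP unfolding top p(2) by auto
    then show "openin (Top ?I) (f -` U \<inter> topspace (Top ?I))"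
      using openin_nonzero[OF gh(1), of P] by (auto simp: induced_structure_def openin_subtopology)
  next
    have "P' \<in> {{x \<in> P'. p x \<noteq> 0} | p. p \<in> poly_functions G'}"
      by (rule CollectI, rule exI[of _ "\<lambda>_. 1"]) (auto intro: poly_functions.const)
    then show "f ` topspace (Top ?I) \<subseteq> \<Union> {{x \<in> P'. p x \<noteq> 0} | p. p \<in> poly_functions G'}"
      using f unfolding top by blast
  qed
  show ?thesis
    unfolding morphism_def
  proof (intro conjI allI impI ballI)
    show "continuous_map (Top ?I) (Top ?Y) f" by (rule cont)
    fix V g assume V: "openin (Top ?Y) V" and g: "g \<in> Reg ?Y V"
    have "\<exists>W. openin (Top ?X) W \<and> x \<in> W \<and> W \<inter> A \<subseteq> {x \<in> A. f x \<in> V} \<and>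
        (\<exists>r \<in> Reg ?X W. \<forall>y \<in> W \<inter> A. g (f y) = r y)"
      if x: "x \<in> A" "f x \<in> V" for x
    proof -
      obtain V' where V': "openin (Top ?Y) V'" "f x \<in> V'" "V' \<subseteq> V" "g \<in> quotients_on G' V'"
        using g x(2) unfolding Reg_affine_structure by blast
      obtain p q where pq: "p \<in> poly_functions G'" "q \<in> poly_functions G'"
        "\<And>y. y \<in> V' \<Longrightarrow> q y \<noteq> 0" "\<And>y. y \<in> V' \<Longrightarrow> g y = p y / q y"
        using V'(4) by (rule quotients_onE) blast
      obtain p1 p2 where
        p: "p1 \<in> poly_functions G" "p2 \<in> poly_functions G"
          "\<And>x. x \<in> A \<Longrightarrow> p2 x \<noteq> 0" "\<And>x. x \<in> A \<Longrightarrow> p (f x) = p1 x / p2 x"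
        using quotients_on_poly_comp[of G' f G A, OF G' pq(1)] unfolding quotients_on_def by auto
      obtain q1 q2 where
        q: "q1 \<in> poly_functions G" "q2 \<in> poly_functions G"
          "\<And>x. x \<in> A \<Longrightarrow> q2 x \<noteq> 0" "\<And>x. x \<in> A \<Longrightarrow> q (f x) = q1 x / q2 x"
        using quotients_on_poly_comp[of G' f G A, OF G' pq(2)] unfolding quotients_on_def by auto
      have "openin (Top ?I) {x \<in> A. f x \<in> V'}"
        using openin_continuous_map_preimage[OF cont V'(1)] unfolding top by simp
      then obtain W0 where W0: "openin (Top ?X) W0" "{x \<in> A. f x \<in> V'} = W0 \<inter> A"
        by (auto simp: induced_structure_def openin_subtopology)
      let ?n = "\<lambda>x. p1 x * q2 x" and ?d = "\<lambda>x. p2 x * q1 x"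
      define W where "W = W0 \<inter> {x \<in> P. ?d x \<noteq> 0}"
      have nd: "?n \<in> poly_functions G" "?d \<in> poly_functions G"
        using p q by (auto intro: poly_functions.mult)
      have W: "openin (Top ?X) W"
        unfolding W_def by (intro openin_Int W0(1) openin_nonzero nd)
      have WA: "W \<inter> A = {x \<in> A. f x \<in> V'}"
      proof -
        have "?d y \<noteq> 0" if "y \<in> A" "f y \<in> V'" for y
          using p(3)[OF that(1)] q(3,4)[OF that(1)] pq(3)[OF that(2)] by auto
        then show ?thesis using W0(2) AP unfolding W_def by blast
      qed
      show ?thesis
      proof (intro exI[of _ W] conjI bexI[of _ "\<lambda>x. ?n x / ?d x"] ballI)
        show "openin (Top ?X) W" by (rule W)
        show "x \<in> W" using WA x V'(2) by blast
        show "W \<inter> A \<subseteq> {x \<in> A. f x \<in> V}" using WA V'(3) by blast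
        show "(\<lambda>x. ?n x / ?d x) \<in> Reg ?X W"
        proof -
          have "(\<lambda>x. ?n x / ?d x) \<in> quotients_on G W"
            by (rule quotients_onI[OF nd]) (auto simp: W_def)
          then show ?thesis unfolding Reg_affine_structure using W by blast
        qed
        fix y assume "y \<in> W \<inter> A"
        then have y: "y \<in> A" "f y \<in> V'" using WA by auto
        show "g (f y) = ?n y / ?d y"
          using p(3)[OF y(1)] q(3)[OF y(1)] pq(3)[OF y(2)]
          unfolding pq(4)[OF y(2)] p(4)[OF y(1)] q(4)[OF y(1)] by simp
      qed
    qed
    then show "g \<circ> f \<in> Reg ?I {x \<in> topspace (Top ?I). f x \<in> V}"
      unfolding top by (auto simp: induced_structure_def)
  qed
qed

lemma morphism_into_coproduct:
  assumes i: "i \<in> I" and A: "A \<subseteq> topspace (Top Z)" and fst: "\<And>x. x \<in> A \<Longrightarrow> fst (\<phi> x) = i"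
    and mor: "morphism (induced_structure Z A) (X i) (\<lambda>x. snd (\<phi> x))"
  shows "morphism (induced_structure Z A) (coproduct I X) \<phi>"
proof -
  let ?Z = "induced_structure Z A"
  have top: "topspace (Top ?Z) = A" using A by (auto simp: induced_structure_def)
  have \<phi>: "\<phi> x = (i, snd (\<phi> x))" if "x \<in> A" for x using fst[OF that] by (metis prod.collapse)
  have "continuous_map (Top ?Z) (sum_topology (\<lambda>i. Top (X i)) I) ((\<lambda>y. (i, y)) \<circ> (\<lambda>x. snd (\<phi> x)))"
  proof (rule continuous_map_compose)
    show "continuous_map (Top ?Z) (Top (X i)) (\<lambda>x. snd (\<phi> x))"
      using mor by (simp add: morphism_def)
    show "continuous_map (Top (X i)) (sum_topology (\<lambda>i. Top (X i)) I) (\<lambda>y. (i, y))"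
      by (rule continuous_map_component_injection[OF i])
  qed
  then have cont: "continuous_map (Top ?Z) (sum_topology (\<lambda>i. Top (X i)) I) \<phi>"
    by (rule continuous_map_eq) (use \<phi> top in auto)
  show ?thesis
    unfolding morphism_def
  proof (intro conjI allI impI ballI)
    show "continuous_map (Top ?Z) (Top (coproduct I X)) \<phi>"
      using cont by (simp add: coproduct_def)
    fix V g assume V: "openin (Top (coproduct I X)) V" and g: "g \<in> Reg (coproduct I X) V"
    let ?V = "{x. (i, x) \<in> V}"
    have "openin (Top (X i)) ?V" using V i by (auto simp: coproduct_def openin_sum_topology)
    moreover have "(\<lambda>x. g (i, x)) \<in> Reg (X i) ?V" using g i by (simp add: coproduct_def)
    ultimately have *: "(\<lambda>x. g (i, x)) \<circ> (\<lambda>x. snd (\<phi> x)) \<in> Reg ?Z {x \<in> A. snd (\<phi> x) \<in> ?V}"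
      using mor unfolding morphism_def top by blast
    have eq: "{x \<in> A. snd (\<phi> x) \<in> ?V} = {x \<in> A. \<phi> x \<in> V}" using \<phi> by auto
    have "g (i, snd (\<phi> x)) = g (\<phi> x)" if "x \<in> A" for x using \<phi>[OF that] by simp
    with * show "g \<circ> \<phi> \<in> Reg ?Z {x \<in> topspace (Top ?Z). \<phi> x \<in> V}"
      unfolding eq top by (simp add: induced_structure_def)
  qed
qed

text \<open>The form in which constructibility is established: \<open>F\<close> is a finite set of functions that
  determine the map. On a piece where the members of \<open>F\<close> are quotients, each of them zero throughout or
  nowhere zero, the map has to stay in one component and to have quotients as its coordinates.\<close>

lemma constructible_mapI:
  assumes F: "finite F" "F \<subseteq> piecewise_rational G"
    and \<phi>: "\<And>x. x \<in> P \<Longrightarrow> fst (\<phi> x) \<in> I \<and> snd (\<phi> x) \<in> P' (fst (\<phi> x))"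
    and pieces: "\<And>A y. \<lbrakk>A \<subseteq> P; y \<in> A; F \<subseteq> quotients_on G A; \<And>f x. \<lbrakk>f \<in> F; x \<in> A\<rbrakk> \<Longrightarrow> f x = 0 \<longleftrightarrow> f y = 0\<rbrakk>
      \<Longrightarrow> (\<forall>x \<in> A. fst (\<phi> x) = fst (\<phi> y)) \<and> (\<forall>g \<in> G' (fst (\<phi> y)). (\<lambda>x. g (snd (\<phi> x))) \<in> quotients_on G A)"
  shows "constructible_map (affine_structure P G) (coproduct I (\<lambda>i. affine_structure (P' i) (G' i))) \<phi>"
proof -
  obtain \<P> where \<P>: "finite \<P>" "\<P> \<subseteq> poly_functions G"
    and classes: "\<forall>y \<in> P. F \<subseteq> quotients_on G (sign_class P \<P> y) \<and>
      (\<forall>f \<in> F. \<forall>x \<in> sign_class P \<P> y. f x = 0 \<longleftrightarrow> f y = 0)"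
    using piecewise_rational_common_sign_classes[OF F, of P] by (elim exE conjE)
  show ?thesis
    unfolding constructible_map_def
  proof (intro exI[of _ "sign_class P \<P> ` P"] conjI ballI)
    show "finite (sign_class P \<P> ` P)" by (rule finite_sign_classes[OF \<P>(1)])
    show "pairwise disjnt (sign_class P \<P> ` P)"
    proof (rule pairwiseI)
      fix A B assume "A \<in> sign_class P \<P> ` P" "B \<in> sign_class P \<P> ` P" "A \<noteq> B"
      then obtain y z where A: "A = sign_class P \<P> y" and B: "B = sign_class P \<P> z" by blast
      show "disjnt A B"
        unfolding disjnt_iff
      proof (intro allI notI)
        fix x assume x: "x \<in> A \<and> x \<in> B"
        have "A = sign_class P \<P> x" using sign_class_eq[of x P \<P> y] x A by simp
        moreover have "B = sign_class P \<P> x" using sign_class_eq[of x P \<P> z] x B by simp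
        ultimately show False using \<open>A \<noteq> B\<close> by simp
      qed
    qed
    show "\<Union> (sign_class P \<P> ` P) = topspace (Top (affine_structure P G))"
      by (auto simp: sign_class_def)
    fix A assume "A \<in> sign_class P \<P> ` P"
    then obtain y where y: "y \<in> P" and A: "A = sign_class P \<P> y" by blast
    show "locally_closed_in (Top (affine_structure P G)) A"
      unfolding A by (rule locally_closed_sign_class[OF \<P>(1,2)])
    have AP: "A \<subseteq> P" and yA: "y \<in> A" using y by (auto simp: A sign_class_def)
    have cl: "F \<subseteq> quotients_on G A \<and> (\<forall>f \<in> F. \<forall>x \<in> A. f x = 0 \<longleftrightarrow> f y = 0)"
      using bspec[OF classes y] unfolding A .
    have "(\<forall>x \<in> A. fst (\<phi> x) = fst (\<phi> y)) \<and>
      (\<forall>g \<in> G' (fst (\<phi> y)). (\<lambda>x. g (snd (\<phi> x))) \<in> quotients_on G A)"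
      by (rule pieces[OF AP yA conjunct1[OF cl]]) (use conjunct2[OF cl] in simp)
    then have *: "\<forall>x \<in> A. fst (\<phi> x) = fst (\<phi> y)"
      "\<forall>g \<in> G' (fst (\<phi> y)). (\<lambda>x. g (snd (\<phi> x))) \<in> quotients_on G A" by simp_all
    show "morphism (induced_structure (affine_structure P G) A) (coproduct I (\<lambda>i. affine_structure (P' i) (G' i))) \<phi>"
    proof (rule morphism_into_coproduct)
      show "fst (\<phi> y) \<in> I" using \<phi>[OF y] by simp
      show "A \<subseteq> topspace (Top (affine_structure P G))" using AP by simp
      show "fst (\<phi> x) = fst (\<phi> y)" if "x \<in> A" for x using *(1) that by blast
      show "morphism (induced_structure (affine_structure P G) A)
          (affine_structure (P' (fst (\<phi> y))) (G' (fst (\<phi> y)))) (\<lambda>x. snd (\<phi> x))"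
      proof (rule morphism_affine_structure[OF AP])
        fix x assume "x \<in> A"
        then show "snd (\<phi> x) \<in> P' (fst (\<phi> y))" using \<phi>[of x] *(1) AP by auto
      next
        fix g assume "g \<in> G' (fst (\<phi> y))"
        then show "(\<lambda>x. g (snd (\<phi> x))) \<in> quotients_on G A" using *(2) by blast
      qed
    qed
  qed
qed

section \<open>Finite families of vectors\<close>

locale complex_vectorspace = vectorspace class_ring V for V :: "(complex, 'v) module" (structure)

text \<open>Linear combinations of indexed families, which may have repetitions, in contrast to the linear
  combinations over sets of vectors on which the notion of a basis of \<^locale>\<open>vectorspace\<close> rests.\<close>

definition comb :: "(complex, 'v) module \<Rightarrow> nat \<Rightarrow> (nat \<Rightarrow> complex) \<Rightarrow> (nat \<Rightarrow> 'v) \<Rightarrow> 'v" where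
  "comb V n c v = (\<Oplus>\<^bsub>V\<^esub>i\<in>{..<n}. c i \<odot>\<^bsub>V\<^esub> v i)"

context complex_vectorspace
begin

lemma smult_in_carrier [simp, intro]: "x \<in> carrier V \<Longrightarrow> c \<odot> x \<in> carrier V"
  using smult_closed[of c x] by simp

lemma smult_add_scalar: "x \<in> carrier V \<Longrightarrow> (a + b) \<odot> x = a \<odot> x \<oplus> b \<odot> x"
  using smult_l_distr[of a b x] by simp

lemma smult_add_vector: "\<lbrakk>x \<in> carrier V; y \<in> carrier V\<rbrakk> \<Longrightarrow> a \<odot> (x \<oplus> y) = a \<odot> x \<oplus> a \<odot> y"
  using smult_r_distr[of a x y] by simp

lemma smult_mult: "x \<in> carrier V \<Longrightarrow> (a * b) \<odot> x = a \<odot> (b \<odot> x)"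
  using smult_assoc1[of a b x] by simp

lemma one_smult [simp]: "x \<in> carrier V \<Longrightarrow> 1 \<odot> x = x"
  using smult_one[of x] by simp

lemma zero_smult [simp]: "x \<in> carrier V \<Longrightarrow> 0 \<odot> x = \<zero>"
  using smult_l_null[of x] by simp

lemma smult_zero_vector [simp]: "a \<odot> \<zero> = \<zero>"
  using smult_r_null[of a] by simp

lemma minus_one_smult: "x \<in> carrier V \<Longrightarrow> (- 1) \<odot> x = \<ominus> x"
proof -
  assume x: "x \<in> carrier V"
  have "(- 1) \<odot> x \<oplus> x = \<zero>"
    using smult_add_scalar[OF x, of "-1" 1] x by simp
  then show ?thesis using x by (simp add: M.minus_equality)
qed

lemma comb_0 [simp]: "comb V 0 c v = \<zero>"
  by (simp add: comb_def)

lemma comb_Suc: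
  assumes "\<And>i. i < Suc n \<Longrightarrow> v i \<in> carrier V"
  shows "comb V (Suc n) c v = comb V n c v \<oplus> c n \<odot> v n"
proof -
  have "comb V (Suc n) c v = c n \<odot> v n \<oplus> comb V n c v"
    unfolding comb_def lessThan_Suc by (rule M.finsum_insert) (use assms in auto)
  moreover have "comb V n c v \<in> carrier V"
    unfolding comb_def by (rule M.finsum_closed) (use assms in auto)
  ultimately show ?thesis using assms[of n] by (simp add: M.a_comm)
qed

lemma comb_closed [intro]: "(\<And>i. i < n \<Longrightarrow> v i \<in> carrier V) \<Longrightarrow> comb V n c v \<in> carrier V"
  unfolding comb_def by (rule M.finsum_closed) auto

lemma comb_cong:
  assumes "\<And>i. i < n \<Longrightarrow> c i = c' i" "\<And>i. i < n \<Longrightarrow> v i = v' i" "\<And>i. i < n \<Longrightarrow> v' i \<in> carrier V"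
  shows "comb V n c v = comb V n c' v'"
  unfolding comb_def by (rule M.finsum_cong') (use assms in auto)

lemma comb_add:
  assumes "\<And>i. i < n \<Longrightarrow> v i \<in> carrier V"
  shows "comb V n (\<lambda>i. c i + d i) v = comb V n c v \<oplus> comb V n d v"
proof -
  have "comb V n (\<lambda>i. c i + d i) v = (\<Oplus>i\<in>{..<n}. c i \<odot> v i \<oplus> d i \<odot> v i)"
    unfolding comb_def by (rule M.finsum_cong') (use assms in \<open>auto simp: smult_add_scalar\<close>)
  also have "\<dots> = comb V n c v \<oplus> comb V n d v"
    unfolding comb_def by (rule M.finsum_addf) (use assms in auto)
  finally show ?thesis .
qed

lemma comb_smult:
  assumes "\<And>i. i < n \<Longrightarrow> v i \<in> carrier V"
  shows "comb V n (\<lambda>i. a * c i) v = a \<odot> comb V n c v"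
  using assms
proof (induction n)
  case (Suc n)
  then have "comb V n c v \<in> carrier V" by (intro comb_closed) auto
  with Suc show ?case by (simp add: comb_Suc smult_add_vector smult_mult)
qed simp

lemma comb_uminus:
  assumes "\<And>i. i < n \<Longrightarrow> v i \<in> carrier V"
  shows "comb V n (\<lambda>i. - c i) v = \<ominus> comb V n c v"
  using comb_smult[of n v "-1" c, OF assms] minus_one_smult[OF comb_closed[of n v c, OF assms]] by simp

lemma comb_diff:
  assumes "\<And>i. i < n \<Longrightarrow> v i \<in> carrier V"
  shows "comb V n (\<lambda>i. c i - d i) v = comb V n c v \<ominus> comb V n d v"
  using comb_add[of n v c "\<lambda>i. - d i", OF assms] comb_uminus[of n v d, OF assms]
  by (simp add: a_minus_def)

lemma comb_vectors_add:
  assumes "\<And>i. i < n \<Longrightarrow> v i \<in> carrier V" "\<And>i. i < n \<Longrightarrow> w i \<in> carrier V"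
  shows "comb V n c (\<lambda>i. v i \<oplus> w i) = comb V n c v \<oplus> comb V n c w"
proof -
  have "comb V n c (\<lambda>i. v i \<oplus> w i) = (\<Oplus>i\<in>{..<n}. c i \<odot> v i \<oplus> c i \<odot> w i)"
    unfolding comb_def by (rule M.finsum_cong') (use assms in \<open>auto simp: smult_add_vector\<close>)
  also have "\<dots> = comb V n c v \<oplus> comb V n c w"
    unfolding comb_def by (rule M.finsum_addf) (use assms in auto)
  finally show ?thesis .
qed

lemma comb_zero_coeffs:
  assumes "\<And>i. i < n \<Longrightarrow> v i \<in> carrier V" "\<And>i. i < n \<Longrightarrow> c i = 0"
  shows "comb V n c v = \<zero>"
  using assms by (induction n) (simp_all add: comb_Suc)

lemma comb_zero_vectors [simp]: "comb V n c (\<lambda>_. \<zero>) = \<zero>"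
  by (induction n) (simp_all add: comb_Suc)

lemma comb_unit:
  assumes "\<And>i. i < n \<Longrightarrow> v i \<in> carrier V" "k < n"
  shows "comb V n (\<lambda>i. if i = k then 1 else 0) v = v k"
  using assms
proof (induction n)
  case (Suc n)
  show ?case
  proof (cases "k = n")
    case True
    have "comb V n (\<lambda>i. if i = k then 1 else 0) v = \<zero>"
      by (rule comb_zero_coeffs) (use Suc.prems True in auto)
    then show ?thesis using Suc.prems True by (simp add: comb_Suc)
  next
    case False
    then show ?thesis using Suc by (simp add: comb_Suc)
  qed
qed simp

lemma comb_comb:
  assumes "\<And>j. j < m \<Longrightarrow> w j \<in> carrier V"
  shows "comb V n c (\<lambda>i. comb V m (a i) w) = comb V m (\<lambda>j. \<Sum>i<n. c i * a i j) w"
proof (induction n)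
  case 0
  then show ?case using comb_zero_coeffs[of m w "\<lambda>_. 0"] assms by simp
next
  case (Suc n)
  have *: "comb V m (a i) w \<in> carrier V" for i by (intro comb_closed assms)
  have "comb V (Suc n) c (\<lambda>i. comb V m (a i) w) =
      comb V m (\<lambda>j. \<Sum>i<n. c i * a i j) w \<oplus> comb V m (\<lambda>j. c n * a n j) w"
    using Suc * by (simp add: comb_Suc comb_smult assms)
  also have "\<dots> = comb V m (\<lambda>j. (\<Sum>i<n. c i * a i j) + c n * a n j) w"
    by (rule comb_add[symmetric]) (rule assms)
  finally show ?case by simp
qed

lemma comb_append:
  assumes "\<And>i. i < n + m \<Longrightarrow> v i \<in> carrier V"
  shows "comb V (n + m) c v = comb V n c v \<oplus> comb V m (\<lambda>i. c (n + i)) (\<lambda>i. v (n + i))"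
  using assms
proof (induction m)
  case 0
  then show ?case by (simp add: comb_closed)
next
  case (Suc m)
  have 1: "comb V n c v \<in> carrier V" by (rule comb_closed) (use Suc.prems in auto)
  have 2: "comb V m (\<lambda>i. c (n + i)) (\<lambda>i. v (n + i)) \<in> carrier V"
    by (rule comb_closed) (use Suc.prems in auto)
  have "comb V (n + Suc m) c v = comb V (n + m) c v \<oplus> c (n + m) \<odot> v (n + m)"
    using comb_Suc[of "n + m" v c] Suc.prems by simp
  also have "\<dots> = comb V n c v \<oplus> (comb V m (\<lambda>i. c (n + i)) (\<lambda>i. v (n + i)) \<oplus> c (n + m) \<odot> v (n + m))"
    using Suc 1 2 by (simp add: M.a_assoc)
  also have "comb V m (\<lambda>i. c (n + i)) (\<lambda>i. v (n + i)) \<oplus> c (n + m) \<odot> v (n + m) =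
      comb V (Suc m) (\<lambda>i. c (n + i)) (\<lambda>i. v (n + i))"
    by (rule comb_Suc[symmetric]) (use Suc.prems in auto)
  finally show ?case .
qed

end

lemma comb_map:
  assumes V: "vectorspace class_ring V" and W: "vectorspace class_ring W"
    and f: "f \<in> module_hom class_ring V W" and v: "\<And>i. i < n \<Longrightarrow> v i \<in> carrier V"
  shows "f (comb V n c v) = comb W n c (\<lambda>i. f (v i))"
proof -
  interpret V: complex_vectorspace V using V by (simp add: complex_vectorspace_def)
  interpret W: complex_vectorspace W using W by (simp add: complex_vectorspace_def)
  interpret f: mod_hom class_ring V W f
    by (intro mod_hom.intro mod_hom_axioms.intro V.module_axioms W.module_axioms f)
  have fv: "f x \<in> carrier W" if "x \<in> carrier V" for x using module_hom_closed[OF f] that by auto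
  have sm: "f (a \<odot>\<^bsub>V\<^esub> x) = a \<odot>\<^bsub>W\<^esub> f x" if "x \<in> carrier V" for a x
    using module_hom_smult[OF f, of a x] that by simp
  show ?thesis using v
  proof (induction n)
    case (Suc n)
    have "comb V n c v \<in> carrier V" by (rule V.comb_closed) (use Suc.prems in auto)
    then have "f (comb V (Suc n) c v) = f (comb V n c v) \<oplus>\<^bsub>W\<^esub> c n \<odot>\<^bsub>W\<^esub> f (v n)"
      using Suc.prems by (simp add: V.comb_Suc LinearCombinations.module_hom_add[OF f] sm)
    also have "\<dots> = comb W (Suc n) c (\<lambda>i. f (v i))"
      using Suc fv by (simp add: W.comb_Suc)
    finally show ?case .
  qed simp
qed

subsection \<open>Bases indexed by natural numbers\<close>

definition spanning_family :: "(complex, 'v) module \<Rightarrow> nat \<Rightarrow> (nat \<Rightarrow> 'v) \<Rightarrow> bool" where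
  "spanning_family V n v \<longleftrightarrow> (\<forall>i<n. v i \<in> carrier V) \<and> (\<forall>x \<in> carrier V. \<exists>c. x = comb V n c v)"

definition basis_family :: "(complex, 'v) module \<Rightarrow> nat \<Rightarrow> (nat \<Rightarrow> 'v) \<Rightarrow> bool" where
  "basis_family V n v \<longleftrightarrow> spanning_family V n v \<and> (\<forall>c. comb V n c v = \<zero>\<^bsub>V\<^esub> \<longrightarrow> (\<forall>i<n. c i = 0))"

text \<open>The coordinates are determined by the vector only below \<open>n\<close>, and only if the family is a basis.\<close>

definition coords :: "(complex, 'v) module \<Rightarrow> nat \<Rightarrow> (nat \<Rightarrow> 'v) \<Rightarrow> 'v \<Rightarrow> nat \<Rightarrow> complex" where
  "coords V n v x = (SOME c. x = comb V n c v)"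

context complex_vectorspace
begin

lemma basis_family_closed: "\<lbrakk>basis_family V n v; i < n\<rbrakk> \<Longrightarrow> v i \<in> carrier V"
  by (simp add: basis_family_def spanning_family_def)

lemma basis_family_unique:
  assumes "basis_family V n v" "comb V n c v = comb V n d v" "i < n"
  shows "c i = d i"
proof -
  have v: "\<And>i. i < n \<Longrightarrow> v i \<in> carrier V" using assms(1) by (rule basis_family_closed)
  have "comb V n (\<lambda>i. c i - d i) v = \<zero>"
    using comb_diff[of n v c d, OF v] assms(2) comb_closed[of n v d, OF v]
    by (simp add: a_minus_def M.r_neg)
  then have "c i - d i = 0" using assms(1,3) unfolding basis_family_def by blast
  then show ?thesis by simp
qed

lemma comb_coords:
  assumes "spanning_family V n v" "x \<in> carrier V"
  shows "comb V n (coords V n v x) v = x"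
proof -
  have "\<exists>c. x = comb V n c v" using assms by (simp add: spanning_family_def)
  then have "x = comb V n (coords V n v x) v" unfolding coords_def by (rule someI_ex)
  then show ?thesis by simp
qed

lemma coords_comb:
  assumes "basis_family V n v" "i < n"
  shows "coords V n v (comb V n c v) i = c i"
proof (rule basis_family_unique[OF assms(1) _ assms(2)])
  show "comb V n (coords V n v (comb V n c v)) v = comb V n c v"
    using assms(1) basis_family_closed[OF assms(1)]
    by (intro comb_coords comb_closed) (auto simp: basis_family_def)
qed

lemma comb_eq_lincomb:
  assumes "inj_on v {..<n}" "\<And>i. i < n \<Longrightarrow> v i \<in> carrier V" "\<And>i. i < n \<Longrightarrow> c i = a (v i)"
  shows "comb V n c v = lincomb a (v ` {..<n})"
proof -
  have "lincomb a (v ` {..<n}) = (\<Oplus>i\<in>{..<n}. a (v i) \<odot> v i)"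
    unfolding lincomb_def by (rule M.finsum_reindex) (use assms in auto)
  also have "\<dots> = comb V n c v"
    unfolding comb_def by (rule M.finsum_cong') (use assms in auto)
  finally show ?thesis by simp
qed

lemma basis_family_basis:
  assumes v: "basis_family V n v"
  shows "ordered_basis V n v" "dim = n"
proof -
  have vc: "\<And>i. i < n \<Longrightarrow> v i \<in> carrier V" using v by (rule basis_family_closed)
  have inj: "inj_on v {..<n}"
  proof (rule inj_onI)
    fix i j assume ij: "i \<in> {..<n}" "j \<in> {..<n}" "v i = v j"
    have "comb V n (\<lambda>k. if k = i then 1 else 0) v = comb V n (\<lambda>k. if k = j then 1 else 0) v"
      using ij comb_unit[of n v i, OF vc] comb_unit[of n v j, OF vc] by simp
    from basis_family_unique[OF v this, of i] ij show "i = j" by (auto split: if_splits)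
  qed
  have sub: "v ` {..<n} \<subseteq> carrier V" using vc by auto
  have "span (v ` {..<n}) = carrier V"
  proof
    show "span (v ` {..<n}) \<subseteq> carrier V" using sub by (rule span_is_subset2)
    show "carrier V \<subseteq> span (v ` {..<n})"
    proof
      fix x assume "x \<in> carrier V"
      then obtain c where x: "x = comb V n c v" using v by (auto simp: basis_family_def spanning_family_def)
      have "x = lincomb (\<lambda>y. c (the_inv_into {..<n} v y)) (v ` {..<n})"
        unfolding x by (rule comb_eq_lincomb[OF inj vc]) (auto simp: the_inv_into_f_f[OF inj])
      then show "x \<in> span (v ` {..<n})" unfolding span_def by auto
    qed
  qed
  moreover have "lin_indpt (v ` {..<n})"
  proof (rule finite_lin_indpt2)
    show "finite (v ` {..<n})" by simp
    show "v ` {..<n} \<subseteq> carrier V" by (rule sub)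
    fix a assume a: "lincomb a (v ` {..<n}) = \<zero>"
    have "comb V n (\<lambda>i. a (v i)) v = \<zero>"
      using comb_eq_lincomb[OF inj vc, of "\<lambda>i. a (v i)" a] a by simp
    then have "\<forall>i<n. a (v i) = 0" using v unfolding basis_family_def by blast
    then show "\<forall>x \<in> v ` {..<n}. a x = \<zero>\<^bsub>class_ring\<^esub>" by simp
  qed
  ultimately have b: "basis (v ` {..<n})" unfolding basis_def using sub by blast
  then show "ordered_basis V n v" using inj by (simp add: ordered_basis_def)
  show "dim = n" using dim_basis[OF _ b] card_image[OF inj] by simp
qed

lemma exists_basis_family:
  assumes fin_dim
  shows "\<exists>n v. basis_family V n v"
proof -
  obtain \<beta> where \<beta>: "finite \<beta>" "basis \<beta>" using finite_basis_exists[OF assms] by blast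
  define n where "n = card \<beta>"
  obtain v where "bij_betw v {..<n} \<beta>"
    using ex_bij_betw_nat_finite[OF \<beta>(1)] unfolding n_def by (auto simp: lessThan_atLeast0)
  then have inj: "inj_on v {..<n}" and img: "v ` {..<n} = \<beta>" by (auto simp: bij_betw_def)
  have li: "lin_indpt \<beta>" and gen: "span \<beta> = carrier V" and sub: "\<beta> \<subseteq> carrier V"
    using \<beta>(2) by (auto simp: basis_def)
  have vc: "\<And>i. i < n \<Longrightarrow> v i \<in> carrier V" using img sub by auto
  have "basis_family V n v"
    unfolding basis_family_def spanning_family_def
  proof (intro conjI allI impI ballI)
    show "\<And>i. i < n \<Longrightarrow> v i \<in> carrier V" by (rule vc)
    fix x assume "x \<in> carrier V"
    then obtain a where "x = lincomb a \<beta>"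
      using finite_in_span[OF \<beta>(1) sub, of x] gen by auto
    then have "x = comb V n (\<lambda>i. a (v i)) v"
      using comb_eq_lincomb[OF inj vc, of "\<lambda>i. a (v i)" a] img by simp
    then show "\<exists>c. x = comb V n c v" by blast
  next
    fix c i assume c: "comb V n c v = \<zero>" and i: "i < n"
    let ?a = "\<lambda>y. c (the_inv_into {..<n} v y)"
    have "lincomb ?a \<beta> = \<zero>"
      using comb_eq_lincomb[OF inj vc, of c ?a] img c by (simp add: the_inv_into_f_f[OF inj])
    moreover have "v i \<in> \<beta>" using img i by auto
    ultimately have "?a (v i) = 0"
      using lin_dep_crit[of \<beta> \<beta> ?a "v i"] \<beta>(1) sub li by auto
    then show "c i = 0" using i by (simp add: the_inv_into_f_f[OF inj])
  qed
  then show ?thesis by blast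
qed

end

text \<open>A family of pairs spanning \<open>V \<times> W\<close>, without forming the product module: a spanning family of \<open>V\<close>
  paired with zeros, followed by one of \<open>W\<close>.\<close>

lemma exists_pair_spanning_family:
  assumes V: "vectorspace class_ring V" "vectorspace.fin_dim class_ring V"
    and W: "vectorspace class_ring W" "vectorspace.fin_dim class_ring W"
  shows "\<exists>n v w. (\<forall>i<n. v i \<in> carrier V \<and> w i \<in> carrier W) \<and>
    (\<forall>x \<in> carrier V. \<forall>y \<in> carrier W. \<exists>c. x = comb V n c v \<and> y = comb W n c w)"
proof -
  interpret V: complex_vectorspace V using V by (simp add: complex_vectorspace_def)
  interpret W: complex_vectorspace W using W by (simp add: complex_vectorspace_def)
  obtain l a where a: "spanning_family V l a"
    using V.exists_basis_family[OF V(2)] by (auto simp: basis_family_def)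
  obtain m b where b: "spanning_family W m b"
    using W.exists_basis_family[OF W(2)] by (auto simp: basis_family_def)
  let ?v = "\<lambda>i. if i < l then a i else \<zero>\<^bsub>V\<^esub>" and ?w = "\<lambda>i. if i < l then \<zero>\<^bsub>W\<^esub> else b (i - l)"
  have cl: "?v i \<in> carrier V \<and> ?w i \<in> carrier W" if "i < l + m" for i
    using a b that by (auto simp: spanning_family_def)
  have "\<exists>c. x = comb V (l + m) c ?v \<and> y = comb W (l + m) c ?w"
    if xy: "x \<in> carrier V" "y \<in> carrier W" for x y
  proof -
    obtain c where c: "x = comb V l c a" using a xy(1) unfolding spanning_family_def by blast
    obtain d where d: "y = comb W m d b" using b xy(2) unfolding spanning_family_def by blast
    let ?c = "\<lambda>i. if i < l then c i else d (i - l)"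
    have "comb V (l + m) ?c ?v = comb V l ?c ?v \<oplus>\<^bsub>V\<^esub> comb V m (\<lambda>i. ?c (l + i)) (\<lambda>i. ?v (l + i))"
      by (rule V.comb_append) (use cl in blast)
    also have "comb V l ?c ?v = x" unfolding c
      by (rule V.comb_cong) (use a in \<open>auto simp: spanning_family_def\<close>)
    also have "comb V m (\<lambda>i. ?c (l + i)) (\<lambda>i. ?v (l + i)) = \<zero>\<^bsub>V\<^esub>" by simp
    finally have 1: "comb V (l + m) ?c ?v = x" using xy by simp
    have "comb W (l + m) ?c ?w = comb W l ?c ?w \<oplus>\<^bsub>W\<^esub> comb W m (\<lambda>i. ?c (l + i)) (\<lambda>i. ?w (l + i))"
      by (rule W.comb_append) (use cl in blast)
    also have "comb W m (\<lambda>i. ?c (l + i)) (\<lambda>i. ?w (l + i)) = y" unfolding d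
      by (rule W.comb_cong) (use b in \<open>auto simp: spanning_family_def\<close>)
    also have "comb W l ?c ?w = comb W l ?c (\<lambda>_. \<zero>\<^bsub>W\<^esub>)"
      by (rule W.comb_cong) auto
    also have "\<dots> = \<zero>\<^bsub>W\<^esub>" by simp
    finally have 2: "comb W (l + m) ?c ?w = y" using xy by simp
    show ?thesis by (rule exI[of _ ?c], rule conjI) (rule 1[symmetric], rule 2[symmetric])
  qed
  note pairs = this
  show ?thesis
  proof (rule exI[of _ "l + m"], rule exI[of _ ?v], rule exI[of _ ?w], intro conjI allI impI ballI)
    show "\<And>i. i < l + m \<Longrightarrow> ?v i \<in> carrier V" "\<And>i. i < l + m \<Longrightarrow> ?w i \<in> carrier W"
      using cl by blast+
    show "\<And>x y. x \<in> carrier V \<Longrightarrow> y \<in> carrier W \<Longrightarrow>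
        \<exists>c. x = comb V (l + m) c ?v \<and> y = comb W (l + m) c ?w" by (rule pairs)
  qed
qed


section \<open>Linear systems with piecewise rational coefficients\<close>

text \<open>Instead of choosing a pivot, which would need a case distinction over its position, elimination
  uses weights \<open>\<mu>\<close> for which \<open>\<Sum>l. \<mu> l * a l\<close> is the indicator function of \<open>a \<noteq> 0\<close>. Each new weight
  contributes only where all previous entries vanish.\<close>

lemma exists_pivot_weights:
  fixes n :: nat
  assumes "\<And>l. l < n \<Longrightarrow> a l \<in> piecewise_rational G"
  shows "\<exists>\<mu>. (\<forall>l<n. \<mu> l \<in> piecewise_rational G) \<and>
    (\<forall>x. (\<Sum>l<n. \<mu> l x * a l x) = (if \<forall>l<n. a l x = 0 then 0 else 1))"
  using assms
proof (induction n)
  case (Suc n)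
  have "\<exists>\<mu>. (\<forall>l<n. \<mu> l \<in> piecewise_rational G) \<and>
    (\<forall>x. (\<Sum>l<n. \<mu> l x * a l x) = (if \<forall>l<n. a l x = 0 then 0 else 1))"
    by (rule Suc.IH) (use Suc.prems in simp)
  then obtain \<mu> where \<mu>: "\<And>l. l < n \<Longrightarrow> \<mu> l \<in> piecewise_rational G"
    and sum: "\<And>x. (\<Sum>l<n. \<mu> l x * a l x) = (if \<forall>l<n. a l x = 0 then 0 else 1)"
    by auto
  let ?m = "\<lambda>x. (1 - (\<Sum>l<n. \<mu> l x * a l x)) * inverse (a n x)"
  show ?case
  proof (intro exI[of _ "\<mu>(n := ?m)"] conjI allI impI)
    fix l assume "l < Suc n"
    then show "(\<mu>(n := ?m)) l \<in> piecewise_rational G"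
      using \<mu> Suc.prems by (cases "l = n") (auto intro!: piecewise_rational_intros)
  next
    fix x
    have "(\<Sum>l<Suc n. (\<mu>(n := ?m)) l x * a l x) = (\<Sum>l<n. \<mu> l x * a l x) + ?m x * a n x"
      by simp
    also have "\<dots> = (if \<forall>l<Suc n. a l x = 0 then 0 else 1)"
      unfolding sum by (auto simp: less_Suc_eq)
    finally show "(\<Sum>l<Suc n. (\<mu>(n := ?m)) l x * a l x) = (if \<forall>l<Suc n. a l x = 0 then 0 else 1)" .
  qed
qed simp

definition satisfies_equations ::
  "((nat \<Rightarrow> 'p \<Rightarrow> complex) \<times> ('p \<Rightarrow> complex)) set \<Rightarrow> nat \<Rightarrow> 'p \<Rightarrow> (nat \<Rightarrow> complex) \<Rightarrow> bool" where
  "satisfies_equations \<E> n x c \<longleftrightarrow> (\<forall>(w, y) \<in> \<E>. (\<Sum>k<n. c k * w k x) = y x)"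

lemma satisfies_equations_insert:
  "satisfies_equations (insert (w, y) \<E>) n x c \<longleftrightarrow>
    (\<Sum>k<n. c k * w k x) = y x \<and> satisfies_equations \<E> n x c"
  by (simp add: satisfies_equations_def)

text \<open>The solutions are parametrised as \<open>c0 + \<Sum>l. s l * v l\<close>, and \<open>t\<close> vanishes where the system is
  solvable. Equations are added one at a time. Let \<open>a l\<close> be the value of the new linear form at \<open>v l\<close> and
  \<open>b\<close> its defect at \<open>c0\<close>. With pivot weights \<open>\<mu>\<close> and \<open>p = \<Sum>l. \<mu> l * v l\<close>, the new form takes the value 1 at
  \<open>p\<close> unless all \<open>a l\<close> vanish. Replacing \<open>c0\<close> by \<open>c0 + b * p\<close> and \<open>v l\<close> by
  \<open>v l - a l * p\<close> therefore solves the new equation, provided that \<open>b = 0\<close> wherever all \<open>a l\<close> vanish.\<close>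

lemma equations_general_solution:
  assumes "finite \<E>" "\<forall>(w, y) \<in> \<E>. (\<forall>k<n. w k \<in> piecewise_rational G) \<and> y \<in> piecewise_rational G"
  shows "\<exists>t c0 v. t \<in> piecewise_rational G \<and> (\<forall>k. c0 k \<in> piecewise_rational G) \<and>
    (\<forall>l k. v l k \<in> piecewise_rational G) \<and>
    (\<forall>x s. t x = 0 \<longrightarrow> satisfies_equations \<E> n x (\<lambda>k. c0 k x + (\<Sum>l<n. s l * v l k x))) \<and>
    (\<forall>x c. satisfies_equations \<E> n x c \<longrightarrow> t x = 0 \<and>
      (\<exists>s. \<forall>k<n. c k = c0 k x + (\<Sum>l<n. s l * v l k x)))"
  using assms
proof (induction \<E> rule: finite_induct)
  case empty
  show ?case
  proof (rule exI[of _ "\<lambda>_. 0"], rule exI[of _ "\<lambda>_ _. 0"], rule exI[of _ "\<lambda>l k x. if l = k then 1 else 0"],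
      intro conjI allI impI)
    fix x :: 'a and c :: "nat \<Rightarrow> complex"
    show "\<exists>s. \<forall>k<n. c k = 0 + (\<Sum>l<n. s l * (if l = k then 1 else 0))"
      by (rule exI[of _ c]) (simp add: if_distrib cong: if_cong)
  qed (auto simp: satisfies_equations_def intro: piecewise_rational.const)
next
  case (insert e \<E>)
  obtain w y where e: "e = (w, y)" by (cases e)
  have w: "\<And>k. k < n \<Longrightarrow> w k \<in> piecewise_rational G" and y: "y \<in> piecewise_rational G"
    using insert.prems unfolding e by auto
  have "\<forall>(w, y) \<in> \<E>. (\<forall>k<n. w k \<in> piecewise_rational G) \<and> y \<in> piecewise_rational G"
    using insert.prems by simp
  from insert.IH[OF this] obtain t c0 v where t: "t \<in> piecewise_rational G"
    and c0': "\<forall>k. c0 k \<in> piecewise_rational G" and v': "\<forall>l k. v l k \<in> piecewise_rational G"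
    and sol': "\<forall>x s. t x = 0 \<longrightarrow> satisfies_equations \<E> n x (\<lambda>k. c0 k x + (\<Sum>l<n. s l * v l k x))"
    and only': "\<forall>x c. satisfies_equations \<E> n x c \<longrightarrow> t x = 0 \<and>
      (\<exists>s. \<forall>k<n. c k = c0 k x + (\<Sum>l<n. s l * v l k x))"
    by (elim exE conjE)
  note c0 = c0'[rule_format] and v = v'[rule_format] and sol = sol'[rule_format] and only = only'[rule_format]
  define a where "a l x = (\<Sum>k<n. v l k x * w k x)" for l x
  define b where "b x = y x - (\<Sum>k<n. c0 k x * w k x)" for x
  have a_rat: "a l \<in> piecewise_rational G" for l
    unfolding a_def[abs_def] by (intro piecewise_rational_intros v w) auto
  have b_rat: "b \<in> piecewise_rational G"
    unfolding b_def[abs_def] by (intro piecewise_rational_intros c0 w y) auto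
  obtain \<mu> where \<mu>: "\<And>l. l < n \<Longrightarrow> \<mu> l \<in> piecewise_rational G"
    and S: "\<And>x. (\<Sum>l<n. \<mu> l x * a l x) = (if \<forall>l<n. a l x = 0 then 0 else 1)"
    using exists_pivot_weights[of n a G] a_rat by blast
  define p where "p k x = (\<Sum>l<n. \<mu> l x * v l k x)" for k x
  define u where "u x = b x * (1 - (\<Sum>l<n. \<mu> l x * a l x))" for x
  define t' where "t' x = 1 - (1 - t x * inverse (t x)) * (1 - u x * inverse (u x))" for x
  define c0' where "c0' k x = c0 k x + b x * p k x" for k x
  define v' where "v' l k x = v l k x - a l x * p k x" for l k x
  have p_rat: "p k \<in> piecewise_rational G" for k
    unfolding p_def[abs_def] by (intro piecewise_rational_intros v \<mu>) auto
  have u_rat: "u \<in> piecewise_rational G"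
    unfolding u_def[abs_def] by (intro piecewise_rational_intros b_rat a_rat \<mu>) auto
  have rat: "t' \<in> piecewise_rational G" "c0' k \<in> piecewise_rational G" "v' l k \<in> piecewise_rational G" for k l
    unfolding t'_def[abs_def] c0'_def[abs_def] v'_def[abs_def]
    by (intro piecewise_rational_intros t u_rat c0 b_rat p_rat v a_rat)+
  \<comment> \<open>\<open>t'\<close> is the indicator function of \<open>t x \<noteq> 0 \<or> u x \<noteq> 0\<close>\<close>
  have t': "t' x = 0 \<longleftrightarrow> t x = 0 \<and> u x = 0" for x
    by (cases "t x = 0"; cases "u x = 0") (auto simp: t'_def)
  have row: "(\<Sum>k<n. (c0 k x + (\<Sum>l<n. s l * v l k x)) * w k x) = y x - b x + (\<Sum>l<n. s l * a l x)" for s x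
  proof -
    have "(\<Sum>k<n. (\<Sum>l<n. s l * v l k x) * w k x) = (\<Sum>k<n. \<Sum>l<n. s l * (v l k x * w k x))"
      by (simp add: sum_distrib_right mult.assoc)
    also have "\<dots> = (\<Sum>l<n. \<Sum>k<n. s l * (v l k x * w k x))" by (rule sum.swap)
    also have "\<dots> = (\<Sum>l<n. s l * a l x)" by (simp add: a_def sum_distrib_left)
    finally show ?thesis by (simp add: b_def distrib_right sum.distrib)
  qed
  have comb: "c0' k x + (\<Sum>l<n. s l * v' l k x) =
      c0 k x + (\<Sum>l<n. (s l + (b x - (\<Sum>j<n. s j * a j x)) * \<mu> l x) * v l k x)" for s k x
  proof -
    have "(\<Sum>l<n. s l * v' l k x) = (\<Sum>l<n. s l * v l k x) - (\<Sum>l<n. s l * a l x) * p k x"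
      by (simp add: v'_def right_diff_distrib sum_subtractf sum_distrib_right mult.assoc)
    moreover have "(\<Sum>l<n. (s l + (b x - (\<Sum>j<n. s j * a j x)) * \<mu> l x) * v l k x) =
        (\<Sum>l<n. s l * v l k x) + (b x - (\<Sum>j<n. s j * a j x)) * p k x"
      by (simp add: p_def distrib_right sum.distrib sum_distrib_left mult.assoc)
    ultimately show ?thesis unfolding c0'_def by (simp only:) (simp add: left_diff_distrib)
  qed
  show ?case
  proof (intro exI[of _ t'] exI[of _ c0'] exI[of _ v'] conjI allI impI)
    fix x s assume "t' x = 0"
    then have tx: "t x = 0" and ux: "u x = 0" using t' by auto
    let ?s = "\<lambda>l. s l + (b x - (\<Sum>j<n. s j * a j x)) * \<mu> l x"
    have "(\<Sum>l<n. ?s l * a l x) = (\<Sum>l<n. s l * a l x) + (b x - (\<Sum>j<n. s j * a j x)) * (\<Sum>l<n. \<mu> l x * a l x)"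
      by (simp add: distrib_right sum.distrib sum_distrib_left mult.assoc)
    also have "\<dots> = b x"
    proof (cases "\<forall>l<n. a l x = 0")
      case True
      then have "b x = 0" using ux by (simp add: u_def S)
      with True show ?thesis by simp
    next
      case False
      then have "(\<Sum>l<n. \<mu> l x * a l x) = 1" unfolding S by (simp only: if_not_P if_False)
      then show ?thesis by simp
    qed
    finally have "(\<Sum>k<n. (c0 k x + (\<Sum>l<n. ?s l * v l k x)) * w k x) = y x"
      unfolding row by simp
    then show "satisfies_equations (insert e \<E>) n x (\<lambda>k. c0' k x + (\<Sum>l<n. s l * v' l k x))"
      unfolding e satisfies_equations_insert comb using sol[OF tx, of ?s] by simp
  next
    fix x c assume "satisfies_equations (insert e \<E>) n x c"
    then have c: "(\<Sum>k<n. c k * w k x) = y x" "satisfies_equations \<E> n x c"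
      unfolding e satisfies_equations_insert by auto
    from only[OF c(2)] obtain s where tx: "t x = 0"
      and s': "\<forall>k<n. c k = c0 k x + (\<Sum>l<n. s l * v l k x)" by (elim exE conjE)
    note s = s'[rule_format]
    have "(\<Sum>k<n. c k * w k x) = y x - b x + (\<Sum>l<n. s l * a l x)"
      unfolding row[symmetric] by (rule sum.cong) (simp_all add: s)
    with c(1) have bs: "b x = (\<Sum>l<n. s l * a l x)" by simp
    have "u x = 0" by (auto simp: u_def S bs)
    then show "t' x = 0" using tx t' by simp
    show "\<exists>s. \<forall>k<n. c k = c0' k x + (\<Sum>l<n. s l * v' l k x)"
    proof (intro exI[of _ s] allI impI)
      fix k assume "k < n"
      then have "c k = c0 k x + (\<Sum>l<n. s l * v l k x)" by (rule s)
      then show "c k = c0' k x + (\<Sum>l<n. s l * v' l k x)" by (simp only: comb bs[symmetric]) simp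
    qed
  qed (rule rat)+
qed

text \<open>A condition on \<open>c\<close> that is a finite system of linear equations in \<open>c 0, \<dots>, c (n - 1)\<close> whose
  coefficients depend piecewise rationally on the point \<open>x\<close>.\<close>

definition linear_condition ::
  "('p \<Rightarrow> complex) set \<Rightarrow> 'p set \<Rightarrow> nat \<Rightarrow> ('p \<Rightarrow> (nat \<Rightarrow> complex) \<Rightarrow> bool) \<Rightarrow> bool" where
  "linear_condition G N n Q \<longleftrightarrow> (\<exists>\<E>. finite \<E> \<and>
    (\<forall>(w, y) \<in> \<E>. (\<forall>k<n. w k \<in> piecewise_rational G) \<and> y \<in> piecewise_rational G) \<and>
    (\<forall>x \<in> N. \<forall>c. Q x c \<longleftrightarrow> satisfies_equations \<E> n x c))"

lemma linear_condition_conj: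
  assumes "linear_condition G N n Q" "linear_condition G N n Q'"
  shows "linear_condition G N n (\<lambda>x c. Q x c \<and> Q' x c)"
proof -
  obtain \<E> \<E>' where "finite \<E>" "finite \<E>'"
    "\<forall>(w, y) \<in> \<E>. (\<forall>k<n. w k \<in> piecewise_rational G) \<and> y \<in> piecewise_rational G"
    "\<forall>(w, y) \<in> \<E>'. (\<forall>k<n. w k \<in> piecewise_rational G) \<and> y \<in> piecewise_rational G"
    "\<forall>x \<in> N. \<forall>c. Q x c \<longleftrightarrow> satisfies_equations \<E> n x c"
    "\<forall>x \<in> N. \<forall>c. Q' x c \<longleftrightarrow> satisfies_equations \<E>' n x c"
    using assms unfolding linear_condition_def by (elim exE conjE)
  then show ?thesis
    unfolding linear_condition_def
    by (intro exI[of _ "\<E> \<union> \<E>'"]) (auto simp: satisfies_equations_def)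
qed

lemma linear_condition_general_solution:
  assumes "linear_condition G N n Q"
  shows "\<exists>t c0 v. t \<in> piecewise_rational G \<and> (\<forall>k. c0 k \<in> piecewise_rational G) \<and>
    (\<forall>l k. v l k \<in> piecewise_rational G) \<and>
    (\<forall>x \<in> N. (t x = 0 \<longrightarrow> (\<forall>s. Q x (\<lambda>k. c0 k x + (\<Sum>l<n. s l * v l k x)))) \<and>
      (\<forall>c. Q x c \<longrightarrow> t x = 0 \<and> (\<exists>s. \<forall>k<n. c k = c0 k x + (\<Sum>l<n. s l * v l k x))))"
proof -
  obtain \<E> where \<E>: "finite \<E>"
    "\<forall>(w, y) \<in> \<E>. (\<forall>k<n. w k \<in> piecewise_rational G) \<and> y \<in> piecewise_rational G"
    "\<forall>x \<in> N. \<forall>c. Q x c \<longleftrightarrow> satisfies_equations \<E> n x c"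
    using assms unfolding linear_condition_def by (elim exE conjE)
  obtain t c0 v where *: "t \<in> piecewise_rational G" "\<forall>k. c0 k \<in> piecewise_rational G"
    "\<forall>l k. v l k \<in> piecewise_rational G"
    "\<forall>x s. t x = 0 \<longrightarrow> satisfies_equations \<E> n x (\<lambda>k. c0 k x + (\<Sum>l<n. s l * v l k x))"
    "\<forall>x c. satisfies_equations \<E> n x c \<longrightarrow> t x = 0 \<and>
      (\<exists>s. \<forall>k<n. c k = c0 k x + (\<Sum>l<n. s l * v l k x))"
    using equations_general_solution[OF \<E>(1,2)] by (elim exE conjE)
  show ?thesis
    by (intro exI[of _ t] exI[of _ c0] exI[of _ v] conjI ballI) (use * \<E>(3) in auto)
qed

lemma linear_condition_solution:
  assumes "linear_condition G N n Q"
  shows "\<exists>t c. t \<in> piecewise_rational G \<and> (\<forall>k. c k \<in> piecewise_rational G) \<and>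
    (\<forall>x \<in> N. (t x = 0 \<longleftrightarrow> (\<exists>c'. Q x c')) \<and> (t x = 0 \<longrightarrow> Q x (\<lambda>k. c k x)))"
proof -
  obtain t c0 v where t: "t \<in> piecewise_rational G" "\<forall>k. c0 k \<in> piecewise_rational G"
    and sol: "\<forall>x \<in> N. (t x = 0 \<longrightarrow> (\<forall>s. Q x (\<lambda>k. c0 k x + (\<Sum>l<n. s l * v l k x)))) \<and>
      (\<forall>c. Q x c \<longrightarrow> t x = 0 \<and> (\<exists>s. \<forall>k<n. c k = c0 k x + (\<Sum>l<n. s l * v l k x)))"
    using linear_condition_general_solution[OF assms] by (elim exE conjE)
  show ?thesis
  proof (rule exI[of _ t], rule exI[of _ c0], intro conjI ballI impI)
    fix x assume x: "x \<in> N"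
    note s = bspec[OF sol x]
    show Q: "Q x (\<lambda>k. c0 k x)" if "t x = 0"
      using mp[OF conjunct1[OF s] that, THEN spec[of _ "\<lambda>_. 0"]] by simp
    show "t x = 0 \<longleftrightarrow> (\<exists>c'. Q x c')"
    proof
      assume "t x = 0"
      from Q[OF this] show "\<exists>c'. Q x c'" by (rule exI[of _ "\<lambda>k. c0 k x"])
    next
      assume "\<exists>c'. Q x c'"
      then show "t x = 0" using conjunct2[OF s] by (elim exE) simp
    qed
  qed (use t in auto)
qed

text \<open>For an always solvable system, the points \<open>c0\<close> and \<open>c0 + v l\<close> of the affine solution space span it
  linearly: \<open>c0 + \<Sum>l. r l * v l\<close> is their combination with weights \<open>1 - \<Sum>l. r l\<close> and \<open>r l\<close>.\<close>

lemma linear_condition_generators: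
  assumes "linear_condition G N n Q" and solvable: "\<forall>x \<in> N. \<exists>c. Q x c"
  shows "\<exists>a. (\<forall>m k. a m k \<in> piecewise_rational G) \<and>
    (\<forall>x \<in> N. (\<forall>m. Q x (\<lambda>k. a m k x)) \<and>
      (\<forall>c. Q x c \<longrightarrow> (\<exists>s. \<forall>k<n. c k = (\<Sum>m<Suc n. s m * a m k x))))"
proof -
  obtain t c0 v where t: "t \<in> piecewise_rational G" "\<forall>k. c0 k \<in> piecewise_rational G"
    and v: "\<forall>l k. v l k \<in> piecewise_rational G"
    and sol: "\<forall>x \<in> N. (t x = 0 \<longrightarrow> (\<forall>s. Q x (\<lambda>k. c0 k x + (\<Sum>l<n. s l * v l k x)))) \<and>
      (\<forall>c. Q x c \<longrightarrow> t x = 0 \<and> (\<exists>s. \<forall>k<n. c k = c0 k x + (\<Sum>l<n. s l * v l k x)))"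
    using linear_condition_general_solution[OF assms(1)] by (elim exE conjE)
  define a where "a m k x = c0 k x + (\<Sum>l<n. (if Suc l = m then 1 else 0) * v l k x)" for m k x
  have a0: "a 0 k x = c0 k x" for k x by (simp add: a_def)
  have aS: "a (Suc l) k x = c0 k x + v l k x" if "l < n" for l k x
    using that by (simp add: a_def if_distrib[of "\<lambda>z. z * _"] cong: if_cong)
  show ?thesis
  proof (rule exI[of _ a], intro conjI allI ballI impI)
    fix m k show "a m k \<in> piecewise_rational G"
      unfolding a_def[abs_def] by (intro piecewise_rational_intros t(2)[rule_format] v[rule_format])
  next
    fix x m assume x: "x \<in> N"
    note s = bspec[OF sol x]
    obtain c where "Q x c" using bspec[OF solvable x] by (elim exE)
    then have "t x = 0" using conjunct2[OF s] by simp
    from mp[OF conjunct1[OF s] this, THEN spec[of _ "\<lambda>l. if Suc l = m then 1 else 0"]]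
    show "Q x (\<lambda>k. a m k x)" unfolding a_def .
  next
    fix x c assume x: "x \<in> N" and c: "Q x c"
    note s = bspec[OF sol x]
    obtain r where r: "\<forall>k<n. c k = c0 k x + (\<Sum>l<n. r l * v l k x)"
      using mp[OF spec[OF conjunct2[OF s]] c] by (elim conjE exE)
    let ?s = "\<lambda>m. case m of 0 \<Rightarrow> 1 - (\<Sum>l<n. r l) | Suc l \<Rightarrow> r l"
    show "\<exists>s. \<forall>k<n. c k = (\<Sum>m<Suc n. s m * a m k x)"
    proof (rule exI[of _ ?s], intro allI impI)
      fix k assume "k < n"
      then have "c k = c0 k x + (\<Sum>l<n. r l * v l k x)" by (rule r[rule_format])
      also have "\<dots> = (1 - (\<Sum>l<n. r l)) * c0 k x + (\<Sum>l<n. r l * (c0 k x + v l k x))"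
        by (simp add: distrib_left sum.distrib sum_distrib_right left_diff_distrib)
      also have "\<dots> = ?s 0 * a 0 k x + (\<Sum>l<n. ?s (Suc l) * a (Suc l) k x)"
        by (simp add: a0 aS)
      also have "\<dots> = (\<Sum>m<Suc n. ?s m * a m k x)" unfolding sum.lessThan_Suc_shift ..
      finally show "c k = (\<Sum>m<Suc n. ?s m * a m k x)" .
    qed
  qed
qed

section \<open>Piecewise rational families of vectors\<close>

text \<open>Families of vectors of one fixed space with piecewise rational coordinates, stated without a
  basis, so that the notion is visibly preserved by linear maps and by composition of morphisms.\<close>

definition rational_families :: "('p \<Rightarrow> complex) set \<Rightarrow> 'p set \<Rightarrow> (complex, 'v) module \<Rightarrow> ('p \<Rightarrow> 'v) set" where
  "rational_families G N V = {y. \<exists>n f v. (\<forall>k<n. f k \<in> piecewise_rational G \<and> v k \<in> carrier V) \<and>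
    (\<forall>x \<in> N. y x = comb V n (\<lambda>k. f k x) v)}"

lemma rational_familiesI:
  assumes "\<And>k. k < n \<Longrightarrow> f k \<in> piecewise_rational G" "\<And>k. k < n \<Longrightarrow> v k \<in> carrier V"
    "\<And>x. x \<in> N \<Longrightarrow> y x = comb V n (\<lambda>k. f k x) v"
  shows "y \<in> rational_families G N V"
  unfolding rational_families_def
proof (rule CollectI, rule exI[of _ n], rule exI[of _ f], rule exI[of _ v], intro conjI allI impI ballI)
  show "\<And>k. k < n \<Longrightarrow> f k \<in> piecewise_rational G" by (rule assms(1))
  show "\<And>k. k < n \<Longrightarrow> v k \<in> carrier V" by (rule assms(2))
  show "\<And>x. x \<in> N \<Longrightarrow> y x = comb V n (\<lambda>k. f k x) v" by (rule assms(3))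
qed

lemma rational_familiesE:
  assumes "y \<in> rational_families G N V"
  obtains n f v where "\<And>k. k < n \<Longrightarrow> f k \<in> piecewise_rational G" "\<And>k. k < n \<Longrightarrow> v k \<in> carrier V"
    "\<And>x. x \<in> N \<Longrightarrow> y x = comb V n (\<lambda>k. f k x) v"
proof -
  obtain n f v where "\<forall>k<n. f k \<in> piecewise_rational G \<and> v k \<in> carrier V"
    "\<forall>x \<in> N. y x = comb V n (\<lambda>k. f k x) v"
    using assms unfolding rational_families_def by auto
  then show thesis by (intro that[of n f v]) auto
qed

lemma rational_families_cong:
  assumes "y \<in> rational_families G N V" "\<And>x. x \<in> N \<Longrightarrow> y' x = y x"
  shows "y' \<in> rational_families G N V"
  using assms(1)
proof (rule rational_familiesE)
  fix n f v assume *: "\<And>k. k < n \<Longrightarrow> f k \<in> piecewise_rational G" "\<And>k. k < n \<Longrightarrow> v k \<in> carrier V"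
    "\<And>x. x \<in> N \<Longrightarrow> y x = comb V n (\<lambda>k. f k x) v"
  show ?thesis
    by (rule rational_familiesI[of n f _ v]) (simp_all add: * assms(2))
qed

context complex_vectorspace
begin

lemma rational_families_closed:
  assumes "y \<in> rational_families G N V" "x \<in> N"
  shows "y x \<in> carrier V"
  using assms(1)
proof (rule rational_familiesE)
  fix n f v assume *: "\<And>k. k < n \<Longrightarrow> v k \<in> carrier V" "\<And>x. x \<in> N \<Longrightarrow> y x = comb V n (\<lambda>k. f k x) v"
  show ?thesis unfolding *(2)[OF assms(2)] by (rule comb_closed) (rule *(1))
qed

lemma rational_families_const:
  assumes "v \<in> carrier V"
  shows "(\<lambda>_. v) \<in> rational_families G N V"
  by (rule rational_familiesI[of 1 "\<lambda>_ _. 1" _ "\<lambda>_. v"])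
    (simp_all add: assms piecewise_rational.const comb_Suc)

lemma rational_families_add:
  assumes "y \<in> rational_families G N V" "z \<in> rational_families G N V"
  shows "(\<lambda>x. y x \<oplus> z x) \<in> rational_families G N V"
proof -
  obtain n f v where 1: "\<And>k. k < n \<Longrightarrow> f k \<in> piecewise_rational G" "\<And>k. k < n \<Longrightarrow> v k \<in> carrier V"
    "\<And>x. x \<in> N \<Longrightarrow> y x = comb V n (\<lambda>k. f k x) v" using assms(1) by (rule rational_familiesE) (rule that)
  obtain m g w where 2: "\<And>k. k < m \<Longrightarrow> g k \<in> piecewise_rational G" "\<And>k. k < m \<Longrightarrow> w k \<in> carrier V"
    "\<And>x. x \<in> N \<Longrightarrow> z x = comb V m (\<lambda>k. g k x) w" using assms(2) by (rule rational_familiesE) (rule that)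
  let ?f = "\<lambda>k. if k < n then f k else g (k - n)" and ?v = "\<lambda>k. if k < n then v k else w (k - n)"
  have v: "?v k \<in> carrier V" if "k < n + m" for k using 1 2 that by auto
  show ?thesis
  proof (rule rational_familiesI[of "n + m" ?f _ ?v])
    fix x assume x: "x \<in> N"
    have "comb V (n + m) (\<lambda>k. ?f k x) ?v =
        comb V n (\<lambda>k. ?f k x) ?v \<oplus> comb V m (\<lambda>i. ?f (n + i) x) (\<lambda>i. ?v (n + i))"
      by (rule comb_append) (rule v)
    also have "comb V n (\<lambda>k. ?f k x) ?v = y x" unfolding 1(3)[OF x]
      by (rule comb_cong) (use 1 in auto)
    also have "comb V m (\<lambda>i. ?f (n + i) x) (\<lambda>i. ?v (n + i)) = z x" unfolding 2(3)[OF x]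
      by (rule comb_cong) (use 2 in auto)
    finally show "y x \<oplus> z x = comb V (n + m) (\<lambda>k. ?f k x) ?v" by simp
  qed (use 1 2 in auto)
qed

lemma rational_families_smult:
  assumes "f \<in> piecewise_rational G" "y \<in> rational_families G N V"
  shows "(\<lambda>x. f x \<odot> y x) \<in> rational_families G N V"
  using assms(2)
proof (rule rational_familiesE)
  fix n g v assume "\<And>k. k < n \<Longrightarrow> g k \<in> piecewise_rational G" "\<And>k. k < n \<Longrightarrow> v k \<in> carrier V"
    "\<And>x. x \<in> N \<Longrightarrow> y x = comb V n (\<lambda>k. g k x) v"
  then show ?thesis
    by (intro rational_familiesI[of n "\<lambda>k x. f x * g k x" _ v])
      (auto intro: piecewise_rational_intros assms(1) simp: comb_smult)
qed

lemma rational_families_minus: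
  assumes "y \<in> rational_families G N V" "z \<in> rational_families G N V"
  shows "(\<lambda>x. y x \<ominus> z x) \<in> rational_families G N V"
proof (rule rational_families_cong)
  show "(\<lambda>x. y x \<oplus> (- 1) \<odot> z x) \<in> rational_families G N V"
    by (intro rational_families_add rational_families_smult assms piecewise_rational.const)
  show "y x \<ominus> z x = y x \<oplus> (- 1) \<odot> z x" if "x \<in> N" for x
    using rational_families_closed[OF assms(2) that] by (simp add: a_minus_def minus_one_smult)
qed

lemma rational_families_comb:
  assumes "\<And>k. k < n \<Longrightarrow> f k \<in> piecewise_rational G" "\<And>k. k < n \<Longrightarrow> y k \<in> rational_families G N V"
  shows "(\<lambda>x. comb V n (\<lambda>k. f k x) (\<lambda>k. y k x)) \<in> rational_families G N V"
  using assms
proof (induction n)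
  case 0
  then show ?case using rational_families_const[of \<zero>] by simp
next
  case (Suc n)
  have "(\<lambda>x. comb V n (\<lambda>k. f k x) (\<lambda>k. y k x) \<oplus> f n x \<odot> y n x) \<in> rational_families G N V"
    using Suc by (intro rational_families_add rational_families_smult) auto
  then show ?case
  proof (rule rational_families_cong)
    fix x assume x: "x \<in> N"
    show "comb V (Suc n) (\<lambda>k. f k x) (\<lambda>k. y k x) = comb V n (\<lambda>k. f k x) (\<lambda>k. y k x) \<oplus> f n x \<odot> y n x"
      by (rule comb_Suc) (rule rational_families_closed[OF Suc.prems(2) x])
  qed
qed

lemma rational_families_coords:
  assumes v: "basis_family V m v" and y: "y \<in> rational_families G N V" and i: "i < m"
  shows "\<exists>f \<in> piecewise_rational G. \<forall>x \<in> N. coords V m v (y x) i = f x"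
  using y
proof (rule rational_familiesE)
  fix n f w assume *: "\<And>k. k < n \<Longrightarrow> f k \<in> piecewise_rational G" "\<And>k. k < n \<Longrightarrow> w k \<in> carrier V"
    "\<And>x. x \<in> N \<Longrightarrow> y x = comb V n (\<lambda>k. f k x) w"
  have vc: "\<And>i. i < m \<Longrightarrow> v i \<in> carrier V" using v by (rule basis_family_closed)
  have sp: "spanning_family V m v" using v by (simp add: basis_family_def)
  show ?thesis
  proof (rule bexI[of _ "\<lambda>x. \<Sum>k<n. f k x * coords V m v (w k) i"] ballI)+
    show "(\<lambda>x. \<Sum>k<n. f k x * coords V m v (w k) i) \<in> piecewise_rational G"
      by (intro piecewise_rational_intros *(1)) auto
    fix x assume x: "x \<in> N"
    have "y x = comb V n (\<lambda>k. f k x) (\<lambda>k. comb V m (coords V m v (w k)) v)"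
      unfolding *(3)[OF x]
      by (rule comb_cong) (use comb_coords[OF sp] *(2) vc comb_closed in auto)
    also have "\<dots> = comb V m (\<lambda>j. \<Sum>k<n. f k x * coords V m v (w k) j) v"
      by (rule comb_comb) (rule vc)
    finally show "coords V m v (y x) i = (\<Sum>k<n. f k x * coords V m v (w k) i)"
      by (simp add: coords_comb[OF v i])
  qed
qed

lemma linear_condition_comb_eq:
  assumes fd: fin_dim and w: "\<And>k. k < n \<Longrightarrow> w k \<in> rational_families G N V"
    and y: "y \<in> rational_families G N V"
  shows "linear_condition G N n (\<lambda>x c. comb V n c (\<lambda>k. w k x) = y x)"
proof -
  obtain m v where v: "basis_family V m v" using exists_basis_family[OF fd] by blast
  have vc: "\<And>i. i < m \<Longrightarrow> v i \<in> carrier V" using v by (rule basis_family_closed)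
  have sp: "spanning_family V m v" using v by (simp add: basis_family_def)
  let ?R = "\<lambda>z i f. f \<in> piecewise_rational G \<and> (\<forall>x \<in> N. coords V m v (z x) i = f x)"
  define W where "W k i = (SOME f. ?R (w k) i f)" for k i
  define Y where "Y i = (SOME f. ?R y i f)" for i
  have W: "?R (w k) i (W k i)" if "k < n" "i < m" for k i
  proof -
    have "\<exists>f. ?R (w k) i f" using rational_families_coords[OF v w[OF that(1)] that(2)] by blast
    then show ?thesis unfolding W_def by (rule someI_ex)
  qed
  have Y: "?R y i (Y i)" if "i < m" for i
  proof -
    have "\<exists>f. ?R y i f" using rational_families_coords[OF v y that] by blast
    then show ?thesis unfolding Y_def by (rule someI_ex)
  qed
  let ?\<E> = "(\<lambda>i. (\<lambda>k. W k i, Y i)) ` {..<m}"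
  show ?thesis
    unfolding linear_condition_def
  proof (intro exI[of _ ?\<E>] conjI ballI allI)
    show "finite ?\<E>" by simp
    show "case e of (w, y) \<Rightarrow> (\<forall>k<n. w k \<in> piecewise_rational G) \<and> y \<in> piecewise_rational G"
      if "e \<in> ?\<E>" for e using that W Y by auto
    fix x c assume x: "x \<in> N"
    have wx: "w k x \<in> carrier V" if "k < n" for k by (rule rational_families_closed[OF w[OF that] x])
    have yx: "y x \<in> carrier V" by (rule rational_families_closed[OF y x])
    have "comb V n c (\<lambda>k. w k x) = comb V n c (\<lambda>k. comb V m (\<lambda>i. W k i x) v)"
    proof (rule comb_cong)
      fix k assume k: "k < n"
      show "w k x = comb V m (\<lambda>i. W k i x) v"
        using comb_coords[OF sp wx[OF k]] comb_cong[of m "coords V m v (w k x)" "\<lambda>i. W k i x" v v] W[OF k] x vc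
        by simp
    qed (auto intro!: comb_closed vc)
    also have "\<dots> = comb V m (\<lambda>i. \<Sum>k<n. c k * W k i x) v" by (rule comb_comb) (rule vc)
    finally have 1: "comb V n c (\<lambda>k. w k x) = comb V m (\<lambda>i. \<Sum>k<n. c k * W k i x) v" .
    have 2: "y x = comb V m (\<lambda>i. Y i x) v"
      using comb_coords[OF sp yx] comb_cong[of m "coords V m v (y x)" "\<lambda>i. Y i x" v v] Y x vc by simp
    have "comb V n c (\<lambda>k. w k x) = y x \<longleftrightarrow> (\<forall>i<m. (\<Sum>k<n. c k * W k i x) = Y i x)"
    proof
      assume "comb V n c (\<lambda>k. w k x) = y x"
      then show "\<forall>i<m. (\<Sum>k<n. c k * W k i x) = Y i x"
        unfolding 1 2 using basis_family_unique[OF v] by blast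
    next
      assume "\<forall>i<m. (\<Sum>k<n. c k * W k i x) = Y i x"
      then show "comb V n c (\<lambda>k. w k x) = y x"
        unfolding 1 2 by (intro comb_cong) (auto intro: vc)
    qed
    then show "comb V n c (\<lambda>k. w k x) = y x \<longleftrightarrow> satisfies_equations ?\<E> n x c"
      by (auto simp: satisfies_equations_def)
  qed
qed

end

lemma rational_families_image:
  assumes "vectorspace class_ring V" "vectorspace class_ring W" "f \<in> module_hom class_ring V W"
    "y \<in> rational_families G N V"
  shows "(\<lambda>x. f (y x)) \<in> rational_families G N W"
  using assms(4)
proof (rule rational_familiesE)
  fix n g v assume *: "\<And>k. k < n \<Longrightarrow> g k \<in> piecewise_rational G" "\<And>k. k < n \<Longrightarrow> v k \<in> carrier V"
    "\<And>x. x \<in> N \<Longrightarrow> y x = comb V n (\<lambda>k. g k x) v"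
  show ?thesis
  proof (rule rational_familiesI[of n g _ "\<lambda>k. f (v k)"])
    show "f (v k) \<in> carrier W" if "k < n" for k
      using module_hom_closed[OF assms(3)] *(2)[OF that] by auto
    show "f (y x) = comb W n (\<lambda>k. g k x) (\<lambda>k. f (v k))" if "x \<in> N" for x
      unfolding *(3)[OF that] by (rule comb_map[OF assms(1-3)]) (rule *(2))
  qed (rule *(1))
qed

lemma (in linear_category) rational_families_comp:
  assumes ob: "X \<in> Ob C" "Y \<in> Ob C" "Z \<in> Ob C"
    and y: "y \<in> rational_families G N (Hom C X Y)" and z: "z \<in> rational_families G N (Hom C Y Z)"
  shows "(\<lambda>x. z x \<cdot> y x) \<in> rational_families G N (Hom C X Z)"
  using z
proof (rule rational_familiesE)
  fix n f v assume *: "\<And>k. k < n \<Longrightarrow> f k \<in> piecewise_rational G" "\<And>k. k < n \<Longrightarrow> v k \<in> mor C Y Z"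
    "\<And>x. x \<in> N \<Longrightarrow> z x = comb (Hom C Y Z) n (\<lambda>k. f k x) v"
  interpret XY: complex_vectorspace "Hom C X Y" using hom_vectorspace ob by (simp add: complex_vectorspace_def)
  interpret XZ: complex_vectorspace "Hom C X Z" using hom_vectorspace ob by (simp add: complex_vectorspace_def)
  have "(\<lambda>x. comb (Hom C X Z) n (\<lambda>k. f k x) (\<lambda>k. v k \<cdot> y x)) \<in> rational_families G N (Hom C X Z)"
    by (intro XZ.rational_families_comb *(1)
        rational_families_image[OF hom_vectorspace hom_vectorspace comp_left_linear[OF ob]] ob *(2) y)
  then show ?thesis
  proof (rule rational_families_cong)
    fix x assume x: "x \<in> N"
    show "z x \<cdot> y x = comb (Hom C X Z) n (\<lambda>k. f k x) (\<lambda>k. v k \<cdot> y x)"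
      unfolding *(3)[OF x]
      by (rule comb_map[OF hom_vectorspace hom_vectorspace comp_right_linear])
        (use ob *(2) XY.rational_families_closed[OF y x] in auto)
  qed
qed

section \<open>Matrices of linear maps\<close>

lemma is_matrix_of_iff:
  "is_matrix_of n \<beta> W m \<gamma> f A \<longleftrightarrow> A \<in> carrier_mat m n \<and>
    (\<forall>q<n. f (\<beta> q) = comb W m (\<lambda>p. A $$ (p, q)) \<gamma>)"
  by (simp add: is_matrix_of_def comb_def)

definition matrix_of ::
  "nat \<Rightarrow> (nat \<Rightarrow> 'u) \<Rightarrow> (complex, 'w) module \<Rightarrow> nat \<Rightarrow> (nat \<Rightarrow> 'w) \<Rightarrow> ('u \<Rightarrow> 'w) \<Rightarrow> complex mat" where
  "matrix_of n \<beta> W m \<gamma> f = mat m n (\<lambda>(p, q). coords W m \<gamma> (f (\<beta> q)) p)"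

context complex_vectorspace
begin

lemma is_matrix_of_matrix_of:
  assumes "basis_family V m \<gamma>" "\<And>q. q < n \<Longrightarrow> f (\<beta> q) \<in> carrier V"
  shows "is_matrix_of n \<beta> V m \<gamma> f (matrix_of n \<beta> V m \<gamma> f)"
  unfolding is_matrix_of_iff
proof (intro conjI allI impI)
  show "matrix_of n \<beta> V m \<gamma> f \<in> carrier_mat m n" by (simp add: matrix_of_def)
  fix q assume q: "q < n"
  have "comb V m (\<lambda>p. matrix_of n \<beta> V m \<gamma> f $$ (p, q)) \<gamma> = comb V m (coords V m \<gamma> (f (\<beta> q))) \<gamma>"
    by (rule comb_cong) (use q basis_family_closed[OF assms(1)] in \<open>auto simp: matrix_of_def\<close>)
  also have "\<dots> = f (\<beta> q)"
    by (rule comb_coords) (use assms q in \<open>auto simp: basis_family_def\<close>)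
  finally show "f (\<beta> q) = comb V m (\<lambda>p. matrix_of n \<beta> V m \<gamma> f $$ (p, q)) \<gamma>" by simp
qed

lemma is_matrix_of_unique:
  assumes "basis_family V m \<gamma>" "is_matrix_of n \<beta> V m \<gamma> f A" "is_matrix_of n \<beta> V m \<gamma> g A'"
    and "\<And>q. q < n \<Longrightarrow> f (\<beta> q) = g (\<beta> q)"
  shows "A = A'"
proof (rule eq_matI)
  have A: "A \<in> carrier_mat m n" "A' \<in> carrier_mat m n"
    using assms(2,3) unfolding is_matrix_of_iff by blast+
  show "dim_row A = dim_row A'" "dim_col A = dim_col A'" using A by auto
  fix p q assume "p < dim_row A'" "q < dim_col A'"
  then have pq: "p < m" "q < n" using A by auto
  have "comb V m (\<lambda>p. A $$ (p, q)) \<gamma> = comb V m (\<lambda>p. A' $$ (p, q)) \<gamma>"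
    using assms(2,3) assms(4)[OF pq(2)] pq(2) unfolding is_matrix_of_iff by simp
  from basis_family_unique[OF assms(1) this pq(1)] show "A $$ (p, q) = A' $$ (p, q)" .
qed

lemma is_matrix_of_one:
  assumes "basis_family V n \<beta>" "\<And>q. q < n \<Longrightarrow> f (\<beta> q) = \<beta> q"
  shows "is_matrix_of n \<beta> V n \<beta> f (1\<^sub>m n)"
  unfolding is_matrix_of_iff
proof (intro conjI allI impI)
  fix q assume q: "q < n"
  have b: "\<And>i. i < n \<Longrightarrow> \<beta> i \<in> carrier V" by (rule basis_family_closed[OF assms(1)])
  have "comb V n (\<lambda>p. 1\<^sub>m n $$ (p, q)) \<beta> = comb V n (\<lambda>p. if p = q then 1 else 0) \<beta>"
    by (rule comb_cong) (use q b in auto)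
  also have "\<dots> = \<beta> q" by (rule comb_unit) (use q b in auto)
  finally show "f (\<beta> q) = comb V n (\<lambda>p. 1\<^sub>m n $$ (p, q)) \<beta>" using assms(2)[OF q] by simp
qed simp

lemma is_matrix_of_add:
  assumes b: "basis_family V m \<gamma>" and A: "is_matrix_of n \<beta> V m \<gamma> f A" "is_matrix_of n \<beta> V m \<gamma> g A'"
    and h: "\<And>q. q < n \<Longrightarrow> h (\<beta> q) = f (\<beta> q) \<oplus> g (\<beta> q)"
  shows "is_matrix_of n \<beta> V m \<gamma> h (A + A')"
  unfolding is_matrix_of_iff
proof (intro conjI allI impI)
  have c: "A \<in> carrier_mat m n" "A' \<in> carrier_mat m n"
    using A unfolding is_matrix_of_iff by blast+
  then show "A + A' \<in> carrier_mat m n" by simp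
  have g: "\<And>i. i < m \<Longrightarrow> \<gamma> i \<in> carrier V" by (rule basis_family_closed[OF b])
  fix q assume q: "q < n"
  have "h (\<beta> q) = comb V m (\<lambda>p. A $$ (p, q)) \<gamma> \<oplus> comb V m (\<lambda>p. A' $$ (p, q)) \<gamma>"
    using A q unfolding is_matrix_of_iff h[OF q] by simp
  also have "\<dots> = comb V m (\<lambda>p. A $$ (p, q) + A' $$ (p, q)) \<gamma>"
    by (rule comb_add[symmetric]) (rule g)
  also have "\<dots> = comb V m (\<lambda>p. (A + A') $$ (p, q)) \<gamma>"
    by (rule comb_cong) (use c q g in auto)
  finally show "h (\<beta> q) = comb V m (\<lambda>p. (A + A') $$ (p, q)) \<gamma>" .
qed

lemma is_matrix_of_smult:
  assumes b: "basis_family V m \<gamma>" and A: "is_matrix_of n \<beta> V m \<gamma> f A"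
    and h: "\<And>q. q < n \<Longrightarrow> h (\<beta> q) = c \<odot> f (\<beta> q)"
  shows "is_matrix_of n \<beta> V m \<gamma> h (c \<cdot>\<^sub>m A)"
  unfolding is_matrix_of_iff
proof (intro conjI allI impI)
  have cm: "A \<in> carrier_mat m n"
    using A unfolding is_matrix_of_iff by blast+
  then show "c \<cdot>\<^sub>m A \<in> carrier_mat m n" by simp
  have g: "\<And>i. i < m \<Longrightarrow> \<gamma> i \<in> carrier V" by (rule basis_family_closed[OF b])
  fix q assume q: "q < n"
  have "h (\<beta> q) = c \<odot> comb V m (\<lambda>p. A $$ (p, q)) \<gamma>"
    using A q unfolding is_matrix_of_iff h[OF q] by simp
  also have "\<dots> = comb V m (\<lambda>p. c * A $$ (p, q)) \<gamma>"
    by (rule comb_smult[symmetric]) (rule g)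
  also have "\<dots> = comb V m (\<lambda>p. (c \<cdot>\<^sub>m A) $$ (p, q)) \<gamma>"
    by (rule comb_cong) (use cm q g in auto)
  finally show "h (\<beta> q) = comb V m (\<lambda>p. (c \<cdot>\<^sub>m A) $$ (p, q)) \<gamma>" .
qed

lemma coords_comb_vectors:
  assumes b: "basis_family V m \<beta>" and u: "\<And>k. k < n \<Longrightarrow> u k \<in> carrier V" and p: "p < m"
  shows "coords V m \<beta> (comb V n c u) p = (\<Sum>k<n. c k * coords V m \<beta> (u k) p)"
proof -
  have bc: "\<And>i. i < m \<Longrightarrow> \<beta> i \<in> carrier V" by (rule basis_family_closed[OF b])
  have "comb V n c u = comb V n c (\<lambda>k. comb V m (coords V m \<beta> (u k)) \<beta>)"
    by (rule comb_cong) (use b u bc comb_coords in \<open>auto simp: basis_family_def\<close>)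
  also have "\<dots> = comb V m (\<lambda>j. \<Sum>k<n. c k * coords V m \<beta> (u k) j) \<beta>"
    by (rule comb_comb) (rule bc)
  finally show ?thesis by (simp add: coords_comb[OF b p])
qed

end

lemma is_matrix_of_mult:
  assumes U: "vectorspace class_ring U" and W: "vectorspace class_ring W"
    and f: "f \<in> module_hom class_ring U W"
    and \<gamma>: "basis_family U m \<gamma>" and \<delta>: "basis_family W l \<delta>"
    and A: "is_matrix_of n \<beta> U m \<gamma> g A" and A': "is_matrix_of m \<gamma> W l \<delta> f A'"
    and h: "\<And>q. q < n \<Longrightarrow> h (\<beta> q) = f (g (\<beta> q))"
  shows "is_matrix_of n \<beta> W l \<delta> h (A' * A)"
  unfolding is_matrix_of_iff
proof (intro conjI allI impI)
  interpret U: complex_vectorspace U using U by (simp add: complex_vectorspace_def)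
  interpret W: complex_vectorspace W using W by (simp add: complex_vectorspace_def)
  have cm: "A \<in> carrier_mat m n" "A' \<in> carrier_mat l m"
    using A A' unfolding is_matrix_of_iff by blast+
  then show "A' * A \<in> carrier_mat l n" by simp
  have g: "\<And>i. i < m \<Longrightarrow> \<gamma> i \<in> carrier U" by (rule U.basis_family_closed[OF \<gamma>])
  have d: "\<And>i. i < l \<Longrightarrow> \<delta> i \<in> carrier W" by (rule W.basis_family_closed[OF \<delta>])
  fix q assume q: "q < n"
  have "h (\<beta> q) = f (comb U m (\<lambda>r. A $$ (r, q)) \<gamma>)"
    using A q unfolding is_matrix_of_iff h[OF q] by simp
  also have "\<dots> = comb W m (\<lambda>r. A $$ (r, q)) (\<lambda>r. f (\<gamma> r))"
    by (rule comb_map[OF U W f]) (rule g)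
  also have "\<dots> = comb W m (\<lambda>r. A $$ (r, q)) (\<lambda>r. comb W l (\<lambda>p. A' $$ (p, r)) \<delta>)"
    by (rule W.comb_cong) (use A' in \<open>auto simp: is_matrix_of_iff intro!: W.comb_closed d\<close>)
  also have "\<dots> = comb W l (\<lambda>p. \<Sum>r<m. A $$ (r, q) * A' $$ (p, r)) \<delta>"
    by (rule W.comb_comb) (rule d)
  also have "\<dots> = comb W l (\<lambda>p. (A' * A) $$ (p, q)) \<delta>"
  proof (rule W.comb_cong)
    fix p assume "p < l"
    then show "(\<Sum>r<m. A $$ (r, q) * A' $$ (p, r)) = (A' * A) $$ (p, q)"
      using cm q by (auto simp: scalar_prod_def lessThan_atLeast0 mult.commute intro!: sum.cong)
  qed (auto intro: d)
  finally show "h (\<beta> q) = comb W l (\<lambda>p. (A' * A) $$ (p, q)) \<delta>" .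
qed

section \<open>Representations in right modules\<close>

text \<open>The axioms of a representation of \<open>Q\<close> in right \<open>B\<close>-modules. They turn a choice of bases into a point
  of the representation variety.\<close>

locale right_module_representation =
  fixes B :: "(complex, 'b) module" and Q :: "('v, 'a) pre_digraph" and R :: "('v, 'a, 'b, 'w) representation"
  assumes tail_head: "a \<in> arcs Q \<Longrightarrow> tail Q a \<in> verts Q \<and> head Q a \<in> verts Q"
    and space: "i \<in> verts Q \<Longrightarrow> vectorspace class_ring (space_at R i)"
    and act_linear: "\<lbrakk>i \<in> verts Q; b \<in> carrier B\<rbrakk>
      \<Longrightarrow> (\<lambda>v. act_at R i v b) \<in> module_hom class_ring (space_at R i) (space_at R i)"
    and act_linear_algebra: "\<lbrakk>i \<in> verts Q; v \<in> carrier (space_at R i)\<rbrakk>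
      \<Longrightarrow> act_at R i v \<in> module_hom class_ring B (space_at R i)"
    and act_mult: "\<lbrakk>i \<in> verts Q; v \<in> carrier (space_at R i); b \<in> carrier B; b' \<in> carrier B\<rbrakk>
      \<Longrightarrow> act_at R i v (b \<otimes>\<^bsub>B\<^esub> b') = act_at R i (act_at R i v b) b'"
    and act_one: "\<lbrakk>i \<in> verts Q; v \<in> carrier (space_at R i)\<rbrakk> \<Longrightarrow> act_at R i v \<one>\<^bsub>B\<^esub> = v"
    and map_linear: "a \<in> arcs Q
      \<Longrightarrow> map_at R a \<in> module_hom class_ring (space_at R (tail Q a)) (space_at R (head Q a))"
    and map_act: "\<lbrakk>a \<in> arcs Q; v \<in> carrier (space_at R (tail Q a)); b \<in> carrier B\<rbrakk>
      \<Longrightarrow> map_at R a (act_at R (tail Q a) v b) = act_at R (head Q a) (map_at R a v) b"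
    and algebra: "vectorspace class_ring B"
    and mult_closed: "\<lbrakk>b \<in> carrier B; b' \<in> carrier B\<rbrakk> \<Longrightarrow> b \<otimes>\<^bsub>B\<^esub> b' \<in> carrier B"
    and one_closed: "\<one>\<^bsub>B\<^esub> \<in> carrier B"

definition coordinates_of ::
  "(complex, 'b) module \<Rightarrow> ('v, 'a) pre_digraph \<Rightarrow> ('v, 'a, 'b, 'w) representation \<Rightarrow> ('v \<Rightarrow> nat) \<Rightarrow>
    ('v \<Rightarrow> nat \<Rightarrow> 'w) \<Rightarrow> ('v, 'a, 'b) rep_point" where
  "coordinates_of B Q R d \<beta> =
    (\<lambda>i\<in>verts Q. \<lambda>b\<in>carrier B. matrix_of (d i) (\<beta> i) (space_at R i) (d i) (\<beta> i) (\<lambda>v. act_at R i v b),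
     \<lambda>a\<in>arcs Q. matrix_of (d (tail Q a)) (\<beta> (tail Q a)) (space_at R (head Q a)) (d (head Q a)) (\<beta> (head Q a))
       (map_at R a))"

context right_module_representation
begin

lemma act_closed:
  "\<lbrakk>i \<in> verts Q; v \<in> carrier (space_at R i); b \<in> carrier B\<rbrakk> \<Longrightarrow> act_at R i v b \<in> carrier (space_at R i)"
  using module_hom_closed[OF act_linear] by auto

lemma map_closed:
  "\<lbrakk>a \<in> arcs Q; v \<in> carrier (space_at R (tail Q a))\<rbrakk> \<Longrightarrow> map_at R a v \<in> carrier (space_at R (head Q a))"
  using module_hom_closed[OF map_linear] by auto

lemma coordinate_point_coordinates_of:
  assumes \<beta>: "\<And>i. i \<in> verts Q \<Longrightarrow> basis_family (space_at R i) (d i) (\<beta> i)"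
  shows "coordinate_point B Q d R \<beta> (coordinates_of B Q R d \<beta>)"
proof -
  have V: "complex_vectorspace (space_at R i)" if "i \<in> verts Q" for i
    using space[OF that] by (simp add: complex_vectorspace_def)
  have \<beta>c: "\<beta> i q \<in> carrier (space_at R i)" if "i \<in> verts Q" "q < d i" for i q
    by (rule complex_vectorspace.basis_family_closed[OF V \<beta>]) (use that in auto)
  define \<rho> where "\<rho> i b = matrix_of (d i) (\<beta> i) (space_at R i) (d i) (\<beta> i) (\<lambda>v. act_at R i v b)" for i b
  define A where "A a = matrix_of (d (tail Q a)) (\<beta> (tail Q a)) (space_at R (head Q a)) (d (head Q a)) (\<beta> (head Q a))
       (map_at R a)" for a
  have \<rho>: "is_matrix_of (d i) (\<beta> i) (space_at R i) (d i) (\<beta> i) (\<lambda>v. act_at R i v b) (\<rho> i b)"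
    if "i \<in> verts Q" "b \<in> carrier B" for i b
    unfolding \<rho>_def
    by (rule complex_vectorspace.is_matrix_of_matrix_of[OF V \<beta>]) (use that act_closed \<beta>c in auto)
  have A: "is_matrix_of (d (tail Q a)) (\<beta> (tail Q a)) (space_at R (head Q a)) (d (head Q a)) (\<beta> (head Q a))
      (map_at R a) (A a)" if "a \<in> arcs Q" for a
    unfolding A_def
    by (rule complex_vectorspace.is_matrix_of_matrix_of[OF V \<beta>]) (use that tail_head map_closed \<beta>c in auto)
  interpret B: complex_vectorspace B using algebra by (simp add: complex_vectorspace_def)
  have struct: "right_module_structure B (d i) (\<lambda>b\<in>carrier B. \<rho> i b)" if i: "i \<in> verts Q" for i
    unfolding right_module_structure_def
  proof (intro conjI ballI allI)
    interpret V: complex_vectorspace "space_at R i" by (rule V[OF i])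
    note uniq = V.is_matrix_of_unique[OF \<beta>[OF i]]
    show "(\<lambda>b\<in>carrier B. \<rho> i b) \<in> carrier B \<rightarrow>\<^sub>E carrier_mat (d i) (d i)"
      using \<rho>[OF i] by (auto simp: is_matrix_of_iff)
    fix b b' c assume b: "b \<in> carrier B"
    have "\<rho> i (c \<odot>\<^bsub>B\<^esub> b) = c \<cdot>\<^sub>m \<rho> i b"
    proof (rule uniq[OF \<rho>[OF i] V.is_matrix_of_smult[OF \<beta>[OF i] \<rho>[OF i b]]])
      show "c \<odot>\<^bsub>B\<^esub> b \<in> carrier B" using b by simp
      show "act_at R i (\<beta> i q) (c \<odot>\<^bsub>B\<^esub> b) = c \<odot>\<^bsub>space_at R i\<^esub> act_at R i (\<beta> i q) b" if "q < d i" for q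
        using module_hom_smult[OF act_linear_algebra[OF i \<beta>c[OF i that]], of c b] b by simp
    qed simp
    then show "(\<lambda>b\<in>carrier B. \<rho> i b) (c \<odot>\<^bsub>B\<^esub> b) = c \<cdot>\<^sub>m (\<lambda>b\<in>carrier B. \<rho> i b) b" using b by simp
    assume b': "b' \<in> carrier B"
    have "\<rho> i (b \<oplus>\<^bsub>B\<^esub> b') = \<rho> i b + \<rho> i b'"
    proof (rule uniq[OF \<rho>[OF i] V.is_matrix_of_add[OF \<beta>[OF i] \<rho>[OF i b] \<rho>[OF i b']]])
      show "b \<oplus>\<^bsub>B\<^esub> b' \<in> carrier B" using b b' by simp
      show "act_at R i (\<beta> i q) (b \<oplus>\<^bsub>B\<^esub> b') = act_at R i (\<beta> i q) b \<oplus>\<^bsub>space_at R i\<^esub> act_at R i (\<beta> i q) b'"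
        if "q < d i" for q
        using LinearCombinations.module_hom_add[OF act_linear_algebra[OF i \<beta>c[OF i that]] b b'] by simp
    qed simp
    then show "(\<lambda>b\<in>carrier B. \<rho> i b) (b \<oplus>\<^bsub>B\<^esub> b') = (\<lambda>b\<in>carrier B. \<rho> i b) b + (\<lambda>b\<in>carrier B. \<rho> i b) b'"
      using b b' by simp
    have "\<rho> i (b \<otimes>\<^bsub>B\<^esub> b') = \<rho> i b' * \<rho> i b"
    proof (rule uniq[OF \<rho>[OF i] is_matrix_of_mult[OF space[OF i] space[OF i] act_linear[OF i b']
            \<beta>[OF i] \<beta>[OF i] \<rho>[OF i b] \<rho>[OF i b']]])
      show "b \<otimes>\<^bsub>B\<^esub> b' \<in> carrier B" using mult_closed b b' by simp
      show "act_at R i (\<beta> i q) (b \<otimes>\<^bsub>B\<^esub> b') = act_at R i (act_at R i (\<beta> i q) b) b'" if "q < d i" for q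
        by (rule act_mult[OF i \<beta>c[OF i that] b b'])
    qed simp
    then show "(\<lambda>b\<in>carrier B. \<rho> i b) (b \<otimes>\<^bsub>B\<^esub> b') = (\<lambda>b\<in>carrier B. \<rho> i b) b' * (\<lambda>b\<in>carrier B. \<rho> i b) b"
      using b b' mult_closed by simp
  next
    interpret V: complex_vectorspace "space_at R i" by (rule V[OF i])
    have "\<rho> i \<one>\<^bsub>B\<^esub> = 1\<^sub>m (d i)"
      by (rule V.is_matrix_of_unique[OF \<beta>[OF i] \<rho>[OF i one_closed] V.is_matrix_of_one[OF \<beta>[OF i], of id]])
        (simp_all add: act_one[OF i \<beta>c[OF i]])
    then show "(\<lambda>b\<in>carrier B. \<rho> i b) \<one>\<^bsub>B\<^esub> = 1\<^sub>m (d i)" using one_closed by simp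
  qed
  have eqv: "A a * \<rho> (tail Q a) b = \<rho> (head Q a) b * A a" if a: "a \<in> arcs Q" and b: "b \<in> carrier B" for a b
  proof -
    have t: "tail Q a \<in> verts Q" and h: "head Q a \<in> verts Q" using tail_head[OF a] by auto
    show ?thesis
      by (rule complex_vectorspace.is_matrix_of_unique[OF V[OF h] \<beta>[OF h]
            is_matrix_of_mult[OF space[OF t] space[OF h] map_linear[OF a] \<beta>[OF t] \<beta>[OF h] \<rho>[OF t b] A[OF a]]
            is_matrix_of_mult[OF space[OF h] space[OF h] act_linear[OF h b] \<beta>[OF h] \<beta>[OF h] A[OF a] \<rho>[OF h b]]])
        (simp_all add: map_act[OF a \<beta>c[OF t] b])
  qed
  have point: "coordinates_of B Q R d \<beta> = (\<lambda>i\<in>verts Q. \<lambda>b\<in>carrier B. \<rho> i b, \<lambda>a\<in>arcs Q. A a)"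
    by (simp add: coordinates_of_def \<rho>_def A_def)
  have Ac: "A a \<in> carrier_mat (d (head Q a)) (d (tail Q a))" for a by (simp add: A_def matrix_of_def)
  have "coordinates_of B Q R d \<beta> \<in> rep_set B Q d"
    unfolding point rep_set_def using struct eqv tail_head Ac by auto
  moreover have "ordered_basis (space_at R i) (d i) (\<beta> i)" if "i \<in> verts Q" for i
    by (rule complex_vectorspace.basis_family_basis(1)[OF V[OF that] \<beta>[OF that]])
  ultimately show ?thesis
    unfolding coordinate_point_def point using \<rho> A by simp
qed

end

text \<open>An isomorphism of representations carries bases to bases and does not change the matrices.\<close>

lemma coordinate_point_transport:
  assumes x: "coordinate_point B Q d R \<beta> x"
    and tail_head: "\<And>a. a \<in> arcs Q \<Longrightarrow> tail Q a \<in> verts Q \<and> head Q a \<in> verts Q"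
    and V: "\<And>i. i \<in> verts Q \<Longrightarrow> vectorspace class_ring (space_at R i)"
    and V': "\<And>i. i \<in> verts Q \<Longrightarrow> vectorspace class_ring (space_at R' i)"
    and \<beta>: "\<And>i. i \<in> verts Q \<Longrightarrow> basis_family (space_at R i) (d i) (\<beta> i)"
    and \<theta>: "\<And>i. i \<in> verts Q \<Longrightarrow> \<theta> i \<in> module_hom class_ring (space_at R i) (space_at R' i)"
    and bij: "\<And>i. i \<in> verts Q \<Longrightarrow> bij_betw (\<theta> i) (carrier (space_at R i)) (carrier (space_at R' i))"
    and act: "\<And>i v b. \<lbrakk>i \<in> verts Q; v \<in> carrier (space_at R i); b \<in> carrier B\<rbrakk>
      \<Longrightarrow> \<theta> i (act_at R i v b) = act_at R' i (\<theta> i v) b"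
    and map: "\<And>a v. \<lbrakk>a \<in> arcs Q; v \<in> carrier (space_at R (tail Q a))\<rbrakk>
      \<Longrightarrow> \<theta> (head Q a) (map_at R a v) = map_at R' a (\<theta> (tail Q a) v)"
  shows "\<And>i. i \<in> verts Q \<Longrightarrow> basis_family (space_at R' i) (d i) (\<lambda>p. \<theta> i (\<beta> i p))"
    and "coordinate_point B Q d R' (\<lambda>i p. \<theta> i (\<beta> i p)) x"
proof -
  have cv: "complex_vectorspace (space_at R i)" and cv': "complex_vectorspace (space_at R' i)"
    if "i \<in> verts Q" for i using V[OF that] V'[OF that] by (simp_all add: complex_vectorspace_def)
  have \<beta>c: "\<beta> i q \<in> carrier (space_at R i)" if "i \<in> verts Q" "q < d i" for i q
    by (rule complex_vectorspace.basis_family_closed[OF cv \<beta>]) (use that in auto)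
  have comb: "\<theta> i (comb (space_at R i) (d i) c (\<beta> i)) = comb (space_at R' i) (d i) c (\<lambda>p. \<theta> i (\<beta> i p))"
    if i: "i \<in> verts Q" for i c
    by (rule comb_map[OF V[OF i] V'[OF i] \<theta>[OF i]]) (rule \<beta>c[OF i])
  show basis': "basis_family (space_at R' i) (d i) (\<lambda>p. \<theta> i (\<beta> i p))" if i: "i \<in> verts Q" for i
    unfolding basis_family_def spanning_family_def
  proof (intro conjI allI impI ballI)
    interpret V: complex_vectorspace "space_at R i" by (rule cv[OF i])
    interpret V': complex_vectorspace "space_at R' i" by (rule cv'[OF i])
    show "\<theta> i (\<beta> i p) \<in> carrier (space_at R' i)" if "p < d i" for p
      using module_hom_closed[OF \<theta>[OF i]] \<beta>c[OF i that] by auto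
    show "\<exists>c. y = comb (space_at R' i) (d i) c (\<lambda>p. \<theta> i (\<beta> i p))" if y: "y \<in> carrier (space_at R' i)" for y
    proof -
      obtain v where v: "v \<in> carrier (space_at R i)" "y = \<theta> i v"
        using bij[OF i] y by (auto simp: bij_betw_def)
      then obtain c where "v = comb (space_at R i) (d i) c (\<beta> i)"
        using \<beta>[OF i] unfolding basis_family_def spanning_family_def by auto
      then show ?thesis using comb[OF i, of c] v(2) by auto
    qed
    fix c p assume c: "comb (space_at R' i) (d i) c (\<lambda>p. \<theta> i (\<beta> i p)) = \<zero>\<^bsub>space_at R' i\<^esub>" and p: "p < d i"
    have "\<theta> i (comb (space_at R i) (d i) c (\<beta> i)) = \<theta> i \<zero>\<^bsub>space_at R i\<^esub>"
    proof -
      have "\<theta> i (comb (space_at R i) 0 c (\<beta> i)) = comb (space_at R' i) 0 c (\<lambda>p. \<theta> i (\<beta> i p))"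
        by (rule comb_map[OF V[OF i] V'[OF i] \<theta>[OF i]]) simp
      then show ?thesis using c comb[OF i, of c] by simp
    qed
    moreover have "comb (space_at R i) (d i) c (\<beta> i) \<in> carrier (space_at R i)"
      by (rule V.comb_closed) (rule \<beta>c[OF i])
    ultimately have "comb (space_at R i) (d i) c (\<beta> i) = \<zero>\<^bsub>space_at R i\<^esub>"
      using bij[OF i] by (auto simp: bij_betw_def dest: inj_onD)
    then show "c p = 0" using \<beta>[OF i] p unfolding basis_family_def by simp
  qed
  have transport: "is_matrix_of (d i) (\<lambda>p. \<theta> i (\<beta> i p)) (space_at R' j) (d j) (\<lambda>p. \<theta> j (\<beta> j p)) f' A"
    if i: "i \<in> verts Q" and j: "j \<in> verts Q"
      and A: "is_matrix_of (d i) (\<beta> i) (space_at R j) (d j) (\<beta> j) f A"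
      and f: "\<And>v. v \<in> carrier (space_at R i) \<Longrightarrow> \<theta> j (f v) = f' (\<theta> i v)" for i j f f' A
    unfolding is_matrix_of_iff
  proof (intro conjI allI impI)
    show "A \<in> carrier_mat (d j) (d i)" using A unfolding is_matrix_of_iff by (rule conjunct1)
    fix q assume q: "q < d i"
    have "f' (\<theta> i (\<beta> i q)) = \<theta> j (f (\<beta> i q))" using f[OF \<beta>c[OF i q]] by simp
    also have "\<dots> = \<theta> j (comb (space_at R j) (d j) (\<lambda>p. A $$ (p, q)) (\<beta> j))"
      using A q unfolding is_matrix_of_iff by simp
    finally show "f' (\<theta> i (\<beta> i q)) = comb (space_at R' j) (d j) (\<lambda>p. A $$ (p, q)) (\<lambda>p. \<theta> j (\<beta> j p))"
      unfolding comb[OF j] .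
  qed
  show "coordinate_point B Q d R' (\<lambda>i p. \<theta> i (\<beta> i p)) x"
    unfolding coordinate_point_def
  proof (intro conjI ballI)
    show "x \<in> rep_set B Q d" using x by (simp add: coordinate_point_def)
    fix i assume i: "i \<in> verts Q"
    show "ordered_basis (space_at R' i) (d i) (\<lambda>p. \<theta> i (\<beta> i p))"
      by (rule complex_vectorspace.basis_family_basis(1)[OF cv'[OF i] basis'[OF i]])
    fix b assume b: "b \<in> carrier B"
    show "is_matrix_of (d i) (\<lambda>p. \<theta> i (\<beta> i p)) (space_at R' i) (d i) (\<lambda>p. \<theta> i (\<beta> i p))
        (\<lambda>v. act_at R' i v b) (fst x i b)"
      by (rule transport[OF i i, of "\<lambda>v. act_at R i v b"])
        (use x i b act in \<open>auto simp: coordinate_point_def\<close>)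
  next
    fix a assume a: "a \<in> arcs Q"
    show "is_matrix_of (d (tail Q a)) (\<lambda>p. \<theta> (tail Q a) (\<beta> (tail Q a) p)) (space_at R' (head Q a)) (d (head Q a))
        (\<lambda>p. \<theta> (head Q a) (\<beta> (head Q a) p)) (map_at R' a) (snd x a)"
      by (rule transport[OF _ _ , of _ _ "map_at R a"])
        (use x a map tail_head in \<open>auto simp: coordinate_point_def\<close>)
  qed
qed

lemma rep_point_in_GL_orbit:
  assumes "x \<in> rep_set B Q d" "\<And>a. a \<in> arcs Q \<Longrightarrow> tail Q a \<in> verts Q \<and> head Q a \<in> verts Q"
  shows "x \<in> GL_orbit B Q d x"
proof -
  obtain \<rho> A where x: "x = (\<rho>, A)" by (cases x)
  have \<rho>: "\<rho> \<in> extensional (verts Q)" and A: "A \<in> extensional (arcs Q)"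
    and \<rho>i: "\<And>i. i \<in> verts Q \<Longrightarrow> \<rho> i \<in> carrier B \<rightarrow>\<^sub>E carrier_mat (d i) (d i)"
    and Aa: "\<And>a. a \<in> arcs Q \<Longrightarrow> A a \<in> carrier_mat (d (head Q a)) (d (tail Q a))"
    using assms(1) by (auto simp: x rep_set_def right_module_structure_def)
  have "\<rho> = (\<lambda>i\<in>verts Q. \<lambda>b\<in>carrier B. 1\<^sub>m (d i) * \<rho> i b * 1\<^sub>m (d i))"
  proof
    fix i show "\<rho> i = (\<lambda>i\<in>verts Q. \<lambda>b\<in>carrier B. 1\<^sub>m (d i) * \<rho> i b * 1\<^sub>m (d i)) i"
    proof (cases "i \<in> verts Q")
      case True
      have "\<rho> i b = (\<lambda>b\<in>carrier B. 1\<^sub>m (d i) * \<rho> i b * 1\<^sub>m (d i)) b" for b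
      proof (cases "b \<in> carrier B")
        case b: True
        have "\<rho> i b \<in> carrier_mat (d i) (d i)" using \<rho>i[OF True] b by auto
        then show ?thesis using b by simp
      next
        case False
        then show ?thesis using \<rho>i[OF True] by (auto simp: PiE_def extensional_def)
      qed
      then show ?thesis using True by auto
    next
      case False
      then show ?thesis using \<rho> by (auto simp: extensional_def)
    qed
  qed
  moreover have "A = (\<lambda>a\<in>arcs Q. 1\<^sub>m (d (head Q a)) * A a * 1\<^sub>m (d (tail Q a)))"
  proof
    fix a show "A a = (\<lambda>a\<in>arcs Q. 1\<^sub>m (d (head Q a)) * A a * 1\<^sub>m (d (tail Q a))) a"
      using A Aa[of a] by (cases "a \<in> arcs Q") (auto simp: extensional_def)
  qed
  ultimately have "x = (\<lambda>i\<in>verts Q. \<lambda>b\<in>carrier B. 1\<^sub>m (d i) * fst x i b * 1\<^sub>m (d i),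
      \<lambda>a\<in>arcs Q. 1\<^sub>m (d (head Q a)) * snd x a * 1\<^sub>m (d (tail Q a)))"
    by (simp add: x)
  then show ?thesis
    unfolding GL_orbit_def
    by (intro CollectI exI[of _ "\<lambda>i. 1\<^sub>m (d i)"]) simp
qed

section \<open>Bundles of vector spaces over a variety\<close>

text \<open>A family \<open>H\<close> of vector spaces whose dimension may jump, with a set \<open>\<S>\<close> of sections that are regarded
  as piecewise rational. Coordinates would need a basis in every fibre; the axioms ask instead that
  finitely many sections span all fibres and that the equation \<open>y = \<Sum>k. c k * w k\<close> between sections
  can be decided (by \<open>t\<close>) and solved (by \<open>c\<close>) in a piecewise rational way.\<close>

locale rational_bundle =
  fixes G :: "('p \<Rightarrow> complex) set" and N :: "'p set" and H :: "'p \<Rightarrow> (complex, 'w) module"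
    and \<S> :: "('p \<Rightarrow> 'w) set"
  assumes fibre: "x \<in> N \<Longrightarrow> vectorspace class_ring (H x)"
    and section_closed: "\<lbrakk>s \<in> \<S>; x \<in> N\<rbrakk> \<Longrightarrow> s x \<in> carrier (H x)"
    and generated: "\<exists>n z. (\<forall>k<n. z k \<in> \<S>) \<and> (\<forall>x \<in> N. spanning_family (H x) n (\<lambda>k. z k x))"
    and solvable: "\<lbrakk>\<forall>k<n. w k \<in> \<S>; y \<in> \<S>\<rbrakk> \<Longrightarrow> \<exists>t c. t \<in> piecewise_rational G \<and>
      (\<forall>k. c k \<in> piecewise_rational G) \<and>
      (\<forall>x \<in> N. (t x = 0 \<longleftrightarrow> (\<exists>c'. y x = comb (H x) n c' (\<lambda>k. w k x))) \<and>
        (t x = 0 \<longrightarrow> y x = comb (H x) n (\<lambda>k. c k x) (\<lambda>k. w k x)))"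

lemma constant_rational_bundle:
  assumes V: "vectorspace class_ring V" and fd: "vectorspace.fin_dim class_ring V"
  shows "rational_bundle G N (\<lambda>_. V) (rational_families G N V)"
proof (rule rational_bundle.intro)
  interpret V: complex_vectorspace V using V by (simp add: complex_vectorspace_def)
  show "vectorspace class_ring V" by (rule V)
  show "s x \<in> carrier V" if "s \<in> rational_families G N V" "x \<in> N" for s x
    by (rule V.rational_families_closed[OF that])
  obtain n v where v: "basis_family V n v" using V.exists_basis_family[OF fd] by blast
  show "\<exists>n z. (\<forall>k<n. z k \<in> rational_families G N V) \<and> (\<forall>x \<in> N. spanning_family V n (\<lambda>k. z k x))"
  proof (rule exI[of _ n], rule exI[of _ "\<lambda>k _. v k"], intro conjI allI impI ballI)
    show "(\<lambda>_. v k) \<in> rational_families G N V" if "k < n" for k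
      by (rule V.rational_families_const) (rule V.basis_family_closed[OF v that])
    show "spanning_family V n (\<lambda>k. v k)" using v by (simp add: basis_family_def)
  qed
  fix n and w :: "nat \<Rightarrow> 'b \<Rightarrow> 'a" and y
  assume w: "\<forall>k<n. w k \<in> rational_families G N V" and y: "y \<in> rational_families G N V"
  have "linear_condition G N n (\<lambda>x c. comb V n c (\<lambda>k. w k x) = y x)"
    by (rule V.linear_condition_comb_eq[OF fd _ y]) (use w in blast)
  from linear_condition_solution[OF this]
  show "\<exists>t c. t \<in> piecewise_rational G \<and> (\<forall>k. c k \<in> piecewise_rational G) \<and>
      (\<forall>x \<in> N. (t x = 0 \<longleftrightarrow> (\<exists>c'. y x = comb V n c' (\<lambda>k. w k x))) \<and>
        (t x = 0 \<longrightarrow> y x = comb V n (\<lambda>k. c k x) (\<lambda>k. w k x)))"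
    by (simp only: eq_commute[of "y _"])
qed

definition pivots :: "(complex, 'v) module \<Rightarrow> nat \<Rightarrow> (nat \<Rightarrow> 'v) \<Rightarrow> nat list" where
  "pivots V n v = filter (\<lambda>k. \<not> (\<exists>c. v k = comb V k c v)) [0..<n]"

lemma (in complex_vectorspace) basis_family_pivots:
  assumes v: "spanning_family V n v"
  shows "basis_family V (length (pivots V n v)) (\<lambda>p. v (pivots V n v ! p))"
proof -
  let ?J = "\<lambda>m. pivots V m v" and ?u = "\<lambda>m p. v (pivots V m v ! p)"
  have vc: "v i \<in> carrier V" if "i < n" for i using v that by (simp add: spanning_family_def)
  have J: "?J m ! p < m" if "p < length (?J m)" for m p
    using nth_mem[OF that] by (auto simp: pivots_def)
  have "m \<le> n \<Longrightarrow> (\<forall>c. \<exists>d. comb V m c v = comb V (length (?J m)) d (?u m)) \<and>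
      (\<forall>d. comb V (length (?J m)) d (?u m) = \<zero> \<longrightarrow> (\<forall>p<length (?J m). d p = 0))" for m
  proof (induction m)
    case 0
    then show ?case by (simp add: pivots_def)
  next
    case (Suc m)
    then have IH: "\<And>c. \<exists>d. comb V m c v = comb V (length (?J m)) d (?u m)"
      "\<And>d p. \<lbrakk>comb V (length (?J m)) d (?u m) = \<zero>; p < length (?J m)\<rbrakk> \<Longrightarrow> d p = 0" by auto
    have vm: "\<And>i. i < m \<Longrightarrow> v i \<in> carrier V" "\<And>i. i < Suc m \<Longrightarrow> v i \<in> carrier V" "v m \<in> carrier V"
      using Suc.prems vc by auto
    have uc: "\<And>p. p < length (?J m) \<Longrightarrow> ?u m p \<in> carrier V" using J vm(1) by blast
    show ?case
    proof (cases "\<exists>c. v m = comb V m c v")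
      case True
      then have JS: "?J (Suc m) = ?J m" by (simp add: pivots_def)
      obtain a where a: "v m = comb V m a v" using True by blast
      have "\<exists>d. comb V (Suc m) c v = comb V (length (?J m)) d (?u m)" for c
      proof -
        have "comb V (Suc m) c v = comb V m c v \<oplus> c m \<odot> comb V m a v"
          unfolding a[symmetric] by (rule comb_Suc) (rule vm(2))
        also have "\<dots> = comb V m c v \<oplus> comb V m (\<lambda>i. c m * a i) v"
          by (simp add: comb_smult[of m v, OF vm(1)])
        also have "\<dots> = comb V m (\<lambda>i. c i + c m * a i) v"
          by (rule comb_add[symmetric]) (rule vm(1))
        finally show ?thesis using IH(1) by simp
      qed
      then show ?thesis unfolding JS using IH(2) by auto
    next
      case False
      then have JS: "?J (Suc m) = ?J m @ [m]" by (simp add: pivots_def)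
      have len: "length (?J (Suc m)) = Suc (length (?J m))" by (simp add: JS)
      have u_old: "?u (Suc m) p = ?u m p" if "p < length (?J m)" for p by (simp add: JS nth_append that)
      have u_new: "?u (Suc m) (length (?J m)) = v m" by (simp add: JS)
      have split: "comb V (length (?J (Suc m))) d (?u (Suc m)) = comb V (length (?J m)) d (?u m) \<oplus> d (length (?J m)) \<odot> v m" for d
      proof -
        have "comb V (Suc (length (?J m))) d (?u (Suc m)) =
            comb V (length (?J m)) d (?u (Suc m)) \<oplus> d (length (?J m)) \<odot> ?u (Suc m) (length (?J m))"
          by (rule comb_Suc) (use u_old u_new uc vm in \<open>auto simp: less_Suc_eq\<close>)
        also have "comb V (length (?J m)) d (?u (Suc m)) = comb V (length (?J m)) d (?u m)"
          by (rule comb_cong) (use u_old uc in auto)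
        finally show ?thesis unfolding len u_new .
      qed
      have "\<exists>d. comb V (Suc m) c v = comb V (length (?J (Suc m))) d (?u (Suc m))" for c
      proof -
        obtain d where d: "comb V m c v = comb V (length (?J m)) d (?u m)" using IH(1) by blast
        have "comb V (length (?J (Suc m))) (d(length (?J m) := c m)) (?u (Suc m)) =
            comb V (length (?J m)) (d(length (?J m) := c m)) (?u m) \<oplus> c m \<odot> v m"
          unfolding split by simp
        also have "comb V (length (?J m)) (d(length (?J m) := c m)) (?u m) = comb V m c v"
          unfolding d by (rule comb_cong) (use uc in auto)
        also have "comb V m c v \<oplus> c m \<odot> v m = comb V (Suc m) c v"
          by (rule comb_Suc[symmetric]) (rule vm(2))
        finally show ?thesis by (intro exI[of _ "d(length (?J m) := c m)"]) (rule sym)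
      qed
      moreover have "\<forall>p<length (?J (Suc m)). d p = 0"
        if d: "comb V (length (?J (Suc m))) d (?u (Suc m)) = \<zero>" for d
      proof -
        let ?l = "length (?J m)"
        have sum: "comb V ?l d (?u m) \<oplus> d ?l \<odot> v m = \<zero>" using d unfolding split .
        have cl: "comb V ?l d (?u m) \<in> carrier V" by (rule comb_closed) (rule uc)
        have "d ?l = 0"
        proof (rule ccontr)
          assume nz: "d ?l \<noteq> 0"
          have "d ?l \<odot> v m = \<ominus> comb V ?l d (?u m)"
            using sum cl vm(3) by (metis M.a_comm M.minus_equality smult_in_carrier)
          also have "\<dots> = comb V ?l (\<lambda>p. - d p) (?u m)"
            by (rule comb_uminus[symmetric]) (rule uc)
          finally have "inverse (d ?l) \<odot> (d ?l \<odot> v m) = comb V ?l (\<lambda>p. inverse (d ?l) * - d p) (?u m)"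
            by (simp add: comb_smult[of ?l "?u m", OF uc, symmetric])
          then have "v m = comb V ?l (\<lambda>p. inverse (d ?l) * - d p) (?u m)"
            using vm(3) nz by (simp add: smult_mult[symmetric])
          also have "\<dots> = comb V ?l (\<lambda>p. inverse (d ?l) * - d p) (\<lambda>p. comb V m (\<lambda>i. if i = ?J m ! p then 1 else 0) v)"
            by (rule comb_cong) (simp_all add: comb_unit[of m v, OF vm(1) J] vm(1)[OF J])
          also have "\<dots> = comb V m (\<lambda>j. \<Sum>p<?l. inverse (d ?l) * - d p * (if j = ?J m ! p then 1 else 0)) v"
            by (rule comb_comb) (rule vm(1))
          finally show False using False by blast
        qed
        moreover from this sum have "comb V ?l d (?u m) = \<zero>" using cl vm(3) by simp
        ultimately show ?thesis using IH(2) by (auto simp: len less_Suc_eq)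
      qed
      ultimately show ?thesis by blast
    qed
  qed
  from this[of n] have *: "\<And>c. \<exists>d. comb V n c v = comb V (length (?J n)) d (?u n)"
    "\<And>d. comb V (length (?J n)) d (?u n) = \<zero> \<Longrightarrow> \<forall>p<length (?J n). d p = 0" by auto
  show ?thesis
    unfolding basis_family_def spanning_family_def
  proof (intro conjI allI impI ballI)
    show "?u n p \<in> carrier V" if "p < length (?J n)" for p using J[OF that] vc by blast
    show "\<exists>c. y = comb V (length (?J n)) c (?u n)" if y: "y \<in> carrier V" for y
    proof -
      obtain c where "y = comb V n c v" using v y unfolding spanning_family_def by blast
      then show ?thesis using *(1)[of c] by simp
    qed
  qed (use *(2) in blast)
qed


section \<open>Bundles of representations\<close>

text \<open>The action and the maps send sections to sections; that they depend piecewise rationally on the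
  point is encoded in this way.\<close>

locale representation_bundle =
  fixes G :: "('p \<Rightarrow> complex) set" and N :: "'p set" and B :: "(complex, 'b) module"
    and Q :: "('v, 'a) pre_digraph" and R :: "'p \<Rightarrow> ('v, 'a, 'b, 'w) representation"
    and \<S> :: "'v \<Rightarrow> ('p \<Rightarrow> 'w) set"
  assumes representation: "x \<in> N \<Longrightarrow> right_module_representation B Q (R x)"
    and fibre_bundle: "i \<in> verts Q \<Longrightarrow> rational_bundle G N (\<lambda>x. space_at (R x) i) (\<S> i)"
    and act_section: "\<lbrakk>i \<in> verts Q; s \<in> \<S> i; b \<in> carrier B\<rbrakk> \<Longrightarrow> (\<lambda>x. act_at (R x) i (s x) b) \<in> \<S> i"
    and map_section: "\<lbrakk>a \<in> arcs Q; s \<in> \<S> (tail Q a)\<rbrakk> \<Longrightarrow> (\<lambda>x. map_at (R x) a (s x)) \<in> \<S> (head Q a)"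
    and finite_quiver: "finite (verts Q)" "finite (arcs Q)"
    and tail_head: "a \<in> arcs Q \<Longrightarrow> tail Q a \<in> verts Q \<and> head Q a \<in> verts Q"
    and algebra_spanned: "\<exists>m c. spanning_family B m c"
begin

text \<open>At every vertex the pivots among the spanning sections \<open>z\<close> give a basis \<open>\<beta> x\<close>. The tests \<open>\<tau>\<close> decide
  which indices are pivots. For each of the finitely many possible pivot lists \<open>I'\<close>, the functions
  \<open>\<kappa> i I' s\<close> are the coordinates of the section \<open>s\<close> at the points with this pivot list. The finite set
  \<open>F\<close> consists of the tests and of the coordinates of the images of the spanning sections under the
  maps of the quiver and under algebra generators \<open>bg\<close>. Where no test in \<open>F\<close> changes between zero and
  nonzero, the pivots and hence the dimensions are constant, and all matrix entries are linear
  combinations of members of \<open>F\<close>.\<close>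

theorem exists_constructible_coordinates:
  assumes dims: "\<forall>x \<in> N. dimension_vector Q (R x) \<in> I"
  shows "\<exists>\<phi> \<beta>. constructible_map (affine_structure N G) (coproduct I (rep_variety B Q)) \<phi> \<and>
    (\<forall>x \<in> N. fst (\<phi> x) = dimension_vector Q (R x) \<and>
      (\<forall>i \<in> verts Q. basis_family (space_at (R x) i) (fst (\<phi> x) i) (\<beta> x i)) \<and>
      coordinate_point B Q (fst (\<phi> x)) (R x) (\<beta> x) (snd (\<phi> x)))"
proof -
  let ?H = "\<lambda>i x. space_at (R x) i"
  obtain m bg where bg: "spanning_family B m bg" using algebra_spanned by (elim exE)
  have bgB: "bg k \<in> carrier B" if "k < m" for k using bg that by (simp add: spanning_family_def)
  let ?gen = "\<lambda>i n z. (\<forall>k<n. z k \<in> \<S> i) \<and> (\<forall>x \<in> N. spanning_family (?H i x) n (\<lambda>k. z k x))"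
  define gen where "gen i = (SOME p. ?gen i (fst p) (snd p))" for i
  define n where "n i = fst (gen i)" for i
  define z where "z i = snd (gen i)" for i
  have gen: "?gen i (n i) (z i)" if i: "i \<in> verts Q" for i
  proof -
    obtain n' z' where "?gen i n' z'" using rational_bundle.generated[OF fibre_bundle[OF i]] by (elim exE)
    then have "\<exists>p. ?gen i (fst p) (snd p)" by (intro exI[of _ "(n', z')"]) simp
    then show ?thesis unfolding n_def z_def gen_def by (rule someI_ex)
  qed
  have z: "z i k \<in> \<S> i" if "i \<in> verts Q" "k < n i" for i k using gen[OF that(1)] that(2) by simp
  have span: "spanning_family (?H i x) (n i) (\<lambda>k. z i k x)" if "i \<in> verts Q" "x \<in> N" for i x
    using gen[OF that(1)] that(2) by simp
  have cv: "complex_vectorspace (?H i x)" if "i \<in> verts Q" "x \<in> N" for i x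
    using rational_bundle.fibre[OF fibre_bundle[OF that(1)] that(2)] by (simp add: complex_vectorspace_def)

  let ?test = "\<lambda>i k t. t \<in> piecewise_rational G \<and>
    (\<forall>x \<in> N. t x = 0 \<longleftrightarrow> (\<exists>c. z i k x = comb (?H i x) k c (\<lambda>l. z i l x)))"
  define \<tau> where "\<tau> i k = (SOME t. ?test i k t)" for i k
  have \<tau>: "?test i k (\<tau> i k)" if i: "i \<in> verts Q" and k: "k < n i" for i k
  proof -
    have "\<forall>l<k. z i l \<in> \<S> i" using z[OF i] k by simp
    from rational_bundle.solvable[OF fibre_bundle[OF i] this z[OF i k]] obtain t c where
      "t \<in> piecewise_rational G" and "\<forall>x \<in> N. (t x = 0 \<longleftrightarrow> (\<exists>c'. z i k x = comb (?H i x) k c' (\<lambda>l. z i l x))) \<and>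
        (t x = 0 \<longrightarrow> z i k x = comb (?H i x) k (\<lambda>k. c k x) (\<lambda>l. z i l x))"
      by (elim exE conjE)
    then have "\<exists>t. ?test i k t" by (intro exI[of _ t]) simp
    then show ?thesis unfolding \<tau>_def by (rule someI_ex)
  qed

  define J where "J i x = pivots (?H i x) (n i) (\<lambda>k. z i k x)" for i x
  define \<beta> where "\<beta> x i = (\<lambda>p. z i (J i x ! p) x)" for x i
  define d where "d x = (\<lambda>i\<in>verts Q. length (J i x))" for x
  have J\<tau>: "J i x = filter (\<lambda>k. \<tau> i k x \<noteq> 0) [0..<n i]" if "i \<in> verts Q" "x \<in> N" for i x
    unfolding J_def pivots_def by (rule filter_cong) (use \<tau>[OF that(1)] that(2) in auto)
  have basis: "basis_family (?H i x) (length (J i x)) (\<beta> x i)" if "i \<in> verts Q" "x \<in> N" for i x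
    unfolding \<beta>_def J_def by (rule complex_vectorspace.basis_family_pivots[OF cv[OF that] span[OF that]])
  have basis_d: "basis_family (?H i x) (d x i) (\<beta> x i)" if "i \<in> verts Q" "x \<in> N" for i x
    using basis[OF that] that by (simp add: d_def)
  have dimd: "d x = dimension_vector Q (R x)" if "x \<in> N" for x
    unfolding d_def dimension_vector_def
    by (rule restrict_ext) (use complex_vectorspace.basis_family_basis(2)[OF cv basis] that in simp)

  define Js where "Js i = (\<lambda>X. filter (\<lambda>k. k \<in> X) [0..<n i]) ` Pow {..<n i}" for i
  have Js_fin: "finite (Js i)" for i by (simp add: Js_def)
  have J_Js: "J i x \<in> Js i" for i x
    unfolding Js_def
  proof (rule image_eqI)
    show "J i x = filter (\<lambda>k. k \<in> set (J i x)) [0..<n i]"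
      unfolding J_def pivots_def by (rule filter_cong) auto
    show "set (J i x) \<in> Pow {..<n i}" by (auto simp: J_def pivots_def)
  qed
  have Js_less: "I' ! p < n i" if "I' \<in> Js i" "p < length I'" for I' i p
    using nth_mem[OF that(2)] that(1) by (auto simp: Js_def)

  let ?coef = "\<lambda>i I' s \<kappa>. (\<forall>p. \<kappa> p \<in> piecewise_rational G) \<and> (\<forall>x \<in> N.
    (\<exists>c. s x = comb (?H i x) (length I') c (\<lambda>p. z i (I' ! p) x)) \<longrightarrow>
      s x = comb (?H i x) (length I') (\<lambda>p. \<kappa> p x) (\<lambda>p. z i (I' ! p) x))"
  define \<kappa> where "\<kappa> i I' s = (SOME \<kappa>. ?coef i I' s \<kappa>)" for i I' s
  have \<kappa>: "?coef i I' s (\<kappa> i I' s)" if i: "i \<in> verts Q" and I': "I' \<in> Js i" and s: "s \<in> \<S> i" for i I' s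
  proof -
    have "\<forall>p<length I'. z i (I' ! p) \<in> \<S> i" using z[OF i] Js_less[OF I'] by simp
    from rational_bundle.solvable[OF fibre_bundle[OF i] this s] obtain t c where
      "t \<in> piecewise_rational G" and c: "\<forall>k. c k \<in> piecewise_rational G" and
      tc: "\<forall>x \<in> N. (t x = 0 \<longleftrightarrow> (\<exists>c'. s x = comb (?H i x) (length I') c' (\<lambda>p. z i (I' ! p) x))) \<and>
        (t x = 0 \<longrightarrow> s x = comb (?H i x) (length I') (\<lambda>k. c k x) (\<lambda>p. z i (I' ! p) x))"
      by (elim exE conjE)
    have "?coef i I' s c"
    proof (intro conjI ballI impI)
      show "\<forall>p. c p \<in> piecewise_rational G" by (rule c)
      fix x assume x: "x \<in> N" and ex: "\<exists>c. s x = comb (?H i x) (length I') c (\<lambda>p. z i (I' ! p) x)"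
      from bspec[OF tc x] ex show "s x = comb (?H i x) (length I') (\<lambda>p. c p x) (\<lambda>p. z i (I' ! p) x)"
        by (elim conjE) (drule iffD2, assumption, erule mp)
    qed
    then have "\<exists>\<kappa>. ?coef i I' s \<kappa>" by (rule exI[of _ c])
    then show ?thesis unfolding \<kappa>_def by (rule someI_ex)
  qed
  have coords_\<kappa>: "coords (?H i x) (length (J i x)) (\<beta> x i) (s x) p = \<kappa> i (J i x) s p x"
    if i: "i \<in> verts Q" and x: "x \<in> N" and s: "s \<in> \<S> i" and p: "p < length (J i x)" for i x s p
  proof -
    interpret complex_vectorspace "?H i x" by (rule cv[OF i x])
    have "s x \<in> carrier (?H i x)" by (rule rational_bundle.section_closed[OF fibre_bundle[OF i] s x])
    then have "s x = comb (?H i x) (length (J i x)) (coords (?H i x) (length (J i x)) (\<beta> x i) (s x)) (\<beta> x i)"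
      using comb_coords basis[OF i x] by (simp add: basis_family_def)
    then have "\<exists>c. s x = comb (?H i x) (length (J i x)) c (\<lambda>p. z i (J i x ! p) x)"
      unfolding \<beta>_def by (rule exI[of _ "coords (?H i x) (length (J i x)) (\<lambda>p. z i (J i x ! p) x) (s x)"])
    then have "s x = comb (?H i x) (length (J i x)) (\<lambda>p. \<kappa> i (J i x) s p x) (\<beta> x i)"
      using \<kappa>[OF i J_Js[of i x] s] x unfolding \<beta>_def by simp
    then have "coords (?H i x) (length (J i x)) (\<beta> x i) (s x) p =
        coords (?H i x) (length (J i x)) (\<beta> x i) (comb (?H i x) (length (J i x)) (\<lambda>p. \<kappa> i (J i x) s p x) (\<beta> x i)) p"
      by (rule arg_cong)
    also have "\<dots> = \<kappa> i (J i x) s p x" by (rule coords_comb[OF basis[OF i x] p])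
    finally show ?thesis .
  qed

  define sa where "sa i k l = (\<lambda>x. act_at (R x) i (z i k x) (bg l))" for i k l
  define sm where "sm a k = (\<lambda>x. map_at (R x) a (z (tail Q a) k x))" for a k
  have sa: "sa i k l \<in> \<S> i" if "i \<in> verts Q" "k < n i" "l < m" for i k l
    unfolding sa_def by (rule act_section) (use that z bgB in auto)
  have sm: "sm a k \<in> \<S> (head Q a)" if "a \<in> arcs Q" "k < n (tail Q a)" for a k
    unfolding sm_def by (rule map_section) (use that z tail_head in auto)
  define F where "F = (\<Union>i\<in>verts Q. \<tau> i ` {..<n i}) \<union>
    (\<Union>i\<in>verts Q. \<Union>I'\<in>Js i. \<Union>k\<in>{..<n i}. \<Union>l\<in>{..<m}. \<kappa> i I' (sa i k l) ` {..<length I'}) \<union>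
    (\<Union>a\<in>arcs Q. \<Union>I'\<in>Js (head Q a). \<Union>k\<in>{..<n (tail Q a)}. \<kappa> (head Q a) I' (sm a k) ` {..<length I'})"
  have F\<tau>: "\<tau> i k \<in> F" if "i \<in> verts Q" "k < n i" for i k
    unfolding F_def by (rule UnI1, rule UnI1, rule UN_I[OF that(1)], rule imageI) (simp add: that)
  have Fsa: "\<kappa> i I' (sa i k l) p \<in> F"
    if "i \<in> verts Q" "I' \<in> Js i" "k < n i" "l < m" "p < length I'" for i I' k l p
    unfolding F_def
    by (rule UnI1, rule UnI2, rule UN_I[OF that(1)], rule UN_I[OF that(2)], rule UN_I[of k],
        simp add: that, rule UN_I[of l], simp add: that, rule imageI) (simp add: that)
  have Fsm: "\<kappa> (head Q a) I' (sm a k) p \<in> F"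
    if "a \<in> arcs Q" "I' \<in> Js (head Q a)" "k < n (tail Q a)" "p < length I'" for a I' k p
    unfolding F_def
    by (rule UnI2, rule UN_I[OF that(1)], rule UN_I[OF that(2)], rule UN_I[of k],
        simp add: that, rule imageI) (simp add: that)
  have F_fin: "finite F"
    unfolding F_def using finite_quiver Js_fin by auto
  have F_rat: "F \<subseteq> piecewise_rational G"
    unfolding F_def
  proof (intro Un_least UN_least image_subsetI)
    show "\<tau> i k \<in> piecewise_rational G" if "i \<in> verts Q" "k \<in> {..<n i}" for i k
      using \<tau>[of i k] that by simp
    show "\<kappa> i I' (sa i k l) p \<in> piecewise_rational G"
      if "i \<in> verts Q" "I' \<in> Js i" "k \<in> {..<n i}" "l \<in> {..<m}" for i I' k l p
      using \<kappa>[OF that(1,2) sa[OF that(1), of k l]] that(3,4) by simp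
    show "\<kappa> (head Q a) I' (sm a k) p \<in> piecewise_rational G"
      if "a \<in> arcs Q" "I' \<in> Js (head Q a)" "k \<in> {..<n (tail Q a)}" for a I' k p
      using \<kappa>[OF conjunct2[OF tail_head[OF that(1)]] that(2) sm[OF that(1), of k]] that(3) by simp
  qed

  define \<phi> where "\<phi> x = (d x, coordinates_of B Q (R x) (d x) (\<beta> x))" for x
  have point: "coordinate_point B Q (d x) (R x) (\<beta> x) (snd (\<phi> x))" if "x \<in> N" for x
    unfolding \<phi>_def snd_conv
    by (rule right_module_representation.coordinate_point_coordinates_of[OF representation[OF that]])
      (rule basis_d[OF _ that])
  have "constructible_map (affine_structure N G)
      (coproduct I (\<lambda>d. affine_structure (rep_set B Q d) (rep_coordinates B Q d))) \<phi>"
  proof (rule constructible_mapI[OF F_fin F_rat])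
    show "fst (\<phi> x) \<in> I \<and> snd (\<phi> x) \<in> rep_set B Q (fst (\<phi> x))" if "x \<in> N" for x
      using bspec[OF dims that] dimd[OF that] point[OF that] by (simp add: \<phi>_def coordinate_point_def)
  next
    fix A y
    assume A: "A \<subseteq> N" and y: "y \<in> A" and FA: "F \<subseteq> quotients_on G A"
      and zero: "\<And>f x. f \<in> F \<Longrightarrow> x \<in> A \<Longrightarrow> f x = 0 \<longleftrightarrow> f y = 0"
    have JA: "J i x = J i y" if "i \<in> verts Q" "x \<in> A" for i x
    proof -
      have "x \<in> N" "y \<in> N" using that A y by auto
      then show ?thesis
        unfolding J\<tau>[OF that(1) \<open>x \<in> N\<close>] J\<tau>[OF that(1) \<open>y \<in> N\<close>]
        by (intro filter_cong) (use zero[OF F\<tau>[OF that(1)] that(2)] in auto)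
    qed
    have dA: "d x = d y" if "x \<in> A" for x
      unfolding d_def by (rule restrict_ext) (simp add: JA that)
    show "(\<forall>x\<in>A. fst (\<phi> x) = fst (\<phi> y)) \<and>
      (\<forall>g\<in>rep_coordinates B Q (fst (\<phi> y)). (\<lambda>x. g (snd (\<phi> x))) \<in> quotients_on G A)"
    proof (intro conjI ballI)
      show "fst (\<phi> x) = fst (\<phi> y)" if "x \<in> A" for x using dA[OF that] by (simp add: \<phi>_def)
      fix g assume "g \<in> rep_coordinates B Q (fst (\<phi> y))"
      then have "g \<in> rep_coordinates B Q (d y)" by (simp add: \<phi>_def)
      then consider i b p q where "g = (\<lambda>x. fst x i b $$ (p, q))" "i \<in> verts Q" "b \<in> carrier B" "p < d y i" "q < d y i"
        | a p q where "g = (\<lambda>x. snd x a $$ (p, q))" "a \<in> arcs Q" "p < d y (head Q a)" "q < d y (tail Q a)"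
        unfolding rep_coordinates_def by blast
      then show "(\<lambda>x. g (snd (\<phi> x))) \<in> quotients_on G A"
      proof cases
        case (1 i b p q)
        note i = 1(2)
        have pq: "p < length (J i y)" "q < length (J i y)" using 1 by (simp_all add: d_def)
        let ?k = "J i y ! q"
        have k: "?k < n i" by (rule Js_less[OF J_Js pq(2)])
        obtain c where c: "b = comb B m c bg" using bg 1(3) unfolding spanning_family_def by blast
        have "(\<lambda>x. \<Sum>l<m. c l * \<kappa> i (J i y) (sa i ?k l) p x) \<in> quotients_on G A"
        proof -
          have "\<kappa> i (J i y) (sa i ?k l) p \<in> quotients_on G A" if "l < m" for l
            using Fsa[OF i J_Js k that pq(1)] FA by blast
          then show ?thesis by (intro quotients_on_sum quotients_on_mult quotients_on_const) simp
        qed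
        then show ?thesis
        proof (rule quotients_on_cong)
          fix x assume xA: "x \<in> A"
          then have x: "x \<in> N" using A by blast
          interpret V: complex_vectorspace "?H i x" by (rule cv[OF i x])
          have zx: "z i ?k x \<in> carrier (?H i x)"
            by (rule rational_bundle.section_closed[OF fibre_bundle[OF i] z[OF i k] x])
          have lin: "act_at (R x) i (z i ?k x) \<in> module_hom class_ring B (?H i x)"
            by (rule right_module_representation.act_linear_algebra[OF representation[OF x] i zx])
          have act: "act_at (R x) i (z i ?k x) b = comb (?H i x) m c (\<lambda>l. sa i ?k l x)"
            unfolding c sa_def
            by (rule comb_map[OF right_module_representation.algebra[OF representation[OF x]]
                  V.vectorspace_axioms lin]) (rule bgB)
          have pq': "p < d x i" "q < d x i" using 1 dA[OF xA] by auto
          have "g (snd (\<phi> x)) = coords (?H i x) (length (J i x)) (\<beta> x i) (act_at (R x) i (z i ?k x) b) p"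
            using 1 pq' i JA[OF i xA] by (simp add: \<phi>_def coordinates_of_def matrix_of_def \<beta>_def d_def)
          also have "\<dots> = (\<Sum>l<m. c l * coords (?H i x) (length (J i x)) (\<beta> x i) (sa i ?k l x) p)"
            unfolding act
            by (rule V.coords_comb_vectors[OF basis[OF i x]])
              (use rational_bundle.section_closed[OF fibre_bundle[OF i] sa[OF i k] x] pq' i in \<open>auto simp: d_def\<close>)
          also have "\<dots> = (\<Sum>l<m. c l * \<kappa> i (J i y) (sa i ?k l) p x)"
          proof (rule sum.cong[OF refl])
            fix l assume "l \<in> {..<m}"
            then show "c l * coords (?H i x) (length (J i x)) (\<beta> x i) (sa i ?k l x) p = c l * \<kappa> i (J i y) (sa i ?k l) p x"
              using coords_\<kappa>[OF i x sa[OF i k], of l p] pq JA[OF i xA] by simp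
          qed
          finally show "(\<Sum>l<m. c l * \<kappa> i (J i y) (sa i ?k l) p x) = g (snd (\<phi> x))" by simp
        qed
      next
        case (2 a p q)
        have t: "tail Q a \<in> verts Q" and h: "head Q a \<in> verts Q" using tail_head[OF 2(2)] by auto
        have pq: "p < length (J (head Q a) y)" "q < length (J (tail Q a) y)" using 2 t h by (simp_all add: d_def)
        let ?k = "J (tail Q a) y ! q"
        have k: "?k < n (tail Q a)" by (rule Js_less[OF J_Js pq(2)])
        have "\<kappa> (head Q a) (J (head Q a) y) (sm a ?k) p \<in> quotients_on G A"
          using Fsm[OF 2(2) J_Js k pq(1)] FA by blast
        then show ?thesis
        proof (rule quotients_on_cong)
          fix x assume xA: "x \<in> A"
          then have x: "x \<in> N" using A by blast
          have pq': "p < d x (head Q a)" "q < d x (tail Q a)" using 2 dA[OF xA] by auto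
          have "g (snd (\<phi> x)) = coords (?H (head Q a) x) (length (J (head Q a) x)) (\<beta> x (head Q a)) (sm a ?k x) p"
            using 2 pq' t h JA[OF t xA] by (simp add: \<phi>_def coordinates_of_def matrix_of_def \<beta>_def d_def sm_def)
          also have "\<dots> = \<kappa> (head Q a) (J (head Q a) y) (sm a ?k) p x"
            using coords_\<kappa>[OF h x sm[OF 2(2) k], of p] pq JA[OF h xA] by simp
          finally show "\<kappa> (head Q a) (J (head Q a) y) (sm a ?k) p x = g (snd (\<phi> x))" by simp
        qed
      qed
    qed
  qed
  then have "constructible_map (affine_structure N G) (coproduct I (rep_variety B Q)) \<phi>"
    by (simp add: rep_variety_def[abs_def])
  moreover have "\<forall>x \<in> N. fst (\<phi> x) = dimension_vector Q (R x) \<and>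
      (\<forall>i \<in> verts Q. basis_family (space_at (R x) i) (fst (\<phi> x) i) (\<beta> x i)) \<and>
      coordinate_point B Q (fst (\<phi> x)) (R x) (\<beta> x) (snd (\<phi> x))"
    using dimd basis_d point by (simp add: \<phi>_def)
  ultimately show ?thesis by (intro exI conjI)
qed

end

section \<open>Arithmetic in linear categories\<close>

context linear_category
begin

lemma Hom_vs [simp, intro]: "\<lbrakk>X \<in> Ob C; Y \<in> Ob C\<rbrakk> \<Longrightarrow> complex_vectorspace (Hom C X Y)"
  by (simp add: complex_vectorspace_def hom_vectorspace)

lemma Hom_abelian_group: "\<lbrakk>X \<in> Ob C; Y \<in> Ob C\<rbrakk> \<Longrightarrow> abelian_group (Hom C X Y)"
  using hom_vectorspace[of X Y] by (simp add: vectorspace_def Module.module_def)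

lemma comp_closed [intro]:
  "\<lbrakk>X \<in> Ob C; Y \<in> Ob C; Z \<in> Ob C; f \<in> mor C X Y; g \<in> mor C Y Z\<rbrakk> \<Longrightarrow> g \<cdot> f \<in> mor C X Z"
  using module_hom_closed[OF comp_left_linear[of X Y Z g]] by auto

lemma zmor_closed [intro]: "\<lbrakk>X \<in> Ob C; Y \<in> Ob C\<rbrakk> \<Longrightarrow> zmor C X Y \<in> mor C X Y"
  using Hom_abelian_group[of X Y] by (simp add: abelian_group.axioms(1) abelian_monoid.zero_closed)

lemma add_closed [intro]:
  "\<lbrakk>X \<in> Ob C; Y \<in> Ob C; f \<in> mor C X Y; g \<in> mor C X Y\<rbrakk> \<Longrightarrow> f \<oplus>\<^bsub>Hom C X Y\<^esub> g \<in> mor C X Y"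
  using Hom_abelian_group[of X Y] by (simp add: abelian_group.axioms(1) abelian_monoid.a_closed)

lemma minus_closed [intro]:
  "\<lbrakk>X \<in> Ob C; Y \<in> Ob C; f \<in> mor C X Y; g \<in> mor C X Y\<rbrakk> \<Longrightarrow> f \<ominus>\<^bsub>Hom C X Y\<^esub> g \<in> mor C X Y"
  using Hom_abelian_group[of X Y] by (simp add: abelian_group.minus_closed)

lemma uminus_closed [intro]:
  "\<lbrakk>X \<in> Ob C; Y \<in> Ob C; f \<in> mor C X Y\<rbrakk> \<Longrightarrow> \<ominus>\<^bsub>Hom C X Y\<^esub> f \<in> mor C X Y"
  using Hom_abelian_group[of X Y] by (simp add: abelian_group.a_inv_closed)

lemma minus_eq_zero_iff:
  assumes "X \<in> Ob C" "Y \<in> Ob C" "f \<in> mor C X Y" "g \<in> mor C X Y"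
  shows "f \<ominus>\<^bsub>Hom C X Y\<^esub> g = zmor C X Y \<longleftrightarrow> f = g"
proof -
  interpret abelian_group "Hom C X Y" using Hom_abelian_group assms by blast
  show ?thesis using assms(3,4) by (metis a_minus_def minus_equality minus_minus r_neg a_inv_closed)
qed

lemma comp_left_mod_hom:
  assumes "X \<in> Ob C" "Y \<in> Ob C" "Z \<in> Ob C" "g \<in> mor C Y Z"
  shows "mod_hom class_ring (Hom C X Y) (Hom C X Z) (\<lambda>f. g \<cdot> f)"
  using comp_left_linear[OF assms] hom_vectorspace[of X Y] hom_vectorspace[of X Z] assms
  by (simp add: mod_hom_def mod_hom_axioms_def vectorspace_def)

lemma comp_right_mod_hom:
  assumes "X \<in> Ob C" "Y \<in> Ob C" "Z \<in> Ob C" "f \<in> mor C X Y"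
  shows "mod_hom class_ring (Hom C Y Z) (Hom C X Z) (\<lambda>g. g \<cdot> f)"
  using comp_right_linear[OF assms] hom_vectorspace[of Y Z] hom_vectorspace[of X Z] assms
  by (simp add: mod_hom_def mod_hom_axioms_def vectorspace_def)

lemma comp_add_right:
  "\<lbrakk>X \<in> Ob C; Y \<in> Ob C; Z \<in> Ob C; g \<in> mor C Y Z; f \<in> mor C X Y; f' \<in> mor C X Y\<rbrakk>
    \<Longrightarrow> g \<cdot> (f \<oplus>\<^bsub>Hom C X Y\<^esub> f') = g \<cdot> f \<oplus>\<^bsub>Hom C X Z\<^esub> g \<cdot> f'"
  using LinearCombinations.module_hom_add[OF comp_left_linear[of X Y Z g]] by simp

lemma comp_add_left:
  "\<lbrakk>X \<in> Ob C; Y \<in> Ob C; Z \<in> Ob C; f \<in> mor C X Y; g \<in> mor C Y Z; g' \<in> mor C Y Z\<rbrakk>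
    \<Longrightarrow> (g \<oplus>\<^bsub>Hom C Y Z\<^esub> g') \<cdot> f = g \<cdot> f \<oplus>\<^bsub>Hom C X Z\<^esub> g' \<cdot> f"
  using LinearCombinations.module_hom_add[OF comp_right_linear[of X Y Z f]] by simp

lemma comp_minus_right:
  "\<lbrakk>X \<in> Ob C; Y \<in> Ob C; Z \<in> Ob C; g \<in> mor C Y Z; f \<in> mor C X Y; f' \<in> mor C X Y\<rbrakk>
    \<Longrightarrow> g \<cdot> (f \<ominus>\<^bsub>Hom C X Y\<^esub> f') = g \<cdot> f \<ominus>\<^bsub>Hom C X Z\<^esub> g \<cdot> f'"
  using mod_hom.f_minus[OF comp_left_mod_hom[of X Y Z g]] by simp

lemma comp_minus_left:
  "\<lbrakk>X \<in> Ob C; Y \<in> Ob C; Z \<in> Ob C; f \<in> mor C X Y; g \<in> mor C Y Z; g' \<in> mor C Y Z\<rbrakk>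
    \<Longrightarrow> (g \<ominus>\<^bsub>Hom C Y Z\<^esub> g') \<cdot> f = g \<cdot> f \<ominus>\<^bsub>Hom C X Z\<^esub> g' \<cdot> f"
  using mod_hom.f_minus[OF comp_right_mod_hom[of X Y Z f]] by simp

lemma comp_uminus_right:
  "\<lbrakk>X \<in> Ob C; Y \<in> Ob C; Z \<in> Ob C; g \<in> mor C Y Z; f \<in> mor C X Y\<rbrakk>
    \<Longrightarrow> g \<cdot> (\<ominus>\<^bsub>Hom C X Y\<^esub> f) = \<ominus>\<^bsub>Hom C X Z\<^esub> (g \<cdot> f)"
  using mod_hom.f_neg[OF comp_left_mod_hom[of X Y Z g]] by simp

lemma comp_uminus_left:
  "\<lbrakk>X \<in> Ob C; Y \<in> Ob C; Z \<in> Ob C; f \<in> mor C X Y; g \<in> mor C Y Z\<rbrakk>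
    \<Longrightarrow> (\<ominus>\<^bsub>Hom C Y Z\<^esub> g) \<cdot> f = \<ominus>\<^bsub>Hom C X Z\<^esub> (g \<cdot> f)"
  using mod_hom.f_neg[OF comp_right_mod_hom[of X Y Z f]] by simp

lemma comp_zero_right:
  "\<lbrakk>X \<in> Ob C; Y \<in> Ob C; Z \<in> Ob C; g \<in> mor C Y Z\<rbrakk> \<Longrightarrow> g \<cdot> zmor C X Y = zmor C X Z"
  using mod_hom.f0_is_0[OF comp_left_mod_hom[of X Y Z g]] by simp

lemma comp_zero_left:
  "\<lbrakk>X \<in> Ob C; Y \<in> Ob C; Z \<in> Ob C; f \<in> mor C X Y\<rbrakk> \<Longrightarrow> zmor C Y Z \<cdot> f = zmor C X Z"
  using mod_hom.f0_is_0[OF comp_right_mod_hom[of X Y Z f]] by simp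

lemma comp_smult_left:
  "\<lbrakk>X \<in> Ob C; Y \<in> Ob C; Z \<in> Ob C; f \<in> mor C X Y; g \<in> mor C Y Z\<rbrakk>
    \<Longrightarrow> (c \<odot>\<^bsub>Hom C Y Z\<^esub> g) \<cdot> f = c \<odot>\<^bsub>Hom C X Z\<^esub> (g \<cdot> f)"
  using module_hom_smult[OF comp_right_linear[of X Y Z f], of c g] by simp

end

lemma (in additive_category) exists_biproduct:
  assumes "X \<in> Ob C" "Y \<in> Ob C"
  shows "\<exists>Z i0 i1 p0 p1. Z \<in> Ob C \<and> i0 \<in> mor C X Z \<and> i1 \<in> mor C Y Z \<and> p0 \<in> mor C Z X \<and> p1 \<in> mor C Z Y \<and>
    p0 \<cdot> i0 = Idn C X \<and> p1 \<cdot> i1 = Idn C Y \<and> p0 \<cdot> i1 = zmor C Y X \<and> p1 \<cdot> i0 = zmor C X Y \<and>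
    i0 \<cdot> p0 \<oplus>\<^bsub>Hom C Z Z\<^esub> i1 \<cdot> p1 = Idn C Z"
proof -
  let ?W = "\<lambda>i::nat. if i = 0 then X else Y"
  have "\<forall>i<2. ?W i \<in> Ob C" using assms by simp
  from direct_sums[OF this] obtain Z inc prj where Z: "is_direct_sum C Z 2 ?W inc prj"
    by (elim exE)
  have ZO: "Z \<in> Ob C" using Z by (simp add: is_direct_sum_def)
  have m: "inc 0 \<in> mor C X Z" "inc 1 \<in> mor C Y Z" "prj 0 \<in> mor C Z X" "prj 1 \<in> mor C Z Y"
    using Z by (auto simp: is_direct_sum_def dest: spec[of _ "0::nat"] spec[of _ "1::nat"])
  have e: "\<And>i j. i < 2 \<Longrightarrow> j < 2 \<Longrightarrow> prj i \<cdot> inc j = (if i = j then Idn C (?W i) else zmor C (?W j) (?W i))"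
    using Z by (simp add: is_direct_sum_def)
  interpret ZZ: abelian_group "Hom C Z Z" by (rule Hom_abelian_group[OF ZO ZO])
  have cl: "inc 0 \<cdot> prj 0 \<in> mor C Z Z" "inc 1 \<cdot> prj 1 \<in> mor C Z Z" using m assms ZO by blast+
  have "{..<2::nat} = {1, 0}" by auto
  then have "(\<Oplus>\<^bsub>Hom C Z Z\<^esub>i\<in>{..<2}. inc i \<cdot> prj i) = inc 1 \<cdot> prj 1 \<oplus>\<^bsub>Hom C Z Z\<^esub> inc 0 \<cdot> prj 0"
    using cl by simp
  then have s: "inc 0 \<cdot> prj 0 \<oplus>\<^bsub>Hom C Z Z\<^esub> inc 1 \<cdot> prj 1 = Idn C Z"
    using Z cl by (simp add: is_direct_sum_def ZZ.a_comm)
  show ?thesis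
    by (rule exI[of _ Z], rule exI[of _ "inc 0"], rule exI[of _ "inc 1"], rule exI[of _ "prj 0"], rule exI[of _ "prj 1"])
      (use ZO m e[of 0 0] e[of 0 1] e[of 1 0] e[of 1 1] s in simp)
qed

section \<open>The stable category\<close>

locale frobenius_with_suspension = frobenius_category E
  for E :: "('o, 'e) exact_category" (structure) +
  fixes S :: "('o, 'e) susp_choice"
  assumes susp_choice: "valid_susp_choice E S"
begin

lemma inj_ob: "X \<in> Ob E \<Longrightarrow> injective_object E (inj_ob S X)"
  and susp_confl: "X \<in> Ob E \<Longrightarrow> (X, inj_ob S X, susp_ob S X, inj_map S X, susp_map S X) \<in> Confl E"
  using susp_choice by (simp_all add: valid_susp_choice_def)

lemma susp_typed:
  assumes "X \<in> Ob E"
  shows "inj_ob S X \<in> Ob E" "susp_ob S X \<in> Ob E" "inj_map S X \<in> mor E X (inj_ob S X)"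
    "susp_map S X \<in> mor E (inj_ob S X) (susp_ob S X)"
    "is_kernel E X (inj_ob S X) (susp_ob S X) (inj_map S X) (susp_map S X)"
    "susp_map S X \<cdot> inj_map S X = zmor E X (susp_ob S X)"
    "inflation E X (inj_ob S X) (inj_map S X)" "deflation E (inj_ob S X) (susp_ob S X) (susp_map S X)"
proof -
  note c = confl_kernel_cokernel[OF susp_confl[OF assms]]
  show "inj_ob S X \<in> Ob E" "susp_ob S X \<in> Ob E"
    "is_kernel E X (inj_ob S X) (susp_ob S X) (inj_map S X) (susp_map S X)" using c by auto
  then show "inj_map S X \<in> mor E X (inj_ob S X)"
    "susp_map S X \<in> mor E (inj_ob S X) (susp_ob S X)"
    "susp_map S X \<cdot> inj_map S X = zmor E X (susp_ob S X)"
    by (auto simp: is_kernel_def)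
  show "inflation E X (inj_ob S X) (inj_map S X)" "deflation E (inj_ob S X) (susp_ob S X) (susp_map S X)"
    using susp_confl[OF assms] by (auto simp: inflation_def deflation_def)
qed

text \<open>A morphism from \<open>X\<close> to an injective object extends along \<open>X \<rightarrow> J X\<close>. This
  makes the morphisms that vanish in the stable category the image of one linear map \<open>E(J X, Y) \<rightarrow> E(X, Y)\<close>.\<close>

lemma inj_factoring_iff:
  assumes "X \<in> Ob E" "Y \<in> Ob E"
  shows "f \<in> inj_factoring E X Y \<longleftrightarrow> (\<exists>h \<in> mor E (inj_ob S X) Y. f = h \<cdot> inj_map S X)"
proof
  assume "f \<in> inj_factoring E X Y"
  then obtain g h J where J: "injective_object E J" and g: "g \<in> mor E X J" and h: "h \<in> mor E J Y"
    and f: "f = h \<cdot> g" by (auto simp: inj_factoring_def)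
  have JO: "J \<in> Ob E" using J by (simp add: injective_object_def)
  obtain g' where g': "g' \<in> mor E (inj_ob S X) J" "g' \<cdot> inj_map S X = g"
    using J g susp_typed(7)[OF assms(1)] unfolding injective_object_def by blast
  have "f = (h \<cdot> g') \<cdot> inj_map S X"
    unfolding f g'(2)[symmetric]
    by (rule comp_assoc[symmetric, OF assms(1) susp_typed(1)[OF assms(1)] JO assms(2) susp_typed(3)[OF assms(1)] g'(1) h])
  moreover have "h \<cdot> g' \<in> mor E (inj_ob S X) Y"
    using comp_closed[OF susp_typed(1)[OF assms(1)] JO assms(2) g'(1) h] .
  ultimately show "\<exists>h \<in> mor E (inj_ob S X) Y. f = h \<cdot> inj_map S X" by blast
next
  assume "\<exists>h \<in> mor E (inj_ob S X) Y. f = h \<cdot> inj_map S X"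
  then show "f \<in> inj_factoring E X Y"
    using inj_ob[OF assms(1)] susp_typed(3)[OF assms(1)] unfolding inj_factoring_def by blast
qed

lemma inj_factoring_subset: "\<lbrakk>X \<in> Ob E; Y \<in> Ob E; f \<in> inj_factoring E X Y\<rbrakk> \<Longrightarrow> f \<in> mor E X Y"
  using inj_factoring_iff susp_typed comp_closed by metis

lemma inj_factoring_zero: "\<lbrakk>X \<in> Ob E; Y \<in> Ob E\<rbrakk> \<Longrightarrow> zmor E X Y \<in> inj_factoring E X Y"
  using inj_factoring_iff[of X Y] comp_zero_left[of X "inj_ob S X" Y "inj_map S X"] susp_typed[of X] zmor_closed
  by metis

lemma inj_factoring_add:
  assumes "X \<in> Ob E" "Y \<in> Ob E" "f \<in> inj_factoring E X Y" "g \<in> inj_factoring E X Y"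
  shows "f \<oplus>\<^bsub>Hom E X Y\<^esub> g \<in> inj_factoring E X Y"
proof -
  obtain h h' where h: "h \<in> mor E (inj_ob S X) Y" "f = h \<cdot> inj_map S X"
    and h': "h' \<in> mor E (inj_ob S X) Y" "g = h' \<cdot> inj_map S X"
    using assms inj_factoring_iff[OF assms(1,2)] by blast
  have "f \<oplus>\<^bsub>Hom E X Y\<^esub> g = (h \<oplus>\<^bsub>Hom E (inj_ob S X) Y\<^esub> h') \<cdot> inj_map S X"
    using comp_add_left[OF assms(1) susp_typed(1)[OF assms(1)] assms(2) susp_typed(3)[OF assms(1)] h(1) h'(1)] h h' by simp
  moreover have "h \<oplus>\<^bsub>Hom E (inj_ob S X) Y\<^esub> h' \<in> mor E (inj_ob S X) Y"
    using add_closed h h' assms susp_typed by blast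
  ultimately show ?thesis using inj_factoring_iff[OF assms(1,2)] by blast
qed

lemma inj_factoring_smult:
  assumes "X \<in> Ob E" "Y \<in> Ob E" "f \<in> inj_factoring E X Y"
  shows "c \<odot>\<^bsub>Hom E X Y\<^esub> f \<in> inj_factoring E X Y"
proof -
  obtain h where h: "h \<in> mor E (inj_ob S X) Y" "f = h \<cdot> inj_map S X"
    using assms inj_factoring_iff[OF assms(1,2)] by blast
  have "c \<odot>\<^bsub>Hom E X Y\<^esub> f = (c \<odot>\<^bsub>Hom E (inj_ob S X) Y\<^esub> h) \<cdot> inj_map S X"
    using comp_smult_left[OF assms(1) susp_typed(1)[OF assms(1)] assms(2) susp_typed(3)[OF assms(1)] h(1)] h by simp
  moreover have "c \<odot>\<^bsub>Hom E (inj_ob S X) Y\<^esub> h \<in> mor E (inj_ob S X) Y"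
    using complex_vectorspace.smult_in_carrier[OF Hom_vs] h assms susp_typed by blast
  ultimately show ?thesis using inj_factoring_iff[OF assms(1,2)] by blast
qed

lemma inj_factoring_uminus:
  assumes "X \<in> Ob E" "Y \<in> Ob E" "f \<in> inj_factoring E X Y"
  shows "\<ominus>\<^bsub>Hom E X Y\<^esub> f \<in> inj_factoring E X Y"
  using inj_factoring_smult[OF assms, of "-1"]
    complex_vectorspace.minus_one_smult[OF Hom_vs[OF assms(1,2)] inj_factoring_subset[OF assms]] by simp

lemma inj_factoring_comp_left:
  assumes "X \<in> Ob E" "Y \<in> Ob E" "Z \<in> Ob E" "f \<in> inj_factoring E X Y" "g \<in> mor E Y Z"
  shows "g \<cdot> f \<in> inj_factoring E X Z"
proof -
  obtain a b J where *: "injective_object E J" "a \<in> mor E X J" "b \<in> mor E J Y" "f = b \<cdot> a"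
    using assms(4) by (auto simp: inj_factoring_def)
  have J: "J \<in> Ob E" using *(1) by (simp add: injective_object_def)
  have "g \<cdot> f = (g \<cdot> b) \<cdot> a" unfolding *(4) using comp_assoc assms * J by simp
  moreover have "g \<cdot> b \<in> mor E J Z" using assms * J by blast
  ultimately show ?thesis using * unfolding inj_factoring_def by blast
qed

lemma inj_factoring_comp_right:
  assumes "X \<in> Ob E" "Y \<in> Ob E" "Z \<in> Ob E" "f \<in> mor E X Y" "g \<in> inj_factoring E Y Z"
  shows "g \<cdot> f \<in> inj_factoring E X Z"
proof -
  obtain a b J where *: "injective_object E J" "a \<in> mor E Y J" "b \<in> mor E J Z" "g = b \<cdot> a"
    using assms(5) by (auto simp: inj_factoring_def)
  have J: "J \<in> Ob E" using *(1) by (simp add: injective_object_def)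
  have "g \<cdot> f = b \<cdot> (a \<cdot> f)" unfolding *(4) using comp_assoc assms * J by simp
  moreover have "a \<cdot> f \<in> mor E X J" using assms * J by blast
  ultimately show ?thesis using * unfolding inj_factoring_def by blast
qed

lemma stable_class_eq_iff:
  assumes "X \<in> Ob E" "Y \<in> Ob E" "f \<in> mor E X Y" "g \<in> mor E X Y"
  shows "stable_class E X Y f = stable_class E X Y g \<longleftrightarrow> f \<ominus>\<^bsub>Hom E X Y\<^esub> g \<in> inj_factoring E X Y"
proof -
  interpret XY: abelian_group "Hom E X Y" by (rule Hom_abelian_group[OF assms(1,2)])
  let ?I = "inj_factoring E X Y"
  note sub = inj_factoring_subset[OF assms(1,2)]
  have coset: "?I +>\<^bsub>Hom E X Y\<^esub> h = {n \<oplus>\<^bsub>Hom E X Y\<^esub> h | n. n \<in> ?I}" for h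
    by (auto simp: a_r_coset_def')
  have mem: "h \<in> ?I +>\<^bsub>Hom E X Y\<^esub> h" if "h \<in> mor E X Y" for h
    using inj_factoring_zero[OF assms(1,2)] that unfolding coset by force
  have le: "?I +>\<^bsub>Hom E X Y\<^esub> f' \<subseteq> ?I +>\<^bsub>Hom E X Y\<^esub> g'"
    if "f' \<ominus>\<^bsub>Hom E X Y\<^esub> g' \<in> ?I" and m: "f' \<in> mor E X Y" "g' \<in> mor E X Y" for f' g'
  proof
    fix y assume "y \<in> ?I +>\<^bsub>Hom E X Y\<^esub> f'"
    then obtain n where n: "n \<in> ?I" "y = n \<oplus>\<^bsub>Hom E X Y\<^esub> f'" unfolding coset by blast
    have "y = (n \<oplus>\<^bsub>Hom E X Y\<^esub> (f' \<ominus>\<^bsub>Hom E X Y\<^esub> g')) \<oplus>\<^bsub>Hom E X Y\<^esub> g'"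
      using n(2) m sub[OF n(1)] by (simp add: a_minus_def XY.a_assoc XY.l_neg)
    moreover have "n \<oplus>\<^bsub>Hom E X Y\<^esub> (f' \<ominus>\<^bsub>Hom E X Y\<^esub> g') \<in> ?I"
      by (rule inj_factoring_add[OF assms(1,2) n(1) that(1)])
    ultimately show "y \<in> ?I +>\<^bsub>Hom E X Y\<^esub> g'" unfolding coset by blast
  qed
  show ?thesis
  proof
    assume "stable_class E X Y f = stable_class E X Y g"
    then have "f \<in> ?I +>\<^bsub>Hom E X Y\<^esub> g" using mem[OF assms(3)] by (simp add: stable_class_def)
    then obtain n where n: "n \<in> ?I" "f = n \<oplus>\<^bsub>Hom E X Y\<^esub> g" unfolding coset by blast
    then have "f \<ominus>\<^bsub>Hom E X Y\<^esub> g = n"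
      using sub[OF n(1)] assms(4) by (simp add: a_minus_def XY.a_assoc XY.r_neg)
    then show "f \<ominus>\<^bsub>Hom E X Y\<^esub> g \<in> ?I" using n(1) by simp
  next
    assume fg: "f \<ominus>\<^bsub>Hom E X Y\<^esub> g \<in> ?I"
    have "g \<ominus>\<^bsub>Hom E X Y\<^esub> f = \<ominus>\<^bsub>Hom E X Y\<^esub> (f \<ominus>\<^bsub>Hom E X Y\<^esub> g)"
      using assms(3,4) by (simp add: a_minus_def XY.minus_add XY.a_comm)
    then have "g \<ominus>\<^bsub>Hom E X Y\<^esub> f \<in> ?I" using inj_factoring_uminus[OF assms(1,2) fg] by simp
    from le[OF fg assms(3,4)] le[OF this assms(4,3)]
    show "stable_class E X Y f = stable_class E X Y g" by (simp add: stable_class_def)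
  qed
qed

lemma stable_rep_class:
  assumes "X \<in> Ob E" "Y \<in> Ob E" "f \<in> mor E X Y"
  shows "stable_rep (stable_class E X Y f) \<in> mor E X Y"
    "stable_class E X Y (stable_rep (stable_class E X Y f)) = stable_class E X Y f"
proof -
  interpret XY: abelian_group "Hom E X Y" by (rule Hom_abelian_group[OF assms(1,2)])
  let ?I = "inj_factoring E X Y"
  note sub = inj_factoring_subset[OF assms(1,2)]
  have coset: "?I +>\<^bsub>Hom E X Y\<^esub> h = {n \<oplus>\<^bsub>Hom E X Y\<^esub> h | n. n \<in> ?I}" for h
    by (auto simp: a_r_coset_def')
  have "\<exists>g. g \<in> ?I +>\<^bsub>Hom E X Y\<^esub> f" using inj_factoring_zero[OF assms(1,2)] unfolding coset by blast
  then have "stable_rep (stable_class E X Y f) \<in> ?I +>\<^bsub>Hom E X Y\<^esub> f"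
    unfolding stable_rep_def stable_class_def snd_conv by (rule someI_ex)
  then obtain n where n: "n \<in> ?I" "stable_rep (stable_class E X Y f) = n \<oplus>\<^bsub>Hom E X Y\<^esub> f"
    unfolding coset by blast
  show m: "stable_rep (stable_class E X Y f) \<in> mor E X Y"
    using n sub[OF n(1)] assms(3) by simp
  have "stable_rep (stable_class E X Y f) \<ominus>\<^bsub>Hom E X Y\<^esub> f = n"
    using n(2) sub[OF n(1)] assms(3) by (simp add: a_minus_def XY.a_assoc XY.r_neg)
  then show "stable_class E X Y (stable_rep (stable_class E X Y f)) = stable_class E X Y f"
    using stable_class_eq_iff[OF assms(1,2) m assms(3)] n(1) by simp
qed

end


locale stable_triangulated =
  E: frobenius_with_suspension E S + C: triangulated_category C
  for E :: "('o, 'e) exact_category" (structure) and S :: "('o, 'e) susp_choice"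
    and C :: "('o, ('o, 'e) stable_mor) tri_category" +
  assumes C_stable: "C = stable_category E S"
begin

lemma Ob_C [simp]: "Ob C = Ob E"
  and Susp_C [simp]: "Susp C X = susp_ob S X"
  and SuspM_C: "SuspM C = stable_suspM E S"
  and Tri_C: "Tri C = stable_triangles E S"
  and Hom_C: "Hom C X Y = stable_hom E X Y"
  and Comp_C: "Comp C b a = stable_class E (fst a) (fst (snd b)) (stable_rep b \<cdot> stable_rep a)"
  and Idn_C: "Idn C X = stable_class E X X (Idn E X)"
  by (simp_all add: C_stable stable_category_def stable_lin_def)

lemma mor_C: "mor C X Y = stable_class E X Y ` mor E X Y"
  by (simp add: Hom_C stable_hom_def)

lemma class_closed [intro]: "f \<in> mor E X Y \<Longrightarrow> stable_class E X Y f \<in> mor C X Y"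
  by (simp add: mor_C)

lemma class_add:
  assumes "X \<in> Ob E" "Y \<in> Ob E" "f \<in> mor E X Y" "g \<in> mor E X Y"
  shows "stable_class E X Y (f \<oplus>\<^bsub>Hom E X Y\<^esub> g) = stable_class E X Y f \<oplus>\<^bsub>Hom C X Y\<^esub> stable_class E X Y g"
proof -
  interpret XY: abelian_group "Hom E X Y" by (rule E.Hom_abelian_group[OF assms(1,2)])
  let ?f = "stable_rep (stable_class E X Y f)" and ?g = "stable_rep (stable_class E X Y g)"
  note f = E.stable_rep_class[OF assms(1,2,3)] and g = E.stable_rep_class[OF assms(1,2,4)]
  have "?f \<ominus>\<^bsub>Hom E X Y\<^esub> f \<in> inj_factoring E X Y" "?g \<ominus>\<^bsub>Hom E X Y\<^esub> g \<in> inj_factoring E X Y"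
    using E.stable_class_eq_iff[OF assms(1,2) f(1) assms(3)] E.stable_class_eq_iff[OF assms(1,2) g(1) assms(4)] f g
    by simp_all
  from E.inj_factoring_add[OF assms(1,2) this]
  have "(?f \<oplus>\<^bsub>Hom E X Y\<^esub> ?g) \<ominus>\<^bsub>Hom E X Y\<^esub> (f \<oplus>\<^bsub>Hom E X Y\<^esub> g) \<in> inj_factoring E X Y"
    using f(1) g(1) assms(3,4) by (simp add: a_minus_def XY.minus_add XY.a_ac)
  then have "stable_class E X Y (?f \<oplus>\<^bsub>Hom E X Y\<^esub> ?g) = stable_class E X Y (f \<oplus>\<^bsub>Hom E X Y\<^esub> g)"
    using E.stable_class_eq_iff[OF assms(1,2)] f(1) g(1) assms by blast
  then show ?thesis by (simp add: Hom_C stable_hom_def)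
qed

lemma class_smult:
  assumes "X \<in> Ob E" "Y \<in> Ob E" "f \<in> mor E X Y"
  shows "stable_class E X Y (c \<odot>\<^bsub>Hom E X Y\<^esub> f) = c \<odot>\<^bsub>Hom C X Y\<^esub> stable_class E X Y f"
proof -
  interpret XY: complex_vectorspace "Hom E X Y" using assms by blast
  let ?f = "stable_rep (stable_class E X Y f)"
  note f = E.stable_rep_class[OF assms(1,2,3)]
  have "?f \<ominus>\<^bsub>Hom E X Y\<^esub> f \<in> inj_factoring E X Y"
    using E.stable_class_eq_iff[OF assms(1,2) f(1) assms(3)] f by simp
  from E.inj_factoring_smult[OF assms(1,2) this, of c]
  have "(c \<odot>\<^bsub>Hom E X Y\<^esub> ?f) \<ominus>\<^bsub>Hom E X Y\<^esub> (c \<odot>\<^bsub>Hom E X Y\<^esub> f) \<in> inj_factoring E X Y"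
    using f(1) assms(3)
    by (simp add: a_minus_def XY.smult_add_vector XY.minus_one_smult[symmetric] XY.smult_mult[symmetric])
  then have "stable_class E X Y (c \<odot>\<^bsub>Hom E X Y\<^esub> ?f) = stable_class E X Y (c \<odot>\<^bsub>Hom E X Y\<^esub> f)"
    using E.stable_class_eq_iff[OF assms(1,2)] f(1) assms(3) by blast
  then show ?thesis by (simp add: Hom_C stable_hom_def)
qed

lemma class_zero: "stable_class E X Y (zmor E X Y) = zmor C X Y"
  by (simp add: Hom_C stable_hom_def)

lemma class_linear:
  assumes "X \<in> Ob E" "Y \<in> Ob E"
  shows "stable_class E X Y \<in> module_hom class_ring (Hom E X Y) (Hom C X Y)"
  unfolding LinearCombinations.module_hom_def using class_add[OF assms] class_smult[OF assms] class_closed by simp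

lemma class_eq_zero_iff:
  assumes "X \<in> Ob E" "Y \<in> Ob E" "f \<in> mor E X Y"
  shows "stable_class E X Y f = zmor C X Y \<longleftrightarrow> (\<exists>h \<in> mor E (inj_ob S X) Y. f = h \<cdot> inj_map S X)"
proof -
  interpret XY: abelian_group "Hom E X Y" by (rule E.Hom_abelian_group[OF assms(1,2)])
  have "f \<ominus>\<^bsub>Hom E X Y\<^esub> zmor E X Y = f" using assms(3) by (simp add: a_minus_def)
  then show ?thesis
    using E.stable_class_eq_iff[OF assms E.zmor_closed[OF assms(1,2)]] E.inj_factoring_iff[OF assms(1,2)]
    by (simp add: class_zero)
qed

lemma class_comp:
  assumes "X \<in> Ob E" "Y \<in> Ob E" "Z \<in> Ob E" "f \<in> mor E X Y" "g \<in> mor E Y Z"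
  shows "stable_class E X Z (g \<cdot> f) = stable_class E Y Z g \<cdot>\<^bsub>C\<^esub> stable_class E X Y f"
proof -
  interpret XZ: abelian_group "Hom E X Z" by (rule E.Hom_abelian_group[OF assms(1,3)])
  let ?f = "stable_rep (stable_class E X Y f)" and ?g = "stable_rep (stable_class E Y Z g)"
  note f = E.stable_rep_class[OF assms(1,2,4)] and g = E.stable_rep_class[OF assms(2,3,5)]
  have d: "?f \<ominus>\<^bsub>Hom E X Y\<^esub> f \<in> inj_factoring E X Y" "?g \<ominus>\<^bsub>Hom E Y Z\<^esub> g \<in> inj_factoring E Y Z"
    using E.stable_class_eq_iff[OF assms(1,2) f(1) assms(4)] E.stable_class_eq_iff[OF assms(2,3) g(1) assms(5)] f g
    by simp_all
  have m: "?g \<cdot> ?f \<in> mor E X Z" "?g \<cdot> f \<in> mor E X Z" "g \<cdot> f \<in> mor E X Z"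
    using assms f(1) g(1) by blast+
  have "?g \<cdot> ?f \<ominus>\<^bsub>Hom E X Z\<^esub> ?g \<cdot> f \<in> inj_factoring E X Z"
    using E.inj_factoring_comp_left[OF assms(1,2,3) d(1) g(1)] E.comp_minus_right[OF assms(1,2,3) g(1) f(1) assms(4)]
    by simp
  then have 1: "stable_class E X Z (?g \<cdot> ?f) = stable_class E X Z (?g \<cdot> f)"
    using E.stable_class_eq_iff[OF assms(1,3) m(1,2)] by simp
  have "?g \<cdot> f \<ominus>\<^bsub>Hom E X Z\<^esub> g \<cdot> f \<in> inj_factoring E X Z"
    using E.inj_factoring_comp_right[OF assms(1,2,3,4) d(2)] E.comp_minus_left[OF assms(1,2,3,4) g(1) assms(5)]
    by simp
  then have 2: "stable_class E X Z (?g \<cdot> f) = stable_class E X Z (g \<cdot> f)"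
    using E.stable_class_eq_iff[OF assms(1,3) m(2,3)] by simp
  show ?thesis unfolding Comp_C using 1 2 by (simp add: stable_class_def)
qed

text \<open>The pullback \<open>Y\<close> of \<open>\<pi> : J M \<rightarrow> \<Sigma>M\<close> along \<open>\<sigma>\<close> contains \<open>M\<close> as the kernel of \<open>p : Y \<rightarrow> L\<close>. For the
  standard triangle on \<open>i : M \<rightarrow> Y\<close> one needs the pushout of \<open>M \<rightarrow> J M\<close> along \<open>i\<close>. Since \<open>M \<rightarrow> J M\<close>
  extends along \<open>i\<close> to \<open>s : Y \<rightarrow> J M\<close>, this pushout is \<open>L \<oplus> J M\<close>, with \<open>(p, s)\<close> as the map from \<open>Y\<close>, and
  \<open>(-\<sigma>, \<pi>)\<close> is the induced map to \<open>\<Sigma>M\<close>. The summand \<open>J M\<close> vanishes in the stable category, which leaves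
  a triangle with third map \<open>-\<sigma>\<close>.\<close>

lemma pullback_of_susp_map:
  assumes M: "M \<in> Ob E" and L: "L \<in> Ob E" and \<sigma>: "\<sigma> \<in> mor E L (susp_ob S M)"
  shows "\<exists>Y p s i. Y \<in> Ob E \<and> p \<in> mor E Y L \<and> s \<in> mor E Y (inj_ob S M) \<and> i \<in> mor E M Y \<and>
    susp_map S M \<cdot> s = \<sigma> \<cdot> p \<and> p \<cdot> i = zmor E M L \<and> s \<cdot> i = inj_map S M \<and>
    (\<forall>W \<in> Ob E. \<forall>x \<in> mor E W L. \<forall>j \<in> mor E W (inj_ob S M). susp_map S M \<cdot> j = \<sigma> \<cdot> x \<longrightarrow>
      (\<exists>!h. h \<in> mor E W Y \<and> p \<cdot> h = x \<and> s \<cdot> h = j)) \<and>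
    (M, Y, L, stable_class E M Y i, stable_class E Y L p,
      stable_class E L (susp_ob S M) (\<ominus>\<^bsub>Hom E L (susp_ob S M)\<^esub> \<sigma>)) \<in> Tri C"
proof -
  let ?J = "inj_ob S M" and ?SM = "susp_ob S M" and ?\<iota> = "inj_map S M" and ?\<pi> = "susp_map S M"
  note susp = E.susp_typed[OF M]
  have J: "?J \<in> Ob E" and SM: "?SM \<in> Ob E" and \<iota>: "?\<iota> \<in> mor E M ?J" and \<pi>: "?\<pi> \<in> mor E ?J ?SM"
    using susp by auto
  obtain Y p s where pb: "is_pullback E ?J ?SM Y L ?\<pi> \<sigma> p s" and defl: "deflation E Y L p"
    using E.deflation_pullback[OF susp(8) L \<sigma>] by blast
  have Y: "Y \<in> Ob E" and p: "p \<in> mor E Y L" and s: "s \<in> mor E Y ?J" and sq: "?\<pi> \<cdot> s = \<sigma> \<cdot> p"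
    using pb by (auto simp: is_pullback_def)
  have univ: "\<exists>!h. h \<in> mor E W Y \<and> p \<cdot> h = x \<and> s \<cdot> h = j"
    if "W \<in> Ob E" "x \<in> mor E W L" "j \<in> mor E W ?J" "?\<pi> \<cdot> j = \<sigma> \<cdot> x" for W x j
  proof -
    have "\<exists>!h. h \<in> mor E W Y \<and> s \<cdot> h = j \<and> p \<cdot> h = x"
      using pb that unfolding is_pullback_def by blast
    then show ?thesis by (simp add: conj_commute)
  qed
  have "?\<pi> \<cdot> ?\<iota> = \<sigma> \<cdot> zmor E M L"
    using susp(6) E.comp_zero_right[OF M L SM \<sigma>] by simp
  from univ[OF M E.zmor_closed[OF M L] \<iota> this] obtain i where
    i: "i \<in> mor E M Y" and pi: "p \<cdot> i = zmor E M L" and si: "s \<cdot> i = ?\<iota>" by blast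

  \<comment> \<open>the deflation \<open>p\<close> is a cokernel of \<open>i\<close>, since \<open>i\<close> is also its kernel\<close>
  have coker: "\<exists>!g. g \<in> mor E L W \<and> g \<cdot> p = f"
    if W: "W \<in> Ob E" and f: "f \<in> mor E Y W" and fi: "f \<cdot> i = zmor E M W" for W f
  proof -
    obtain K k where K: "(K, Y, L, k, p) \<in> Confl E" using defl by (auto simp: deflation_def)
    have KO: "K \<in> Ob E" and ker: "is_kernel E K Y L k p" and cok: "is_cokernel E K Y L k p"
      using E.confl_kernel_cokernel[OF K] by auto
    have k: "k \<in> mor E K Y" and pk: "p \<cdot> k = zmor E K L" using ker by (auto simp: is_kernel_def)
    have sk: "s \<cdot> k \<in> mor E K ?J" using KO Y J k s by blast
    have "?\<pi> \<cdot> (s \<cdot> k) = (?\<pi> \<cdot> s) \<cdot> k"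
      by (rule E.comp_assoc[OF KO Y J SM k s \<pi>, symmetric])
    also have "\<dots> = \<sigma> \<cdot> (p \<cdot> k)" unfolding sq by (rule E.comp_assoc[OF KO Y L SM k p \<sigma>])
    also have "\<dots> = zmor E K ?SM" unfolding pk by (rule E.comp_zero_right[OF KO L SM \<sigma>])
    finally have 0: "?\<pi> \<cdot> (s \<cdot> k) = zmor E K ?SM" .
    then obtain g where g: "g \<in> mor E K M" "?\<iota> \<cdot> g = s \<cdot> k"
      using susp(5) KO sk unfolding is_kernel_def by blast
    have ig: "i \<cdot> g \<in> mor E K Y" using KO M Y g(1) i by blast
    have "p \<cdot> (i \<cdot> g) = zmor E K L"
      using E.comp_assoc[OF KO M Y L g(1) i p] pi E.comp_zero_left[OF KO M L g(1)] by simp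
    moreover have "s \<cdot> (i \<cdot> g) = s \<cdot> k"
      using E.comp_assoc[OF KO M Y J g(1) i s] si g(2) by simp
    moreover have "?\<pi> \<cdot> (s \<cdot> k) = \<sigma> \<cdot> zmor E K L"
      using 0 E.comp_zero_right[OF KO L SM \<sigma>] by simp
    ultimately have kig: "k = i \<cdot> g"
      using univ[OF KO E.zmor_closed[OF KO L] sk] pk k ig by blast
    have "f \<cdot> k = zmor E K W"
      unfolding kig using E.comp_assoc[OF KO M Y W g(1) i f] fi E.comp_zero_left[OF KO M W g(1)] by simp
    then show ?thesis using cok W f unfolding is_cokernel_def by blast
  qed

  obtain Z i0 i1 p0 p1 where Z: "Z \<in> Ob E" and i0: "i0 \<in> mor E L Z" and i1: "i1 \<in> mor E ?J Z"
    and p0: "p0 \<in> mor E Z L" and p1: "p1 \<in> mor E Z ?J"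
    and id0: "p0 \<cdot> i0 = Idn E L" and id1: "p1 \<cdot> i1 = Idn E ?J"
    and z01: "p0 \<cdot> i1 = zmor E ?J L" and z10: "p1 \<cdot> i0 = zmor E L ?J"
    and sum: "i0 \<cdot> p0 \<oplus>\<^bsub>Hom E Z Z\<^esub> i1 \<cdot> p1 = Idn E Z"
    using E.exists_biproduct[OF L J] by (elim exE conjE)
  define v where "v = i0 \<cdot> p \<oplus>\<^bsub>Hom E Y Z\<^esub> i1 \<cdot> s"
  define w where "w = ?\<pi> \<cdot> p1 \<ominus>\<^bsub>Hom E Z ?SM\<^esub> \<sigma> \<cdot> p0"
  have i0p: "i0 \<cdot> p \<in> mor E Y Z" and i1s: "i1 \<cdot> s \<in> mor E Y Z"
    and \<pi>p1: "?\<pi> \<cdot> p1 \<in> mor E Z ?SM" and \<sigma>p0: "\<sigma> \<cdot> p0 \<in> mor E Z ?SM"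
    using Y Z L J SM i0 i1 p s p0 p1 \<pi> \<sigma> by blast+
  have v: "v \<in> mor E Y Z" unfolding v_def by (rule E.add_closed[OF Y Z i0p i1s])
  have w: "w \<in> mor E Z ?SM" unfolding w_def by (rule E.minus_closed[OF Z SM \<pi>p1 \<sigma>p0])
  interpret YZ: abelian_group "Hom E Y Z" by (rule E.Hom_abelian_group[OF Y Z])
  interpret YSM: abelian_group "Hom E Y ?SM" by (rule E.Hom_abelian_group[OF Y SM])
  interpret JSM: abelian_group "Hom E ?J ?SM" by (rule E.Hom_abelian_group[OF J SM])
  interpret LSM: abelian_group "Hom E L ?SM" by (rule E.Hom_abelian_group[OF L SM])
  interpret YL: abelian_group "Hom E Y L" by (rule E.Hom_abelian_group[OF Y L])
  interpret YJ: abelian_group "Hom E Y ?J" by (rule E.Hom_abelian_group[OF Y J])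
  interpret MZ: abelian_group "Hom E M Z" by (rule E.Hom_abelian_group[OF M Z])
  have p0v: "p0 \<cdot> v = p"
    unfolding v_def E.comp_add_right[OF Y Z L p0 i0p i1s]
      E.comp_assoc[OF Y L Z L p i0 p0, symmetric] E.comp_assoc[OF Y J Z L s i1 p0, symmetric] id0 z01
      E.id_left[OF Y L p] E.comp_zero_left[OF Y J L s] using p by simp
  have p1v: "p1 \<cdot> v = s"
    unfolding v_def E.comp_add_right[OF Y Z J p1 i0p i1s]
      E.comp_assoc[OF Y L Z J p i0 p1, symmetric] E.comp_assoc[OF Y J Z J s i1 p1, symmetric] id1 z10
      E.id_left[OF Y J s] E.comp_zero_left[OF Y L J p] using s by simp
  have wv: "w \<cdot> v = zmor E Y ?SM"
    unfolding w_def E.comp_minus_left[OF Y Z SM v \<pi>p1 \<sigma>p0]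
      E.comp_assoc[OF Y Z J SM v p1 \<pi>] E.comp_assoc[OF Y Z L SM v p0 \<sigma>] p0v p1v sq
    using E.minus_eq_zero_iff[OF Y SM] E.comp_closed[OF Y L SM p \<sigma>] by blast
  have wi1: "w \<cdot> i1 = ?\<pi>"
    unfolding w_def E.comp_minus_left[OF J Z SM i1 \<pi>p1 \<sigma>p0]
      E.comp_assoc[OF J Z J SM i1 p1 \<pi>] E.comp_assoc[OF J Z L SM i1 p0 \<sigma>] id1 z01
      E.id_right[OF J SM \<pi>] E.comp_zero_right[OF J L SM \<sigma>] using \<pi> by (simp add: a_minus_def)
  have wi0: "w \<cdot> i0 = \<ominus>\<^bsub>Hom E L ?SM\<^esub> \<sigma>"
    unfolding w_def E.comp_minus_left[OF L Z SM i0 \<pi>p1 \<sigma>p0]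
      E.comp_assoc[OF L Z J SM i0 p1 \<pi>] E.comp_assoc[OF L Z L SM i0 p0 \<sigma>] id0 z10
      E.id_right[OF L SM \<sigma>] E.comp_zero_right[OF L J SM \<pi>] using \<sigma> by (simp add: a_minus_def)
  have vi: "i1 \<cdot> ?\<iota> = v \<cdot> i"
    unfolding v_def E.comp_add_left[OF M Y Z i i0p i1s]
      E.comp_assoc[OF M Y L Z i p i0] E.comp_assoc[OF M Y J Z i s i1] pi si
      E.comp_zero_right[OF M L Z i0] using E.comp_closed[OF M J Z \<iota> i1] by simp
  have "is_pushout E M ?J Y Z ?\<iota> i v i1"
    unfolding is_pushout_def
  proof (intro conjI ballI impI)
    show "{M, ?J, Y, Z} \<subseteq> Ob E" using M J Y Z by simp
    fix W a b assume W: "W \<in> Ob E" and a: "a \<in> mor E ?J W" and b: "b \<in> mor E Y W"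
      and ab: "a \<cdot> ?\<iota> = b \<cdot> i"
    interpret YW: abelian_group "Hom E Y W" by (rule E.Hom_abelian_group[OF Y W])
    interpret JW: abelian_group "Hom E ?J W" by (rule E.Hom_abelian_group[OF J W])
    interpret ZW: abelian_group "Hom E Z W" by (rule E.Hom_abelian_group[OF Z W])
    have as: "a \<cdot> s \<in> mor E Y W" using Y J W s a by blast
    let ?f = "b \<ominus>\<^bsub>Hom E Y W\<^esub> a \<cdot> s"
    have f: "?f \<in> mor E Y W" by (rule E.minus_closed[OF Y W b as])
    have "?f \<cdot> i = b \<cdot> i \<ominus>\<^bsub>Hom E M W\<^esub> a \<cdot> (s \<cdot> i)"
      using E.comp_minus_left[OF M Y W i b as] E.comp_assoc[OF M Y J W i s a] by simp
    also have "\<dots> = zmor E M W"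
      using E.minus_eq_zero_iff[OF M W] E.comp_closed[OF M Y W i b] ab si by simp
    finally obtain g where g: "g \<in> mor E L W" "g \<cdot> p = ?f" using coker[OF W f] by blast
    define h where "h = g \<cdot> p0 \<oplus>\<^bsub>Hom E Z W\<^esub> a \<cdot> p1"
    have gp0: "g \<cdot> p0 \<in> mor E Z W" and ap1: "a \<cdot> p1 \<in> mor E Z W"
      using Z L J W p0 p1 g(1) a by blast+
    have h: "h \<in> mor E Z W" unfolding h_def by (rule E.add_closed[OF Z W gp0 ap1])
    have hi1: "h \<cdot> i1 = a"
      unfolding h_def E.comp_add_left[OF J Z W i1 gp0 ap1]
        E.comp_assoc[OF J Z L W i1 p0 g(1)] E.comp_assoc[OF J Z J W i1 p1 a] id1 z01
        E.comp_zero_right[OF J L W g(1)] E.id_right[OF J W a] using a by simp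
    have hv: "h \<cdot> v = b"
      unfolding h_def E.comp_add_left[OF Y Z W v gp0 ap1]
        E.comp_assoc[OF Y Z L W v p0 g(1)] E.comp_assoc[OF Y Z J W v p1 a] p0v p1v g(2)
      using b as by (simp add: a_minus_def YW.a_assoc YW.l_neg)
    show "\<exists>!h. h \<in> mor E Z W \<and> h \<cdot> i1 = a \<and> h \<cdot> v = b"
    proof (rule ex1I[of _ h])
      show "h \<in> mor E Z W \<and> h \<cdot> i1 = a \<and> h \<cdot> v = b" using h hi1 hv by simp
      fix h' assume "h' \<in> mor E Z W \<and> h' \<cdot> i1 = a \<and> h' \<cdot> v = b"
      then have h': "h' \<in> mor E Z W" and h'i1: "h' \<cdot> i1 = a" and h'v: "h' \<cdot> v = b" by auto
      have h'i0: "h' \<cdot> i0 \<in> mor E L W" using L Z W i0 h' by blast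
      have "b = (h' \<cdot> i0) \<cdot> p \<oplus>\<^bsub>Hom E Y W\<^esub> a \<cdot> s"
        unfolding h'v[symmetric] h'i1[symmetric] v_def E.comp_add_right[OF Y Z W h' i0p i1s]
          E.comp_assoc[OF Y L Z W p i0 h'] E.comp_assoc[OF Y J Z W s i1 h'] ..
      then have "(h' \<cdot> i0) \<cdot> p = ?f"
        using as E.comp_closed[OF Y L W p h'i0] by (simp add: a_minus_def YW.a_assoc YW.r_neg)
      then have h'g: "h' \<cdot> i0 = g" using coker[OF W f] g h'i0
        \<open>?f \<cdot> i = b \<cdot> i \<ominus>\<^bsub>Hom E M W\<^esub> a \<cdot> (s \<cdot> i)\<close> \<open>b \<cdot> i \<ominus>\<^bsub>Hom E M W\<^esub> a \<cdot> (s \<cdot> i) = zmor E M W\<close>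
        by (metis (no_types, lifting))
      have ii: "i0 \<cdot> p0 \<in> mor E Z Z" "i1 \<cdot> p1 \<in> mor E Z Z" using L J Z i0 i1 p0 p1 by blast+
      have "h' = h' \<cdot> Idn E Z" using E.id_right[OF Z W h'] by simp
      also have "\<dots> = (h' \<cdot> i0) \<cdot> p0 \<oplus>\<^bsub>Hom E Z W\<^esub> (h' \<cdot> i1) \<cdot> p1"
        unfolding sum[symmetric] E.comp_add_right[OF Z Z W h' ii]
          E.comp_assoc[OF Z L Z W p0 i0 h'] E.comp_assoc[OF Z J Z W p1 i1 h'] ..
      finally show "h' = h" unfolding h'g h'i1 h_def .
    qed
  qed (use \<iota> i v i1 vi in auto)
  then have std: "(M, Y, Z, stable_class E M Y i, stable_class E Y Z v, stable_class E Z ?SM w) \<in> standard_triangles E S"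
    unfolding standard_triangles_def using w wi1 wv by blast

  have lin: "mor (stable_lin E) = mor C" "Comp (stable_lin E) = Comp C" "Idn (stable_lin E) = Idn C"
    "Hom (stable_lin E) = Hom C"
    by (simp_all add: C_stable stable_category_def)
  have iso_eq: "is_iso (stable_lin E) = is_iso C" by (simp add: is_iso_def[abs_def] lin)
  have id_iso: "is_iso C X X (Idn C X)" if "X \<in> Ob E" for X
    unfolding is_iso_def using C.id_mor[of X] C.id_left[of X X "Idn C X"] that by auto
  have J0: "stable_class E Z Z (i1 \<cdot> p1) = zmor C Z Z"
  proof -
    have "i1 \<cdot> p1 \<in> inj_factoring E Z Z" using E.inj_ob[OF M] i1 p1 unfolding inj_factoring_def by blast
    then show ?thesis
      using class_eq_zero_iff[OF Z Z E.comp_closed[OF Z J Z p1 i1]] E.inj_factoring_iff[OF Z Z] by simp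
  qed
  have J1: "stable_class E Y Z (i1 \<cdot> s) = zmor C Y Z"
  proof -
    have "i1 \<cdot> s \<in> inj_factoring E Y Z" using E.inj_ob[OF M] i1 s unfolding inj_factoring_def by blast
    then show ?thesis using class_eq_zero_iff[OF Y Z i1s] E.inj_factoring_iff[OF Y Z] by simp
  qed
  have c_iso: "is_iso C L Z (stable_class E L Z i0)"
    unfolding is_iso_def
  proof (intro conjI bexI[of _ "stable_class E Z L p0"])
    show "stable_class E L Z i0 \<in> mor C L Z" "stable_class E Z L p0 \<in> mor C Z L" using i0 p0 by blast+
    show "stable_class E Z L p0 \<cdot>\<^bsub>C\<^esub> stable_class E L Z i0 = Idn C L"
      using class_comp[OF L Z L i0 p0] id0 by (simp add: Idn_C)
    interpret ZZ: abelian_group "Hom C Z Z" by (rule C.Hom_abelian_group) (simp_all add: Z)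
    have ii: "i0 \<cdot> p0 \<in> mor E Z Z" "i1 \<cdot> p1 \<in> mor E Z Z" using L J Z i0 i1 p0 p1 by blast+
    have "Idn C Z = stable_class E Z Z (i0 \<cdot> p0)"
      unfolding Idn_C sum[symmetric] class_add[OF Z Z ii] J0 using class_closed[OF ii(1)] by simp
    then show "stable_class E L Z i0 \<cdot>\<^bsub>C\<^esub> stable_class E Z L p0 = Idn C Z"
      using class_comp[OF Z L Z p0 i0] by simp
  qed
  let ?u = "stable_class E M Y i" and ?v = "stable_class E Y L p" and ?w = "stable_class E L ?SM (\<ominus>\<^bsub>Hom E L ?SM\<^esub> \<sigma>)"
  have m: "?u \<in> mor C M Y" "?v \<in> mor C Y L" "?w \<in> mor C L ?SM"
    using i p E.uminus_closed[OF L SM \<sigma>] by blast+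
  have eq1: "Idn C Y \<cdot>\<^bsub>C\<^esub> ?u = ?u \<cdot>\<^bsub>C\<^esub> Idn C M"
    using C.id_left[of M Y ?u] C.id_right[of M Y ?u] m(1) M Y by simp
  have eq2: "stable_class E L Z i0 \<cdot>\<^bsub>C\<^esub> ?v = stable_class E Y Z v \<cdot>\<^bsub>C\<^esub> Idn C Y"
  proof -
    interpret CYZ: abelian_group "Hom C Y Z" by (rule C.Hom_abelian_group) (simp_all add: Y Z)
    have "stable_class E Y Z v = stable_class E Y Z (i0 \<cdot> p)"
      unfolding v_def class_add[OF Y Z i0p i1s] J1 using class_closed[OF i0p] by simp
    then show ?thesis
      using class_comp[OF Y L Z p i0] C.id_right[of Y Z "stable_class E Y Z v"] class_closed[OF v] Y Z by simp
  qed
  have eq3: "stable_suspM E S (Idn C M) \<cdot>\<^bsub>C\<^esub> ?w = stable_class E Z ?SM w \<cdot>\<^bsub>C\<^esub> stable_class E L Z i0"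
  proof -
    have "stable_suspM E S (Idn C M) = Idn C ?SM" using C.susp_id[of M] M by (simp add: SuspM_C)
    then show ?thesis
      using class_comp[OF L Z SM i0 w] wi0 C.id_left[of L ?SM ?w] m(3) L SM by simp
  qed
  have "(M, Y, L, ?u, ?v, ?w) \<in> Tri C"
    unfolding Tri_C stable_triangles_def
    using M Y L m std id_iso[OF M] id_iso[OF Y] c_iso eq1 eq2 eq3
    unfolding mem_Collect_eq prod.case lin iso_eq by blast
  then show ?thesis
    using Y p s i sq pi si univ by blast
qed

end

lemma dim_le_of_exact:
  assumes U: "vectorspace class_ring U" "vectorspace.fin_dim class_ring U"
    and V: "vectorspace class_ring V" "vectorspace.fin_dim class_ring V"
    and W: "vectorspace class_ring W" "vectorspace.fin_dim class_ring W"
    and f: "f \<in> module_hom class_ring U V" and g: "g \<in> module_hom class_ring V W"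
    and exact: "f ` carrier U = {v \<in> carrier V. g v = \<zero>\<^bsub>W\<^esub>}"
  shows "vdim V \<le> vdim U + vdim W"
proof -
  interpret f: linear_map class_ring U V f
    using U V f by (simp add: linear_map_def mod_hom_def mod_hom_axioms_def vectorspace_def)
  interpret W: vectorspace class_ring W by (rule W(1))
  interpret g: linear_map class_ring V W g
    using V W g by (simp add: linear_map_def mod_hom_def mod_hom_axioms_def vectorspace_def)
  have eq: "f.im = g.ker" using exact by (simp add: f.im_def g.ker_def)
  have 1: "vectorspace.dim class_ring (W\<lparr>carrier := g.im\<rparr>) \<le> vdim W"
  proof -
    let ?I = "W\<lparr>carrier := g.im\<rparr>"
    have I: "vectorspace class_ring ?I" by (rule W.subspace_is_vs[OF g.imT_is_subspace])
    have sub: "submodule class_ring g.im W" by (rule g.im_is_submodule)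
    have "g \<in> module_hom class_ring V ?I"
      using g by (auto simp: LinearCombinations.module_hom_def g.im_def)
    then have "linear_map class_ring V ?I g"
      using V(1) I by (simp add: linear_map_def mod_hom_def mod_hom_axioms_def vectorspace_def)
    from linear_map.rank_nullity_main(2)[OF this V(2)] have "vectorspace.fin_dim class_ring ?I"
      by (simp add: g.im_def)
    then obtain b where b: "finite b" "vectorspace.basis class_ring ?I b"
      using vectorspace.finite_basis_exists[OF I] by blast
    have bI: "b \<subseteq> g.im" "LinearCombinations.module.lin_indpt class_ring ?I b"
      using b(2) by (simp_all add: vectorspace.basis_def[OF I])
    have "b \<subseteq> carrier W" using bI(1) sub by (auto simp: submodule_def)
    moreover have "\<not> W.lin_dep b" using W.span_li_not_depend(2)[OF bI(1) sub] bI(2) by simp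
    ultimately have "card b \<le> vdim W" by (rule W.li_le_dim(2)[OF W(2)])
    then show ?thesis using vectorspace.dim_basis[OF I b] by simp
  qed
  have "vdim U \<ge> vectorspace.dim class_ring (V\<lparr>carrier := f.im\<rparr>)"
    using f.rank_nullity[OF U(2)] by simp
  then show ?thesis using g.rank_nullity[OF V(2)] 1 unfolding eq by simp
qed

section \<open>Triangulated categories\<close>

context triangulated_category
begin

lemma exists_zero_object: "\<exists>Z. zero_object C Z"
proof -
  obtain Z inc prj where "is_direct_sum C Z 0 (\<lambda>_. undefined) inc prj"
    using direct_sums[of 0 "\<lambda>_. undefined"] by auto
  then have Z: "Z \<in> Ob C" and sum: "(\<Oplus>\<^bsub>Hom C Z Z\<^esub>i\<in>{..<0::nat}. inc i \<cdot> prj i) = Idn C Z"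
    by (simp_all only: is_direct_sum_def)
  interpret abelian_group "Hom C Z Z" by (rule Hom_abelian_group[OF Z Z])
  have "Idn C Z = zmor C Z Z" using sum by simp
  then show ?thesis using Z by (auto simp: zero_object_def)
qed

lemma susp_mor: "\<lbrakk>X \<in> Ob C; Y \<in> Ob C; f \<in> mor C X Y\<rbrakk> \<Longrightarrow> SuspM C f \<in> mor C (Susp C X) (Susp C Y)"
  using susp_fully_faithful by (auto simp: bij_betw_def)

lemma susp_inj:
  "\<lbrakk>X \<in> Ob C; Y \<in> Ob C; f \<in> mor C X Y; g \<in> mor C X Y; SuspM C f = SuspM C g\<rbrakk> \<Longrightarrow> f = g"
  using susp_fully_faithful[of X Y] by (auto simp: bij_betw_def dest: inj_onD)

lemma susp_full:
  "\<lbrakk>X \<in> Ob C; Y \<in> Ob C; h \<in> mor C (Susp C X) (Susp C Y)\<rbrakk> \<Longrightarrow> \<exists>f \<in> mor C X Y. SuspM C f = h"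
  using susp_fully_faithful[of X Y] unfolding bij_betw_def by (metis imageE)

lemma susp_zero:
  assumes "X \<in> Ob C" "Y \<in> Ob C"
  shows "SuspM C (zmor C X Y) = zmor C (Susp C X) (Susp C Y)"
proof -
  have "mod_hom class_ring (Hom C X Y) (Hom C (Susp C X) (Susp C Y)) (SuspM C)"
    using susp_linear[OF assms] hom_vectorspace[OF assms] hom_vectorspace[OF susp_ob susp_ob, OF assms]
    by (simp add: mod_hom_def mod_hom_axioms_def vectorspace_def)
  from mod_hom.f0_is_0[OF this] show ?thesis .
qed

lemma uminus_inj:
  assumes "X \<in> Ob C" "Y \<in> Ob C" "f \<in> mor C X Y" "g \<in> mor C X Y"
    "\<ominus>\<^bsub>Hom C X Y\<^esub> f = \<ominus>\<^bsub>Hom C X Y\<^esub> g"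
  shows "f = g"
proof -
  interpret abelian_group "Hom C X Y" by (rule Hom_abelian_group[OF assms(1,2)])
  show ?thesis using assms(3-5) by (metis minus_minus)
qed

lemma triangle_rotate:
  assumes "(X, Y, Z, u, v, w) \<in> Tri C"
  shows "(Y, Z, Susp C X, v, w, \<ominus>\<^bsub>Hom C (Susp C X) (Susp C Y)\<^esub> SuspM C u) \<in> Tri C"
  using tri_typed[OF assms] TR2 assms by blast

lemma triangle_comp_zero:
  assumes t: "(X, Y, Z, u, v, w) \<in> Tri C"
  shows "v \<cdot> u = zmor C X Z"
proof -
  have X: "X \<in> Ob C" and Y: "Y \<in> Ob C" and Z: "Z \<in> Ob C" and u: "u \<in> mor C X Y" and v: "v \<in> mor C Y Z"
    using tri_typed[OF t] by auto
  obtain O' where O': "zero_object C O'" using exists_zero_object by blast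
  have O'b: "O' \<in> Ob C" using O' by (simp add: zero_object_def)
  from TR3[OF TR1_id[OF X O'] t id_mor[OF X] u] obtain c where
    c: "c \<in> mor C O' Z" "c \<cdot> zmor C X O' = v \<cdot> u" by blast
  show ?thesis using c comp_zero_right[OF X O'b Z c(1)] by simp
qed

text \<open>The morphism \<open>f\<close> is the first component of a morphism from the rotated trivial triangle
  \<open>T \<rightarrow> 0 \<rightarrow> \<Sigma>T\<close> to \<open>Y \<rightarrow> Z \<rightarrow> \<Sigma>X\<close>. Its third component is \<open>\<Sigma>g\<close> for the morphism \<open>g\<close> sought, since \<open>\<Sigma>\<close> is full.\<close>

lemma triangle_exact:
  assumes t: "(X, Y, Z, u, v, w) \<in> Tri C" and T: "T \<in> Ob C" and f: "f \<in> mor C T Y"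
    and vf: "v \<cdot> f = zmor C T Z"
  shows "\<exists>g \<in> mor C T X. u \<cdot> g = f"
proof -
  have X: "X \<in> Ob C" and Y: "Y \<in> Ob C" and Z: "Z \<in> Ob C" and u: "u \<in> mor C X Y" and v: "v \<in> mor C Y Z"
    using tri_typed[OF t] by auto
  obtain O' where O': "zero_object C O'" using exists_zero_object by blast
  have O'b: "O' \<in> Ob C" using O' by (simp add: zero_object_def)
  have "zmor C O' Z \<cdot> zmor C T O' = v \<cdot> f"
    using vf comp_zero_left[OF T O'b Z zmor_closed[OF T O'b]] by simp
  from TR3[OF triangle_rotate[OF TR1_id[OF T O']] triangle_rotate[OF t] f zmor_closed[OF O'b Z] this]
  obtain c where c: "c \<in> mor C (Susp C T) (Susp C X)"
    and eq: "SuspM C f \<cdot> (\<ominus>\<^bsub>Hom C (Susp C T) (Susp C T)\<^esub> SuspM C (Idn C T)) =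
      (\<ominus>\<^bsub>Hom C (Susp C X) (Susp C Y)\<^esub> SuspM C u) \<cdot> c" by blast
  obtain g where g: "g \<in> mor C T X" "SuspM C g = c" using susp_full[OF T X c] by blast
  note ST = susp_ob[OF T] and SX = susp_ob[OF X] and SY = susp_ob[OF Y]
  note Sf = susp_mor[OF T Y f] and Su = susp_mor[OF X Y u]
  have ug: "u \<cdot> g \<in> mor C T Y" using T X Y g(1) u by blast
  have "\<ominus>\<^bsub>Hom C (Susp C T) (Susp C Y)\<^esub> SuspM C f = \<ominus>\<^bsub>Hom C (Susp C T) (Susp C Y)\<^esub> (SuspM C u \<cdot> c)"
    using eq comp_uminus_right[OF ST ST SY Sf id_mor[OF ST]] comp_uminus_left[OF ST SX SY c Su]
      id_right[OF ST SY Sf] susp_id[OF T] by simp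
  then have "SuspM C f = SuspM C u \<cdot> c"
    by (rule uminus_inj[OF ST SY Sf comp_closed[OF ST SX SY c Su]])
  also have "\<dots> = SuspM C (u \<cdot> g)" using susp_comp[OF T X Y g(1) u] g(2) by simp
  finally have "f = u \<cdot> g" by (rule susp_inj[OF T Y f ug])
  then show ?thesis using g(1) by blast
qed

text \<open>The kernel of \<open>C(T, u)\<close> depends only on \<open>w\<close>, and is thus the same for all triangles on \<open>X\<close> and \<open>Z\<close>
  with third map \<open>w\<close>.\<close>

lemma triangle_kernel:
  assumes t: "(X, Y, Z, u, v, w) \<in> Tri C" and T: "T \<in> Ob C" and f: "f \<in> mor C T X"
  shows "u \<cdot> f = zmor C T Y \<longleftrightarrow> (\<exists>h \<in> mor C (Susp C T) Z. w \<cdot> h = SuspM C f)"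
proof -
  have X: "X \<in> Ob C" and Y: "Y \<in> Ob C" and Z: "Z \<in> Ob C" and u: "u \<in> mor C X Y" and w: "w \<in> mor C Z (Susp C X)"
    using tri_typed[OF t] by auto
  note ST = susp_ob[OF T] and SX = susp_ob[OF X] and SY = susp_ob[OF Y]
  note Sf = susp_mor[OF T X f] and Su = susp_mor[OF X Y u]
  let ?Su = "\<ominus>\<^bsub>Hom C (Susp C X) (Susp C Y)\<^esub> SuspM C u"
  have t2: "(Z, Susp C X, Susp C Y, w, ?Su, \<ominus>\<^bsub>Hom C (Susp C Y) (Susp C Z)\<^esub> SuspM C v) \<in> Tri C"
    by (rule triangle_rotate[OF triangle_rotate[OF t]])
  have Su': "?Su \<in> mor C (Susp C X) (Susp C Y)" by (rule uminus_closed[OF SX SY Su])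
  have uf: "u \<cdot> f \<in> mor C T Y" using T X Y f u by blast
  interpret abelian_group "Hom C (Susp C T) (Susp C Y)" by (rule Hom_abelian_group[OF ST SY])
  have Suf: "?Su \<cdot> SuspM C f = \<ominus>\<^bsub>Hom C (Susp C T) (Susp C Y)\<^esub> SuspM C (u \<cdot> f)"
    using comp_uminus_left[OF ST SX SY Sf Su] susp_comp[OF T X Y f u] by simp
  show ?thesis
  proof
    assume "u \<cdot> f = zmor C T Y"
    then have "?Su \<cdot> SuspM C f = zmor C (Susp C T) (Susp C Y)" using Suf susp_zero[OF T Y] by simp
    from triangle_exact[OF t2 ST Sf this] show "\<exists>h \<in> mor C (Susp C T) Z. w \<cdot> h = SuspM C f" .
  next
    assume "\<exists>h \<in> mor C (Susp C T) Z. w \<cdot> h = SuspM C f"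
    then obtain h where h: "h \<in> mor C (Susp C T) Z" "w \<cdot> h = SuspM C f" by blast
    have "?Su \<cdot> SuspM C f = zmor C (Susp C T) (Susp C Y)"
      unfolding h(2)[symmetric] comp_assoc[OF ST Z SX SY h(1) w Su', symmetric] triangle_comp_zero[OF t2]
      by (rule comp_zero_left[OF ST Z SY h(1)])
    moreover have "\<ominus>\<^bsub>Hom C (Susp C T) (Susp C Y)\<^esub> zmor C (Susp C T) (Susp C Y) = zmor C (Susp C T) (Susp C Y)"
      by (rule minus_equality) simp_all
    ultimately have "\<ominus>\<^bsub>Hom C (Susp C T) (Susp C Y)\<^esub> SuspM C (u \<cdot> f) =
        \<ominus>\<^bsub>Hom C (Susp C T) (Susp C Y)\<^esub> SuspM C (zmor C T Y)"
      unfolding susp_zero[OF T Y] Suf by (simp only:)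
    then have "SuspM C (u \<cdot> f) = SuspM C (zmor C T Y)"
      by (rule uminus_inj[OF ST SY susp_mor[OF T Y uf] susp_mor[OF T Y zmor_closed[OF T Y]]])
    then show "u \<cdot> f = zmor C T Y" by (rule susp_inj[OF T Y uf zmor_closed[OF T Y]])
  qed
qed

text \<open>The axiom on morphisms of triangles completes a square at the third vertex. Two rotations bring \<open>\<Sigma>Y\<close>
  and \<open>\<Sigma>Y'\<close> there, and full faithfulness of \<open>\<Sigma>\<close> removes the suspension again.\<close>

lemma triangle_comparison:
  assumes t: "(X, Y, Z, u, v, w) \<in> Tri C" and t': "(X, Y', Z, u', v', w) \<in> Tri C"
  shows "\<exists>b \<in> mor C Y Y'. b \<cdot> u = u' \<and> v' \<cdot> b = v"
proof -
  have X: "X \<in> Ob C" and Y: "Y \<in> Ob C" and Z: "Z \<in> Ob C" and u: "u \<in> mor C X Y" and v: "v \<in> mor C Y Z"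
    and w: "w \<in> mor C Z (Susp C X)"
    using tri_typed[OF t] by auto
  have Y': "Y' \<in> Ob C" and u': "u' \<in> mor C X Y'" and v': "v' \<in> mor C Y' Z" using tri_typed[OF t'] by auto
  note SX = susp_ob[OF X] and SY = susp_ob[OF Y] and SY' = susp_ob[OF Y'] and SZ = susp_ob[OF Z]
  have "Idn C (Susp C X) \<cdot> w = w \<cdot> Idn C Z" using id_left[OF Z SX w] id_right[OF Z SX w] by simp
  from TR3[OF triangle_rotate[OF triangle_rotate[OF t]] triangle_rotate[OF triangle_rotate[OF t']]
      id_mor[OF Z] id_mor[OF SX] this]
  obtain c where c: "c \<in> mor C (Susp C Y) (Susp C Y')"
    and 1: "c \<cdot> (\<ominus>\<^bsub>Hom C (Susp C X) (Susp C Y)\<^esub> SuspM C u) =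
      (\<ominus>\<^bsub>Hom C (Susp C X) (Susp C Y')\<^esub> SuspM C u') \<cdot> Idn C (Susp C X)"
    and 2: "SuspM C (Idn C Z) \<cdot> (\<ominus>\<^bsub>Hom C (Susp C Y) (Susp C Z)\<^esub> SuspM C v) =
      (\<ominus>\<^bsub>Hom C (Susp C Y') (Susp C Z)\<^esub> SuspM C v') \<cdot> c" by blast
  obtain b where b: "b \<in> mor C Y Y'" "SuspM C b = c" using susp_full[OF Y Y' c] by blast
  note Su = susp_mor[OF X Y u] and Su' = susp_mor[OF X Y' u'] and Sv = susp_mor[OF Y Z v] and Sv' = susp_mor[OF Y' Z v']
  have bu: "b \<cdot> u \<in> mor C X Y'" and v'b: "v' \<cdot> b \<in> mor C Y Z" using X Y Y' Z u v' b(1) by blast+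
  have "\<ominus>\<^bsub>Hom C (Susp C X) (Susp C Y')\<^esub> SuspM C (b \<cdot> u) = \<ominus>\<^bsub>Hom C (Susp C X) (Susp C Y')\<^esub> SuspM C u'"
    using 1 comp_uminus_right[OF SX SY SY' c Su] id_right[OF SX SY' uminus_closed[OF SX SY' Su']]
      susp_comp[OF X Y Y' u b(1)] b(2) by simp
  then have "SuspM C (b \<cdot> u) = SuspM C u'" by (rule uminus_inj[OF SX SY' susp_mor[OF X Y' bu] Su'])
  then have e1: "b \<cdot> u = u'" by (rule susp_inj[OF X Y' bu u'])
  have "\<ominus>\<^bsub>Hom C (Susp C Y) (Susp C Z)\<^esub> SuspM C (v' \<cdot> b) = \<ominus>\<^bsub>Hom C (Susp C Y) (Susp C Z)\<^esub> SuspM C v"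
    using 2 comp_uminus_left[OF SY SY' SZ c Sv'] id_left[OF SY SZ uminus_closed[OF SY SZ Sv]]
      susp_comp[OF Y Y' Z b(1) v'] b(2) susp_id[OF Z] by simp
  then have "SuspM C (v' \<cdot> b) = SuspM C v" by (rule uminus_inj[OF SY SZ susp_mor[OF Y Z v'b] Sv])
  then have "v' \<cdot> b = v" by (rule susp_inj[OF Y Z v'b v])
  then show ?thesis using b(1) e1 by blast
qed

text \<open>The five lemma for \<open>C(T, X) \<rightarrow> C(T, Y) \<rightarrow> C(T, Z)\<close> with its continuation on both sides, in the
  special case that the outer maps are identities.\<close>

lemma triangle_comparison_bij:
  assumes t: "(X, Y, Z, u, v, w) \<in> Tri C" and t': "(X, Y', Z, u', v', w) \<in> Tri C"
    and b: "b \<in> mor C Y Y'" "b \<cdot> u = u'" "v' \<cdot> b = v" and T: "T \<in> Ob C"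
  shows "bij_betw (\<lambda>f. b \<cdot> f) (mor C T Y) (mor C T Y')"
proof -
  have X: "X \<in> Ob C" and Y: "Y \<in> Ob C" and Z: "Z \<in> Ob C" and u: "u \<in> mor C X Y" and v: "v \<in> mor C Y Z"
    and w: "w \<in> mor C Z (Susp C X)"
    using tri_typed[OF t] by auto
  have Y': "Y' \<in> Ob C" and u': "u' \<in> mor C X Y'" and v': "v' \<in> mor C Y' Z" using tri_typed[OF t'] by auto
  interpret TY: abelian_group "Hom C T Y" by (rule Hom_abelian_group[OF T Y])
  interpret TY': abelian_group "Hom C T Y'" by (rule Hom_abelian_group[OF T Y'])
  have zero: "f = zmor C T Y" if f: "f \<in> mor C T Y" and bf: "b \<cdot> f = zmor C T Y'" for f
  proof -
    have "v \<cdot> f = zmor C T Z"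
      unfolding b(3)[symmetric] comp_assoc[OF T Y Y' Z f b(1) v'] bf by (rule comp_zero_right[OF T Y' Z v'])
    then obtain g where g: "g \<in> mor C T X" "u \<cdot> g = f" using triangle_exact[OF t T f] by blast
    have "u' \<cdot> g = zmor C T Y'"
      unfolding b(2)[symmetric] comp_assoc[OF T X Y Y' g(1) u b(1)] g(2) by (rule bf)
    then have "u \<cdot> g = zmor C T Y" using triangle_kernel[OF t' T g(1)] triangle_kernel[OF t T g(1)] by blast
    then show ?thesis using g(2) by simp
  qed
  show ?thesis
  proof (rule bij_betw_imageI)
    show "inj_on (\<lambda>f. b \<cdot> f) (mor C T Y)"
    proof (rule inj_onI)
      fix f f' assume f: "f \<in> mor C T Y" "f' \<in> mor C T Y" and eq: "b \<cdot> f = b \<cdot> f'"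
      have "b \<cdot> (f \<ominus>\<^bsub>Hom C T Y\<^esub> f') = zmor C T Y'"
        unfolding comp_minus_right[OF T Y Y' b(1) f]
        using minus_eq_zero_iff[OF T Y'] comp_closed[OF T Y Y' f(1) b(1)] comp_closed[OF T Y Y' f(2) b(1)] eq by blast
      from zero[OF minus_closed[OF T Y f] this] show "f = f'" using minus_eq_zero_iff[OF T Y f] by blast
    qed
    show "(\<lambda>f. b \<cdot> f) ` mor C T Y = mor C T Y'"
    proof
      show "(\<lambda>f. b \<cdot> f) ` mor C T Y \<subseteq> mor C T Y'" using T Y Y' b(1) by blast
      show "mor C T Y' \<subseteq> (\<lambda>f. b \<cdot> f) ` mor C T Y"
      proof
        fix y assume y: "y \<in> mor C T Y'"
        have v'y: "v' \<cdot> y \<in> mor C T Z" using T Y' Z y v' by blast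
        have "w \<cdot> (v' \<cdot> y) = zmor C T (Susp C X)"
          unfolding comp_assoc[OF T Y' Z susp_ob[OF X] y v' w, symmetric] triangle_comp_zero[OF triangle_rotate[OF t']]
          by (rule comp_zero_left[OF T Y' susp_ob[OF X] y])
        then obtain f where f: "f \<in> mor C T Y" "v \<cdot> f = v' \<cdot> y"
          using triangle_exact[OF triangle_rotate[OF t] T v'y] by blast
        have bf: "b \<cdot> f \<in> mor C T Y'" using T Y Y' f(1) b(1) by blast
        have "v' \<cdot> (y \<ominus>\<^bsub>Hom C T Y'\<^esub> b \<cdot> f) = zmor C T Z"
          unfolding comp_minus_right[OF T Y' Z v' y bf] comp_assoc[OF T Y Y' Z f(1) b(1) v', symmetric] b(3) f(2)
          using minus_eq_zero_iff[OF T Z v'y v'y] by simp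
        then obtain g where g: "g \<in> mor C T X" "u' \<cdot> g = y \<ominus>\<^bsub>Hom C T Y'\<^esub> b \<cdot> f"
          using triangle_exact[OF t' T minus_closed[OF T Y' y bf]] by blast
        have ug: "u \<cdot> g \<in> mor C T Y" using T X Y g(1) u by blast
        have "b \<cdot> (f \<oplus>\<^bsub>Hom C T Y\<^esub> u \<cdot> g) = b \<cdot> f \<oplus>\<^bsub>Hom C T Y'\<^esub> (y \<ominus>\<^bsub>Hom C T Y'\<^esub> b \<cdot> f)"
          unfolding comp_add_right[OF T Y Y' b(1) f(1) ug] comp_assoc[OF T X Y Y' g(1) u b(1), symmetric] b(2) g(2) ..
        also have "\<dots> = y" using y bf by (simp add: a_minus_def TY'.a_lcomm TY'.r_neg)
        finally show "y \<in> (\<lambda>f. b \<cdot> f) ` mor C T Y" using add_closed[OF T Y f(1) ug] by force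
      qed
    qed
  qed
qed

lemma triangle_dim_le:
  assumes t: "(X, Y, Z, u, v, w) \<in> Tri C" and T: "T \<in> Ob C" and fin: "hom_finite C"
  shows "vdim (Hom C T Y) \<le> vdim (Hom C T X) + vdim (Hom C T Z)"
proof (rule dim_le_of_exact)
  have X: "X \<in> Ob C" and Y: "Y \<in> Ob C" and Z: "Z \<in> Ob C" and u: "u \<in> mor C X Y" and v: "v \<in> mor C Y Z"
    using tri_typed[OF t] by auto
  show "vectorspace class_ring (Hom C T X)" "vectorspace class_ring (Hom C T Y)" "vectorspace class_ring (Hom C T Z)"
    using hom_vectorspace T X Y Z by blast+
  show "vectorspace.fin_dim class_ring (Hom C T X)" "vectorspace.fin_dim class_ring (Hom C T Y)"
    "vectorspace.fin_dim class_ring (Hom C T Z)"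
    using fin T X Y Z by (simp_all add: hom_finite_def)
  show "(\<lambda>f. u \<cdot> f) \<in> module_hom class_ring (Hom C T X) (Hom C T Y)" by (rule comp_left_linear[OF T X Y u])
  show "(\<lambda>f. v \<cdot> f) \<in> module_hom class_ring (Hom C T Y) (Hom C T Z)" by (rule comp_left_linear[OF T Y Z v])
  show "(\<lambda>f. u \<cdot> f) ` mor C T X = {f \<in> mor C T Y. v \<cdot> f = zmor C T Z}"
  proof
    show "(\<lambda>f. u \<cdot> f) ` mor C T X \<subseteq> {f \<in> mor C T Y. v \<cdot> f = zmor C T Z}"
    proof (rule image_subsetI, rule CollectI, rule conjI)
      fix f assume f: "f \<in> mor C T X"
      show "u \<cdot> f \<in> mor C T Y" using T X Y f u by blast
      show "v \<cdot> (u \<cdot> f) = zmor C T Z"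
        unfolding comp_assoc[OF T X Y Z f u v, symmetric] triangle_comp_zero[OF t] by (rule comp_zero_left[OF T X Z f])
    qed
    show "{f \<in> mor C T Y. v \<cdot> f = zmor C T Z} \<subseteq> (\<lambda>f. u \<cdot> f) ` mor C T X"
      using triangle_exact[OF t T] by blast
  qed
qed

end

section \<open>The representation of a triangle\<close>

lemma (in linear_category) vectorspace_End_algebra:
  assumes "T \<in> Ob C"
  shows "vectorspace class_ring (End_algebra C T)"
proof -
  interpret V: vectorspace class_ring "Hom C T T" by (rule hom_vectorspace[OF assms assms])
  have 1: "abelian_group (End_algebra C T)"
    using V.M.abelian_group_axioms
    by (simp add: End_algebra_def abelian_group_def abelian_monoid_def abelian_group_axioms_def)
  then show ?thesis
    using hom_vectorspace[OF assms assms]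
    by (simp add: vectorspace_def Module.module_def module_axioms_def End_algebra_def)
qed

lemma comb_End_algebra: "comb (End_algebra C T) n c v = comb (Hom C T T) n c v"
proof -
  have "add_monoid (End_algebra C T) = add_monoid (Hom C T T)" by (simp add: End_algebra_def)
  then show ?thesis by (simp add: comb_def finsum_def End_algebra_def)
qed

lemma A4_simps [simp]:
  "verts A4_quiver = {1, 2, 3, 4}" "arcs A4_quiver = {1, 2, 3}" "tail A4_quiver a = a" "head A4_quiver a = a + 1"
  by (simp_all add: A4_quiver_def)

lemma hom_representation_simps [simp]:
  "space_at (hom_representation C T M Y L N i p e) v =
    Hom C T (if v = 1 then M else if v = 2 then Y else if v = 3 then L else N)"
  "act_at (hom_representation C T M Y L N i p e) v x b = x \<cdot>\<^bsub>C\<^esub> b"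
  "map_at (hom_representation C T M Y L N i p e) a x = (if a = 1 then i else if a = 2 then p else e) \<cdot>\<^bsub>C\<^esub> x"
  by (simp_all add: hom_representation_def)

lemma (in linear_category) right_module_representation_hom:
  assumes T: "T \<in> Ob C" and M: "M \<in> Ob C" and Y: "Y \<in> Ob C" and L: "L \<in> Ob C" and N: "N \<in> Ob C"
    and i: "i \<in> mor C M Y" and p: "p \<in> mor C Y L" and e: "e \<in> mor C L N"
  shows "right_module_representation (End_algebra C T) A4_quiver (hom_representation C T M Y L N i p e)"
proof -
  let ?X = "\<lambda>v::nat. if v = 1 then M else if v = 2 then Y else if v = 3 then L else N"
  let ?f = "\<lambda>a::nat. if a = 1 then i else if a = 2 then p else e"
  have X: "?X v \<in> Ob C" for v using M Y L N by simp
  have f: "?f a \<in> mor C (?X a) (?X (a + 1))" if "a \<in> {1, 2, 3}" for a using that i p e by auto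
  have lin: "(\<lambda>b. x \<cdot> b) \<in> module_hom class_ring (End_algebra C T) (Hom C T (?X v))" if "x \<in> mor C T (?X v)" for x v
    using comp_left_linear[OF T T X that] by (simp add: LinearCombinations.module_hom_def End_algebra_def)
  show ?thesis
  proof (rule right_module_representation.intro)
    fix v :: nat assume "v \<in> verts A4_quiver"
    show "vectorspace class_ring (space_at (hom_representation C T M Y L N i p e) v)"
      using hom_vectorspace[OF T X] by simp
  next
    fix v :: nat and b assume "v \<in> verts A4_quiver" "b \<in> carrier (End_algebra C T)"
    then have "b \<in> mor C T T" by (simp add: End_algebra_def)
    from comp_right_linear[OF T T X this]
    show "(\<lambda>x. act_at (hom_representation C T M Y L N i p e) v x b) \<in> module_hom class_ring
        (space_at (hom_representation C T M Y L N i p e) v) (space_at (hom_representation C T M Y L N i p e) v)"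
      by simp
  next
    fix v :: nat and x assume "x \<in> carrier (space_at (hom_representation C T M Y L N i p e) v)"
    then have "x \<in> mor C T (?X v)" by simp
    from lin[OF this] show "act_at (hom_representation C T M Y L N i p e) v x \<in> module_hom class_ring (End_algebra C T)
        (space_at (hom_representation C T M Y L N i p e) v)"
      by (simp add: hom_representation_def)
  next
    fix v :: nat and x b b' assume "x \<in> carrier (space_at (hom_representation C T M Y L N i p e) v)"
      "b \<in> carrier (End_algebra C T)" "b' \<in> carrier (End_algebra C T)"
    then have x: "x \<in> mor C T (?X v)" and b: "b \<in> mor C T T" "b' \<in> mor C T T" by (simp_all add: End_algebra_def)
    show "act_at (hom_representation C T M Y L N i p e) v x (b \<otimes>\<^bsub>End_algebra C T\<^esub> b') =
        act_at (hom_representation C T M Y L N i p e) v (act_at (hom_representation C T M Y L N i p e) v x b) b'"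
      using comp_assoc[OF T T T X b(2,1) x] by (simp add: End_algebra_def)
  next
    fix v :: nat and x assume "x \<in> carrier (space_at (hom_representation C T M Y L N i p e) v)"
    then have "x \<in> mor C T (?X v)" by simp
    from id_right[OF T X this]
    show "act_at (hom_representation C T M Y L N i p e) v x \<one>\<^bsub>End_algebra C T\<^esub> = x"
      by (simp add: End_algebra_def)
  next
    fix a :: nat assume a: "a \<in> arcs A4_quiver"
    then have "?f a \<in> mor C (?X a) (?X (a + 1))" by (intro f) simp
    note fa = comp_left_linear[OF T X X this]
    consider "a = 1" | "a = 2" | "a = 3" using a by auto
    then show "map_at (hom_representation C T M Y L N i p e) a \<in> module_hom class_ring
        (space_at (hom_representation C T M Y L N i p e) (tail A4_quiver a))
        (space_at (hom_representation C T M Y L N i p e) (head A4_quiver a))"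
      by cases (use fa in \<open>simp_all add: hom_representation_def\<close>)
  next
    fix a :: nat and x b assume a: "a \<in> arcs A4_quiver"
      and "x \<in> carrier (space_at (hom_representation C T M Y L N i p e) (tail A4_quiver a))"
      and b: "b \<in> carrier (End_algebra C T)"
    then have x: "x \<in> mor C T (?X a)" and b: "b \<in> mor C T T" by (simp_all add: End_algebra_def)
    have fa: "?f a \<in> mor C (?X a) (?X (a + 1))" using a by (intro f) simp
    show "map_at (hom_representation C T M Y L N i p e) a
          (act_at (hom_representation C T M Y L N i p e) (tail A4_quiver a) x b) =
        act_at (hom_representation C T M Y L N i p e) (head A4_quiver a)
          (map_at (hom_representation C T M Y L N i p e) a x) b"
      using comp_assoc[OF T T X X b x fa] by simp
  next
    show "vectorspace class_ring (End_algebra C T)" by (rule vectorspace_End_algebra[OF T])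
    show "\<one>\<^bsub>End_algebra C T\<^esub> \<in> carrier (End_algebra C T)" using id_mor[OF T] by (simp add: End_algebra_def)
    show "b \<otimes>\<^bsub>End_algebra C T\<^esub> b' \<in> carrier (End_algebra C T)"
      if "b \<in> carrier (End_algebra C T)" "b' \<in> carrier (End_algebra C T)" for b b'
      using comp_closed[OF T T T, of b' b] that by (simp add: End_algebra_def)
  qed auto
qed

section \<open>The middle terms of the triangles\<close>

text \<open>A family of pullbacks of \<open>J M \<rightarrow> \<Sigma>M\<close> along a piecewise rational family of morphisms \<open>\<sigma> x : L \<rightarrow> \<Sigma>M\<close>.\<close>

locale pullback_family = stable_triangulated E S C
  for E :: "('o, 'e) exact_category" (structure) and S :: "('o, 'e) susp_choice"
    and C :: "('o, ('o, 'e) stable_mor) tri_category" +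
  fixes G :: "('p \<Rightarrow> complex) set" and N :: "'p set" and M L :: 'o and \<sigma> :: "'p \<Rightarrow> 'e"
    and Y :: "'p \<Rightarrow> 'o" and p s :: "'p \<Rightarrow> 'e"
  assumes M: "M \<in> Ob E" and L: "L \<in> Ob E"
    and \<sigma>: "\<sigma> \<in> rational_families G N (Hom E L (susp_ob S M))"
    and Y: "x \<in> N \<Longrightarrow> Y x \<in> Ob E"
    and p: "x \<in> N \<Longrightarrow> p x \<in> mor E (Y x) L"
    and s: "x \<in> N \<Longrightarrow> s x \<in> mor E (Y x) (inj_ob S M)"
    and square: "x \<in> N \<Longrightarrow> susp_map S M \<cdot> s x = \<sigma> x \<cdot> p x"
    and cartesian: "\<lbrakk>x \<in> N; W \<in> Ob E; a \<in> mor E W L; j \<in> mor E W (inj_ob S M);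
      susp_map S M \<cdot> j = \<sigma> x \<cdot> a\<rbrakk>
      \<Longrightarrow> \<exists>!h. h \<in> mor E W (Y x) \<and> p x \<cdot> h = a \<and> s x \<cdot> h = j"
    and E_finite: "hom_finite E"
begin

abbreviation J where "J \<equiv> inj_ob S M"
abbreviation SM where "SM \<equiv> susp_ob S M"
abbreviation \<pi> where "\<pi> \<equiv> susp_map S M"

lemmas J = E.susp_typed(1)[OF M] and SM = E.susp_typed(2)[OF M] and \<pi> = E.susp_typed(4)[OF M]

lemma \<sigma>_mor: "x \<in> N \<Longrightarrow> \<sigma> x \<in> mor E L SM"
  by (rule complex_vectorspace.rational_families_closed[OF E.Hom_vs[OF L SM] \<sigma>])

lemma mor_to_pullback_unique:
  assumes x: "x \<in> N" and W: "W \<in> Ob E" and h: "h \<in> mor E W (Y x)" "h' \<in> mor E W (Y x)"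
    and eq: "p x \<cdot> h = p x \<cdot> h'" "s x \<cdot> h = s x \<cdot> h'"
  shows "h = h'"
proof -
  have ph: "p x \<cdot> h \<in> mor E W L" by (rule E.comp_closed[OF W Y[OF x] L h(1) p[OF x]])
  have sh: "s x \<cdot> h \<in> mor E W J" by (rule E.comp_closed[OF W Y[OF x] J h(1) s[OF x]])
  have "\<pi> \<cdot> (s x \<cdot> h) = \<sigma> x \<cdot> (p x \<cdot> h)"
    unfolding E.comp_assoc[OF W Y[OF x] J SM h(1) s[OF x] \<pi>, symmetric] square[OF x]
    by (rule E.comp_assoc[OF W Y[OF x] L SM h(1) p[OF x] \<sigma>_mor[OF x]])
  from cartesian[OF x W ph sh this] show ?thesis
    by (rule ex1E) (metis h eq)
qed

text \<open>The objects \<open>Y x\<close> vary with \<open>x\<close>, and so the spaces \<open>E(T, Y x)\<close> have no common coordinates. A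
  morphism into \<open>Y x\<close> is however determined by its components in the fixed spaces \<open>E(T, L)\<close> and
  \<open>E(T, J M)\<close>, and a family of such morphisms counts as piecewise rational if both components are.\<close>

definition lifted_sections :: "'o \<Rightarrow> ('p \<Rightarrow> ('o, 'e) stable_mor) set" where
  "lifted_sections T = {y. \<exists>z. (\<forall>x \<in> N. z x \<in> mor E T (Y x) \<and> y x = stable_class E T (Y x) (z x)) \<and>
    (\<lambda>x. p x \<cdot> z x) \<in> rational_families G N (Hom E T L) \<and>
    (\<lambda>x. s x \<cdot> z x) \<in> rational_families G N (Hom E T J)}"

lemma lifted_sectionsI:
  assumes "\<And>x. x \<in> N \<Longrightarrow> z x \<in> mor E T (Y x)" "\<And>x. x \<in> N \<Longrightarrow> y x = stable_class E T (Y x) (z x)"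
    "(\<lambda>x. p x \<cdot> z x) \<in> rational_families G N (Hom E T L)"
    "(\<lambda>x. s x \<cdot> z x) \<in> rational_families G N (Hom E T J)"
  shows "y \<in> lifted_sections T"
  unfolding lifted_sections_def
  by (rule CollectI, rule exI[of _ z]) (use assms in simp)

lemma lifted_sectionsE:
  assumes "y \<in> lifted_sections T"
  obtains z where "\<And>x. x \<in> N \<Longrightarrow> z x \<in> mor E T (Y x)" "\<And>x. x \<in> N \<Longrightarrow> y x = stable_class E T (Y x) (z x)"
    "(\<lambda>x. p x \<cdot> z x) \<in> rational_families G N (Hom E T L)"
    "(\<lambda>x. s x \<cdot> z x) \<in> rational_families G N (Hom E T J)"
proof -
  obtain z where "\<forall>x \<in> N. z x \<in> mor E T (Y x) \<and> y x = stable_class E T (Y x) (z x)"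
    "(\<lambda>x. p x \<cdot> z x) \<in> rational_families G N (Hom E T L)"
    "(\<lambda>x. s x \<cdot> z x) \<in> rational_families G N (Hom E T J)"
    using assms unfolding lifted_sections_def by (elim CollectE exE conjE)
  then show thesis by (intro that[of z]) simp_all
qed

lemma comp_comb_left:
  assumes "X \<in> Ob E" "X' \<in> Ob E" "X'' \<in> Ob E" "g \<in> mor E X' X''" "\<forall>k<n. f k \<in> mor E X X'"
  shows "g \<cdot> comb (Hom E X X') n c f = comb (Hom E X X'') n c (\<lambda>k. g \<cdot> f k)"
  by (rule comb_map[OF E.hom_vectorspace[OF assms(1,2)] E.hom_vectorspace[OF assms(1,3)]
        E.comp_left_linear[OF assms(1-4)]]) (simp add: assms(5))

lemma comp_comb_right:
  assumes "X \<in> Ob E" "X' \<in> Ob E" "X'' \<in> Ob E" "f \<in> mor E X X'" "\<forall>k<n. g k \<in> mor E X' X''"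
  shows "comb (Hom E X' X'') n c g \<cdot> f = comb (Hom E X X'') n c (\<lambda>k. g k \<cdot> f)"
  by (rule comb_map[OF E.hom_vectorspace[OF assms(2,3)] E.hom_vectorspace[OF assms(1,3)]
        E.comp_right_linear[OF assms(1-4)]]) (simp add: assms(5))

lemma fin_dim: "\<lbrakk>X \<in> Ob E; X' \<in> Ob E\<rbrakk> \<Longrightarrow> vectorspace.fin_dim class_ring (Hom E X X')"
  using E_finite by (simp add: hom_finite_def)

text \<open>In terms of the coefficients with respect to pairs spanning \<open>E(W, L) \<times> E(W, J M)\<close>, being the pair
  of components of a morphism \<open>W \<rightarrow> Y x\<close> is a linear condition.\<close>

lemma pair_generators:
  assumes W: "W \<in> Ob E"
  obtains n a j where "\<And>k. k < n \<Longrightarrow> a k \<in> mor E W L" "\<And>k. k < n \<Longrightarrow> j k \<in> mor E W J"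
    "\<And>f g. \<lbrakk>f \<in> mor E W L; g \<in> mor E W J\<rbrakk> \<Longrightarrow> \<exists>c. f = comb (Hom E W L) n c a \<and> g = comb (Hom E W J) n c j"
    "\<And>k. k < n \<Longrightarrow> (\<lambda>x. \<sigma> x \<cdot> a k \<ominus>\<^bsub>Hom E W SM\<^esub> \<pi> \<cdot> j k) \<in> rational_families G N (Hom E W SM)"
    "\<And>x c. x \<in> N \<Longrightarrow> comb (Hom E W SM) n c (\<lambda>k. \<sigma> x \<cdot> a k \<ominus>\<^bsub>Hom E W SM\<^esub> \<pi> \<cdot> j k) = zmor E W SM \<longleftrightarrow>
      \<pi> \<cdot> comb (Hom E W J) n c j = \<sigma> x \<cdot> comb (Hom E W L) n c a"
proof -
  interpret WL: complex_vectorspace "Hom E W L" by (rule E.Hom_vs[OF W L])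
  interpret WJ: complex_vectorspace "Hom E W J" by (rule E.Hom_vs[OF W J])
  interpret WS: complex_vectorspace "Hom E W SM" by (rule E.Hom_vs[OF W SM])
  obtain n a j where aj: "\<forall>k<n. a k \<in> mor E W L \<and> j k \<in> mor E W J"
    and gen: "\<forall>f \<in> mor E W L. \<forall>g \<in> mor E W J. \<exists>c. f = comb (Hom E W L) n c a \<and> g = comb (Hom E W J) n c j"
    using exists_pair_spanning_family[OF E.hom_vectorspace[OF W L] fin_dim[OF W L] E.hom_vectorspace[OF W J] fin_dim[OF W J]]
    by (elim exE conjE)
  have a: "a k \<in> mor E W L" and j: "j k \<in> mor E W J" if "k < n" for k using aj that by auto
  have a': "\<forall>k<n. a k \<in> mor E W L" and j': "\<forall>k<n. j k \<in> mor E W J" using aj by auto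
  show thesis
  proof (rule that[of n a j])
    show "\<exists>c. f = comb (Hom E W L) n c a \<and> g = comb (Hom E W J) n c j" if "f \<in> mor E W L" "g \<in> mor E W J" for f g
      using bspec[OF bspec[OF gen that(1)] that(2)] .
    show "(\<lambda>x. \<sigma> x \<cdot> a k \<ominus>\<^bsub>Hom E W SM\<^esub> \<pi> \<cdot> j k) \<in> rational_families G N (Hom E W SM)" if "k < n" for k
      by (intro WS.rational_families_minus E.rational_families_comp[OF W L SM WL.rational_families_const[OF a[OF that]] \<sigma>]
          WS.rational_families_const E.comp_closed[OF W J SM j[OF that] \<pi>])
    fix x c assume x: "x \<in> N"
    have ma: "\<And>k. k < n \<Longrightarrow> \<sigma> x \<cdot> a k \<in> mor E W SM" and mj: "\<And>k. k < n \<Longrightarrow> \<pi> \<cdot> j k \<in> mor E W SM"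
      using E.comp_closed[OF W L SM a \<sigma>_mor[OF x]] E.comp_closed[OF W J SM j \<pi>] by blast+
    have "comb (Hom E W SM) n c (\<lambda>k. \<sigma> x \<cdot> a k \<ominus>\<^bsub>Hom E W SM\<^esub> \<pi> \<cdot> j k) =
        comb (Hom E W SM) n c (\<lambda>k. \<sigma> x \<cdot> a k) \<oplus>\<^bsub>Hom E W SM\<^esub> comb (Hom E W SM) n c (\<lambda>k. \<ominus>\<^bsub>Hom E W SM\<^esub> (\<pi> \<cdot> j k))"
      unfolding a_minus_def by (rule WS.comb_vectors_add) (use ma mj in auto)
    also have "comb (Hom E W SM) n c (\<lambda>k. \<ominus>\<^bsub>Hom E W SM\<^esub> (\<pi> \<cdot> j k)) =
        comb (Hom E W SM) n (\<lambda>k. - c k) (\<lambda>k. \<pi> \<cdot> j k)"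
    proof -
      have "comb (Hom E W SM) n c (\<lambda>k. \<ominus>\<^bsub>Hom E W SM\<^esub> (\<pi> \<cdot> j k)) =
          (\<ominus>\<^bsub>Hom E J SM\<^esub> \<pi>) \<cdot> comb (Hom E W J) n c j"
        unfolding comp_comb_left[OF W J SM E.uminus_closed[OF J SM \<pi>] j']
        by (rule WS.comb_cong) (use E.comp_uminus_left[OF W J SM j \<pi>] mj in auto)
      also have "\<dots> = \<ominus>\<^bsub>Hom E W SM\<^esub> (\<pi> \<cdot> comb (Hom E W J) n c j)"
        by (rule E.comp_uminus_left[OF W J SM WJ.comb_closed[OF j] \<pi>])
      also have "\<dots> = comb (Hom E W SM) n (\<lambda>k. - c k) (\<lambda>k. \<pi> \<cdot> j k)"
        unfolding comp_comb_left[OF W J SM \<pi> j'] by (rule WS.comb_uminus[symmetric]) (rule mj)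
      finally show ?thesis .
    qed
    also have "comb (Hom E W SM) n (\<lambda>k. - c k) (\<lambda>k. \<pi> \<cdot> j k) =
        \<ominus>\<^bsub>Hom E W SM\<^esub> (\<pi> \<cdot> comb (Hom E W J) n c j)"
      unfolding comp_comb_left[OF W J SM \<pi> j'] by (rule WS.comb_uminus) (rule mj)
    also have "comb (Hom E W SM) n c (\<lambda>k. \<sigma> x \<cdot> a k) = \<sigma> x \<cdot> comb (Hom E W L) n c a"
      by (rule comp_comb_left[OF W L SM \<sigma>_mor[OF x] a', symmetric])
    finally have *: "comb (Hom E W SM) n c (\<lambda>k. \<sigma> x \<cdot> a k \<ominus>\<^bsub>Hom E W SM\<^esub> \<pi> \<cdot> j k) =
        \<sigma> x \<cdot> comb (Hom E W L) n c a \<ominus>\<^bsub>Hom E W SM\<^esub> \<pi> \<cdot> comb (Hom E W J) n c j"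
      by (simp add: a_minus_def)
    show "comb (Hom E W SM) n c (\<lambda>k. \<sigma> x \<cdot> a k \<ominus>\<^bsub>Hom E W SM\<^esub> \<pi> \<cdot> j k) = zmor E W SM \<longleftrightarrow>
      \<pi> \<cdot> comb (Hom E W J) n c j = \<sigma> x \<cdot> comb (Hom E W L) n c a"
      unfolding * using E.minus_eq_zero_iff[OF W SM E.comp_closed[OF W L SM WL.comb_closed[OF a] \<sigma>_mor[OF x]]
          E.comp_closed[OF W J SM WJ.comb_closed[OF j] \<pi>]] by auto
  qed (use a j in auto)
qed

text \<open>The pairs of components of morphisms \<open>T \<rightarrow> Y x\<close> are the solutions of a homogeneous linear
  system; generators of its solution space give the spanning sections.\<close>

lemma lifted_sections_generated:
  assumes T: "T \<in> Ob E"
  shows "\<exists>n w. (\<forall>k<n. w k \<in> lifted_sections T) \<and> (\<forall>x \<in> N. spanning_family (Hom C T (Y x)) n (\<lambda>k. w k x))"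
proof -
  interpret TL: complex_vectorspace "Hom E T L" by (rule E.Hom_vs[OF T L])
  interpret TJ: complex_vectorspace "Hom E T J" by (rule E.Hom_vs[OF T J])
  interpret TS: complex_vectorspace "Hom E T SM" by (rule E.Hom_vs[OF T SM])
  obtain n a j where a: "\<And>k. k < n \<Longrightarrow> a k \<in> mor E T L" and j: "\<And>k. k < n \<Longrightarrow> j k \<in> mor E T J"
    and gen: "\<And>f g. \<lbrakk>f \<in> mor E T L; g \<in> mor E T J\<rbrakk> \<Longrightarrow> \<exists>c. f = comb (Hom E T L) n c a \<and> g = comb (Hom E T J) n c j"
    and rat: "\<And>k. k < n \<Longrightarrow> (\<lambda>x. \<sigma> x \<cdot> a k \<ominus>\<^bsub>Hom E T SM\<^esub> \<pi> \<cdot> j k) \<in> rational_families G N (Hom E T SM)"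
    and eq: "\<And>x c. x \<in> N \<Longrightarrow> comb (Hom E T SM) n c (\<lambda>k. \<sigma> x \<cdot> a k \<ominus>\<^bsub>Hom E T SM\<^esub> \<pi> \<cdot> j k) = zmor E T SM \<longleftrightarrow>
      \<pi> \<cdot> comb (Hom E T J) n c j = \<sigma> x \<cdot> comb (Hom E T L) n c a"
    using T by (rule pair_generators) (rule that)
  let ?Q = "\<lambda>x c. comb (Hom E T SM) n c (\<lambda>k. \<sigma> x \<cdot> a k \<ominus>\<^bsub>Hom E T SM\<^esub> \<pi> \<cdot> j k) = zmor E T SM"
  have lin: "linear_condition G N n ?Q"
    by (rule TS.linear_condition_comb_eq[OF fin_dim[OF T SM] rat TS.rational_families_const]) auto
  have "\<forall>x \<in> N. \<exists>c. ?Q x c"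
  proof
    fix x assume "x \<in> N"
    then show "\<exists>c. ?Q x c"
      by (intro exI[of _ "\<lambda>_. 0"] TS.comb_zero_coeffs TS.rational_families_closed[OF rat]) simp_all
  qed
  from linear_condition_generators[OF lin this] obtain b where
    b: "\<forall>m k. b m k \<in> piecewise_rational G" and
    bQ: "\<forall>x \<in> N. (\<forall>m. ?Q x (\<lambda>k. b m k x)) \<and> (\<forall>c. ?Q x c \<longrightarrow> (\<exists>r. \<forall>k<n. c k = (\<Sum>m<Suc n. r m * b m k x)))"
    by (elim exE conjE)
  let ?f = "\<lambda>m x. comb (Hom E T L) n (\<lambda>k. b m k x) a" and ?g = "\<lambda>m x. comb (Hom E T J) n (\<lambda>k. b m k x) j"
  have f: "?f m x \<in> mor E T L" and g: "?g m x \<in> mor E T J" for m x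
    by (rule TL.comb_closed[OF a] TJ.comb_closed[OF j]; assumption)+
  define z where "z m x = (THE h. h \<in> mor E T (Y x) \<and> p x \<cdot> h = ?f m x \<and> s x \<cdot> h = ?g m x)" for m x
  have z: "z m x \<in> mor E T (Y x) \<and> p x \<cdot> z m x = ?f m x \<and> s x \<cdot> z m x = ?g m x" if x: "x \<in> N" for m x
  proof -
    have "?Q x (\<lambda>k. b m k x)" using bspec[OF bQ x] by (elim conjE allE)
    then have "\<pi> \<cdot> ?g m x = \<sigma> x \<cdot> ?f m x" unfolding eq[OF x] .
    from cartesian[OF x T f g this] show ?thesis unfolding z_def by (rule theI')
  qed
  show ?thesis
  proof (rule exI[of _ "Suc n"], rule exI[of _ "\<lambda>m x. stable_class E T (Y x) (z m x)"], intro conjI allI impI ballI)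
    fix m
    show "(\<lambda>x. stable_class E T (Y x) (z m x)) \<in> lifted_sections T"
    proof (rule lifted_sectionsI[where z="z m"])
      show "(\<lambda>x. p x \<cdot> z m x) \<in> rational_families G N (Hom E T L)"
        by (rule rational_familiesI[of n "b m" _ a]) (use b a z in auto)
      show "(\<lambda>x. s x \<cdot> z m x) \<in> rational_families G N (Hom E T J)"
        by (rule rational_familiesI[of n "b m" _ j]) (use b j z in auto)
    qed (use z in auto)
  next
    fix x assume x: "x \<in> N"
    interpret TY: complex_vectorspace "Hom E T (Y x)" by (rule E.Hom_vs[OF T Y[OF x]])
    have zx: "z m x \<in> mor E T (Y x)" for m using z[OF x] by blast
    have zx': "\<forall>m<k. z m x \<in> mor E T (Y x)" for k using zx by blast
    show "spanning_family (Hom C T (Y x)) (Suc n) (\<lambda>m. stable_class E T (Y x) (z m x))"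
      unfolding spanning_family_def
    proof (intro conjI allI impI ballI)
      show "stable_class E T (Y x) (z m x) \<in> mor C T (Y x)" for m by (rule class_closed[OF zx])
      fix y assume "y \<in> mor C T (Y x)"
      then obtain h where h: "h \<in> mor E T (Y x)" "y = stable_class E T (Y x) h" by (auto simp: mor_C)
      have ph: "p x \<cdot> h \<in> mor E T L" by (rule E.comp_closed[OF T Y[OF x] L h(1) p[OF x]])
      have sh: "s x \<cdot> h \<in> mor E T J" by (rule E.comp_closed[OF T Y[OF x] J h(1) s[OF x]])
      obtain c where c: "p x \<cdot> h = comb (Hom E T L) n c a" "s x \<cdot> h = comb (Hom E T J) n c j"
        using gen[OF ph sh] by (elim exE conjE)
      have "\<pi> \<cdot> (s x \<cdot> h) = \<sigma> x \<cdot> (p x \<cdot> h)"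
        unfolding E.comp_assoc[OF T Y[OF x] J SM h(1) s[OF x] \<pi>, symmetric] square[OF x]
        by (rule E.comp_assoc[OF T Y[OF x] L SM h(1) p[OF x] \<sigma>_mor[OF x]])
      then have "?Q x c" unfolding eq[OF x] c .
      then obtain r where r: "\<forall>k<n. c k = (\<Sum>m<Suc n. r m * b m k x)"
        using bspec[OF bQ x] by (elim conjE) (drule spec[of _ c], drule mp, assumption, elim exE)
      have "h = comb (Hom E T (Y x)) (Suc n) r (\<lambda>m. z m x)"
      proof (rule mor_to_pullback_unique[OF x T h(1)])
        show "comb (Hom E T (Y x)) (Suc n) r (\<lambda>m. z m x) \<in> mor E T (Y x)" by (rule TY.comb_closed) (rule zx)
        have "p x \<cdot> comb (Hom E T (Y x)) (Suc n) r (\<lambda>m. z m x) = comb (Hom E T L) (Suc n) r (\<lambda>m. ?f m x)"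
          unfolding comp_comb_left[OF T Y[OF x] L p[OF x] zx'] using z[OF x] by simp
        also have "\<dots> = comb (Hom E T L) n (\<lambda>k. \<Sum>m<Suc n. r m * b m k x) a" by (rule TL.comb_comb) (rule a)
        also have "\<dots> = comb (Hom E T L) n c a" by (rule TL.comb_cong) (use r a in auto)
        finally show "p x \<cdot> h = p x \<cdot> comb (Hom E T (Y x)) (Suc n) r (\<lambda>m. z m x)" using c(1) by simp
        have "s x \<cdot> comb (Hom E T (Y x)) (Suc n) r (\<lambda>m. z m x) = comb (Hom E T J) (Suc n) r (\<lambda>m. ?g m x)"
          unfolding comp_comb_left[OF T Y[OF x] J s[OF x] zx'] using z[OF x] by simp
        also have "\<dots> = comb (Hom E T J) n (\<lambda>k. \<Sum>m<Suc n. r m * b m k x) j" by (rule TJ.comb_comb) (rule j)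
        also have "\<dots> = comb (Hom E T J) n c j" by (rule TJ.comb_cong) (use r j in auto)
        finally show "s x \<cdot> h = s x \<cdot> comb (Hom E T (Y x)) (Suc n) r (\<lambda>m. z m x)" using c(2) by simp
      qed
      then have "y = comb (Hom C T (Y x)) (Suc n) r (\<lambda>m. stable_class E T (Y x) (z m x))"
        unfolding h(2)
        using comb_map[OF E.hom_vectorspace[OF T Y[OF x]] C.hom_vectorspace[of T "Y x"] class_linear[OF T Y[OF x]], of "Suc n" "\<lambda>m. z m x" r]
          zx T Y[OF x] by simp
      then show "\<exists>c. y = comb (Hom C T (Y x)) (Suc n) c (\<lambda>m. stable_class E T (Y x) (z m x))"
        by (rule exI[of _ r])
    qed
  qed
qed

text \<open>An equation \<open>y = \<Sum>k. c k * w k\<close> in \<open>C(T, Y x)\<close> means that lifts of both sides to \<open>E(T, Y x)\<close> differ by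
  a morphism \<open>T \<rightarrow> J T \<rightarrow> Y x\<close>. With the coefficients of the components of \<open>J T \<rightarrow> Y x\<close> as \<open>m\<close>
  additional unknowns, it becomes a linear system: two equations for the components of \<open>T \<rightarrow> Y x\<close>, and
  one expressing that the additional unknowns describe a morphism into the pullback.\<close>

lemma lifted_sections_solvable:
  assumes T: "T \<in> Ob E" and w: "\<forall>k<n. w k \<in> lifted_sections T" and y: "y \<in> lifted_sections T"
  shows "\<exists>t c. t \<in> piecewise_rational G \<and> (\<forall>k. c k \<in> piecewise_rational G) \<and>
      (\<forall>x \<in> N. (t x = 0 \<longleftrightarrow> (\<exists>c'. y x = comb (Hom C T (Y x)) n c' (\<lambda>k. w k x))) \<and>
        (t x = 0 \<longrightarrow> y x = comb (Hom C T (Y x)) n (\<lambda>k. c k x) (\<lambda>k. w k x)))"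
proof -
  let ?JT = "inj_ob S T" and ?\<iota> = "inj_map S T"
  have JT: "?JT \<in> Ob E" and \<iota>: "?\<iota> \<in> mor E T ?JT" using E.susp_typed[OF T] by auto
  interpret TL: complex_vectorspace "Hom E T L" by (rule E.Hom_vs[OF T L])
  interpret TJ: complex_vectorspace "Hom E T J" by (rule E.Hom_vs[OF T J])
  interpret QS: complex_vectorspace "Hom E ?JT SM" by (rule E.Hom_vs[OF JT SM])
  interpret QL: complex_vectorspace "Hom E ?JT L" by (rule E.Hom_vs[OF JT L])
  interpret QJ: complex_vectorspace "Hom E ?JT J" by (rule E.Hom_vs[OF JT J])
  obtain zy where zy: "\<And>x. x \<in> N \<Longrightarrow> zy x \<in> mor E T (Y x)" and yz: "\<And>x. x \<in> N \<Longrightarrow> y x = stable_class E T (Y x) (zy x)"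
    and py: "(\<lambda>x. p x \<cdot> zy x) \<in> rational_families G N (Hom E T L)"
    and sy: "(\<lambda>x. s x \<cdot> zy x) \<in> rational_families G N (Hom E T J)"
    using y by (rule lifted_sectionsE) (rule that)
  let ?lift = "\<lambda>k z. (\<forall>x \<in> N. z x \<in> mor E T (Y x) \<and> w k x = stable_class E T (Y x) (z x)) \<and>
    (\<lambda>x. p x \<cdot> z x) \<in> rational_families G N (Hom E T L) \<and>
    (\<lambda>x. s x \<cdot> z x) \<in> rational_families G N (Hom E T J)"
  define z where "z k = (SOME z. ?lift k z)" for k
  have lift: "?lift k (z k)" if "k < n" for k
  proof -
    have "\<exists>z. ?lift k z" using w that unfolding lifted_sections_def by simp
    then show ?thesis unfolding z_def by (rule someI_ex)
  qed
  have z: "z k x \<in> mor E T (Y x)" and wz: "w k x = stable_class E T (Y x) (z k x)" if "k < n" "x \<in> N" for k x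
    using lift[OF that(1)] that(2) by auto
  have z': "\<forall>k<n. z k x \<in> mor E T (Y x)" if "x \<in> N" for x using z that by blast
  have pz: "(\<lambda>x. p x \<cdot> z k x) \<in> rational_families G N (Hom E T L)"
    and sz: "(\<lambda>x. s x \<cdot> z k x) \<in> rational_families G N (Hom E T J)" if "k < n" for k
    using lift[OF that] by auto
  obtain m a j where a: "\<And>k. k < m \<Longrightarrow> a k \<in> mor E ?JT L" and j: "\<And>k. k < m \<Longrightarrow> j k \<in> mor E ?JT J"
    and gen: "\<And>f g. \<lbrakk>f \<in> mor E ?JT L; g \<in> mor E ?JT J\<rbrakk> \<Longrightarrow> \<exists>c. f = comb (Hom E ?JT L) m c a \<and> g = comb (Hom E ?JT J) m c j"
    and rat: "\<And>k. k < m \<Longrightarrow> (\<lambda>x. \<sigma> x \<cdot> a k \<ominus>\<^bsub>Hom E ?JT SM\<^esub> \<pi> \<cdot> j k) \<in> rational_families G N (Hom E ?JT SM)"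
    and eq: "\<And>x c. x \<in> N \<Longrightarrow> comb (Hom E ?JT SM) m c (\<lambda>k. \<sigma> x \<cdot> a k \<ominus>\<^bsub>Hom E ?JT SM\<^esub> \<pi> \<cdot> j k) = zmor E ?JT SM \<longleftrightarrow>
      \<pi> \<cdot> comb (Hom E ?JT J) m c j = \<sigma> x \<cdot> comb (Hom E ?JT L) m c a"
    using JT by (rule pair_generators) (rule that)
  have a': "\<forall>k<m. a k \<in> mor E ?JT L" and j': "\<forall>k<m. j k \<in> mor E ?JT J" using a j by auto
  let ?A = "\<lambda>k x. if k < n then p x \<cdot> z k x else a (k - n) \<cdot> ?\<iota>"
  let ?B = "\<lambda>k x. if k < n then s x \<cdot> z k x else j (k - n) \<cdot> ?\<iota>"
  let ?D = "\<lambda>k x. if k < n then zmor E ?JT SM else \<sigma> x \<cdot> a (k - n) \<ominus>\<^bsub>Hom E ?JT SM\<^esub> \<pi> \<cdot> j (k - n)"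
  let ?Q = "\<lambda>x c. comb (Hom E T L) (n + m) c (\<lambda>k. ?A k x) = p x \<cdot> zy x \<and>
    comb (Hom E T J) (n + m) c (\<lambda>k. ?B k x) = s x \<cdot> zy x \<and>
    comb (Hom E ?JT SM) (n + m) c (\<lambda>k. ?D k x) = zmor E ?JT SM"
  have a\<iota>: "\<And>k. k < m \<Longrightarrow> a k \<cdot> ?\<iota> \<in> mor E T L" by (rule E.comp_closed[OF T JT L \<iota> a])
  have j\<iota>: "\<And>k. k < m \<Longrightarrow> j k \<cdot> ?\<iota> \<in> mor E T J" by (rule E.comp_closed[OF T JT J \<iota> j])
  have A: "(\<lambda>x. ?A k x) \<in> rational_families G N (Hom E T L)" if "k < n + m" for k
  proof (cases "k < n")
    case True
    then show ?thesis using pz by simp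
  next
    case False
    then have "k - n < m" using that by simp
    from False TL.rational_families_const[OF a\<iota>[OF this]] show ?thesis by simp
  qed
  have B: "(\<lambda>x. ?B k x) \<in> rational_families G N (Hom E T J)" if "k < n + m" for k
  proof (cases "k < n")
    case True
    then show ?thesis using sz by simp
  next
    case False
    then have "k - n < m" using that by simp
    from False TJ.rational_families_const[OF j\<iota>[OF this]] show ?thesis by simp
  qed
  have D: "(\<lambda>x. ?D k x) \<in> rational_families G N (Hom E ?JT SM)" if "k < n + m" for k
  proof (cases "k < n")
    case True
    then show ?thesis using QS.rational_families_const[of "zmor E ?JT SM"] by simp
  next
    case False
    then have "k - n < m" using that by simp
    from False rat[OF this] show ?thesis by simp
  qed
  have lin: "linear_condition G N (n + m) ?Q"
    by (intro linear_condition_conj TL.linear_condition_comb_eq[OF fin_dim[OF T L] A py]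
        TJ.linear_condition_comb_eq[OF fin_dim[OF T J] B sy]
        QS.linear_condition_comb_eq[OF fin_dim[OF JT SM] D QS.rational_families_const]) auto
  have splitA: "comb (Hom E T L) (n + m) c (\<lambda>k. ?A k x) = comb (Hom E T L) n c (\<lambda>k. p x \<cdot> z k x) \<oplus>\<^bsub>Hom E T L\<^esub>
      comb (Hom E ?JT L) m (\<lambda>k. c (n + k)) a \<cdot> ?\<iota>" if x: "x \<in> N" for c x
  proof -
    have "comb (Hom E T L) (n + m) c (\<lambda>k. ?A k x) = comb (Hom E T L) n c (\<lambda>k. ?A k x) \<oplus>\<^bsub>Hom E T L\<^esub>
        comb (Hom E T L) m (\<lambda>k. c (n + k)) (\<lambda>k. ?A (n + k) x)"
      by (rule TL.comb_append) (rule TL.rational_families_closed[OF A x])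
    also have "comb (Hom E T L) n c (\<lambda>k. ?A k x) = comb (Hom E T L) n c (\<lambda>k. p x \<cdot> z k x)"
      by (rule TL.comb_cong) (use TL.rational_families_closed[OF pz x] in auto)
    also have "comb (Hom E T L) m (\<lambda>k. c (n + k)) (\<lambda>k. ?A (n + k) x) = comb (Hom E T L) m (\<lambda>k. c (n + k)) (\<lambda>k. a k \<cdot> ?\<iota>)"
      by (rule TL.comb_cong) (use a\<iota> in auto)
    also have "\<dots> = comb (Hom E ?JT L) m (\<lambda>k. c (n + k)) a \<cdot> ?\<iota>"
      by (rule comp_comb_right[OF T JT L \<iota> a', symmetric])
    finally show ?thesis .
  qed
  have splitB: "comb (Hom E T J) (n + m) c (\<lambda>k. ?B k x) = comb (Hom E T J) n c (\<lambda>k. s x \<cdot> z k x) \<oplus>\<^bsub>Hom E T J\<^esub>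
      comb (Hom E ?JT J) m (\<lambda>k. c (n + k)) j \<cdot> ?\<iota>" if x: "x \<in> N" for c x
  proof -
    have "comb (Hom E T J) (n + m) c (\<lambda>k. ?B k x) = comb (Hom E T J) n c (\<lambda>k. ?B k x) \<oplus>\<^bsub>Hom E T J\<^esub>
        comb (Hom E T J) m (\<lambda>k. c (n + k)) (\<lambda>k. ?B (n + k) x)"
      by (rule TJ.comb_append) (rule TJ.rational_families_closed[OF B x])
    also have "comb (Hom E T J) n c (\<lambda>k. ?B k x) = comb (Hom E T J) n c (\<lambda>k. s x \<cdot> z k x)"
      by (rule TJ.comb_cong) (use TJ.rational_families_closed[OF sz x] in auto)
    also have "comb (Hom E T J) m (\<lambda>k. c (n + k)) (\<lambda>k. ?B (n + k) x) = comb (Hom E T J) m (\<lambda>k. c (n + k)) (\<lambda>k. j k \<cdot> ?\<iota>)"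
      by (rule TJ.comb_cong) (use j\<iota> in auto)
    also have "\<dots> = comb (Hom E ?JT J) m (\<lambda>k. c (n + k)) j \<cdot> ?\<iota>"
      by (rule comp_comb_right[OF T JT J \<iota> j', symmetric])
    finally show ?thesis .
  qed
  have splitD: "comb (Hom E ?JT SM) (n + m) c (\<lambda>k. ?D k x) =
      comb (Hom E ?JT SM) m (\<lambda>k. c (n + k)) (\<lambda>k. \<sigma> x \<cdot> a k \<ominus>\<^bsub>Hom E ?JT SM\<^esub> \<pi> \<cdot> j k)" if x: "x \<in> N" for c x
  proof -
    have cl: "comb (Hom E ?JT SM) m (\<lambda>k. c (n + k)) (\<lambda>k. \<sigma> x \<cdot> a k \<ominus>\<^bsub>Hom E ?JT SM\<^esub> \<pi> \<cdot> j k) \<in> mor E ?JT SM"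
      by (rule QS.comb_closed) (rule QS.rational_families_closed[OF rat x])
    have "comb (Hom E ?JT SM) (n + m) c (\<lambda>k. ?D k x) = comb (Hom E ?JT SM) n c (\<lambda>k. ?D k x) \<oplus>\<^bsub>Hom E ?JT SM\<^esub>
        comb (Hom E ?JT SM) m (\<lambda>k. c (n + k)) (\<lambda>k. ?D (n + k) x)"
      by (rule QS.comb_append) (rule QS.rational_families_closed[OF D x])
    also have "comb (Hom E ?JT SM) n c (\<lambda>k. ?D k x) = comb (Hom E ?JT SM) n c (\<lambda>_. zmor E ?JT SM)"
      by (rule QS.comb_cong) auto
    also have "comb (Hom E ?JT SM) m (\<lambda>k. c (n + k)) (\<lambda>k. ?D (n + k) x) =
        comb (Hom E ?JT SM) m (\<lambda>k. c (n + k)) (\<lambda>k. \<sigma> x \<cdot> a k \<ominus>\<^bsub>Hom E ?JT SM\<^esub> \<pi> \<cdot> j k)"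
      by (rule QS.comb_cong) (use QS.rational_families_closed[OF rat x] in auto)
    finally show ?thesis using cl by simp
  qed
  have vsC: "vectorspace class_ring (Hom C T (Y x))" if "x \<in> N" for x
    using C.hom_vectorspace[of T "Y x"] T Y[OF that] by simp
  have class_comb: "comb (Hom C T (Y x)) n c (\<lambda>k. w k x) = stable_class E T (Y x) (comb (Hom E T (Y x)) n c (\<lambda>k. z k x))"
    if x: "x \<in> N" for c x
  proof -
    interpret CTY: complex_vectorspace "Hom C T (Y x)" using vsC[OF x] by (simp add: complex_vectorspace_def)
    have "comb (Hom C T (Y x)) n c (\<lambda>k. w k x) = comb (Hom C T (Y x)) n c (\<lambda>k. stable_class E T (Y x) (z k x))"
      by (rule CTY.comb_cong) (use wz z x class_closed in auto)
    also have "\<dots> = stable_class E T (Y x) (comb (Hom E T (Y x)) n c (\<lambda>k. z k x))"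
      by (rule comb_map[OF E.hom_vectorspace[OF T Y[OF x]] vsC[OF x] class_linear[OF T Y[OF x]] z[OF _ x], symmetric])
    finally show ?thesis .
  qed
  \<comment> \<open>a solution of the system is a combination of the \<open>z k\<close> that differs from \<open>zy\<close> by a morphism
    through the injective object \<open>J T\<close>\<close>
  have sound: "y x = comb (Hom C T (Y x)) n c (\<lambda>k. w k x)" if x: "x \<in> N" and Q: "?Q x c" for x c
  proof -
    interpret TY: complex_vectorspace "Hom E T (Y x)" by (rule E.Hom_vs[OF T Y[OF x]])
    let ?f = "comb (Hom E ?JT L) m (\<lambda>k. c (n + k)) a" and ?g = "comb (Hom E ?JT J) m (\<lambda>k. c (n + k)) j"
    have f: "?f \<in> mor E ?JT L" by (rule QL.comb_closed[OF a])
    have g: "?g \<in> mor E ?JT J" by (rule QJ.comb_closed[OF j])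
    have "\<pi> \<cdot> ?g = \<sigma> x \<cdot> ?f" using Q unfolding splitD[OF x] eq[OF x] by blast
    from cartesian[OF x JT f g this] obtain h where h: "h \<in> mor E ?JT (Y x)" "p x \<cdot> h = ?f" "s x \<cdot> h = ?g"
      by blast
    let ?z = "comb (Hom E T (Y x)) n c (\<lambda>k. z k x)"
    have zc: "?z \<in> mor E T (Y x)" by (rule TY.comb_closed[OF z[OF _ x]])
    have h\<iota>: "h \<cdot> ?\<iota> \<in> mor E T (Y x)" by (rule E.comp_closed[OF T JT Y[OF x] \<iota> h(1)])
    have "zy x = ?z \<oplus>\<^bsub>Hom E T (Y x)\<^esub> h \<cdot> ?\<iota>"
    proof (rule mor_to_pullback_unique[OF x T zy[OF x] E.add_closed[OF T Y[OF x] zc h\<iota>]])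
      show "p x \<cdot> zy x = p x \<cdot> (?z \<oplus>\<^bsub>Hom E T (Y x)\<^esub> h \<cdot> ?\<iota>)"
        unfolding E.comp_add_right[OF T Y[OF x] L p[OF x] zc h\<iota>] comp_comb_left[OF T Y[OF x] L p[OF x] z'[OF x]]
          E.comp_assoc[OF T JT Y[OF x] L \<iota> h(1) p[OF x], symmetric] h(2)
        using Q unfolding splitA[OF x] by simp
      show "s x \<cdot> zy x = s x \<cdot> (?z \<oplus>\<^bsub>Hom E T (Y x)\<^esub> h \<cdot> ?\<iota>)"
        unfolding E.comp_add_right[OF T Y[OF x] J s[OF x] zc h\<iota>] comp_comb_left[OF T Y[OF x] J s[OF x] z'[OF x]]
          E.comp_assoc[OF T JT Y[OF x] J \<iota> h(1) s[OF x], symmetric] h(3)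
        using Q unfolding splitB[OF x] by simp
    qed
    then have "zy x \<ominus>\<^bsub>Hom E T (Y x)\<^esub> ?z = h \<cdot> ?\<iota>"
      using zc h\<iota> by (simp add: a_minus_def TY.M.a_comm TY.M.a_lcomm TY.M.r_neg)
    then have "zy x \<ominus>\<^bsub>Hom E T (Y x)\<^esub> ?z \<in> inj_factoring E T (Y x)"
      using E.inj_factoring_iff[OF T Y[OF x]] h(1) by blast
    then show ?thesis
      unfolding yz[OF x] class_comb[OF x] using E.stable_class_eq_iff[OF T Y[OF x] zy[OF x] zc] by simp
  qed
  have complete: "\<exists>d. ?Q x d"
    if x: "x \<in> N" and yc: "y x = comb (Hom C T (Y x)) n c (\<lambda>k. w k x)" for x c
  proof -
    interpret TY: complex_vectorspace "Hom E T (Y x)" by (rule E.Hom_vs[OF T Y[OF x]])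
    let ?z = "comb (Hom E T (Y x)) n c (\<lambda>k. z k x)"
    have zc: "?z \<in> mor E T (Y x)" by (rule TY.comb_closed[OF z[OF _ x]])
    have "zy x \<ominus>\<^bsub>Hom E T (Y x)\<^esub> ?z \<in> inj_factoring E T (Y x)"
      using yc E.stable_class_eq_iff[OF T Y[OF x] zy[OF x] zc] unfolding yz[OF x] class_comb[OF x] by simp
    then obtain h where h: "h \<in> mor E ?JT (Y x)" "zy x \<ominus>\<^bsub>Hom E T (Y x)\<^esub> ?z = h \<cdot> ?\<iota>"
      using E.inj_factoring_iff[OF T Y[OF x]] by blast
    have h\<iota>: "h \<cdot> ?\<iota> \<in> mor E T (Y x)" by (rule E.comp_closed[OF T JT Y[OF x] \<iota> h(1)])
    have zyx: "zy x = ?z \<oplus>\<^bsub>Hom E T (Y x)\<^esub> h \<cdot> ?\<iota>"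
      unfolding h(2)[symmetric] using zc zy[OF x] by (simp add: a_minus_def TY.M.a_lcomm TY.M.r_neg)
    have ph: "p x \<cdot> h \<in> mor E ?JT L" by (rule E.comp_closed[OF JT Y[OF x] L h(1) p[OF x]])
    have sh: "s x \<cdot> h \<in> mor E ?JT J" by (rule E.comp_closed[OF JT Y[OF x] J h(1) s[OF x]])
    obtain e where e: "p x \<cdot> h = comb (Hom E ?JT L) m e a" "s x \<cdot> h = comb (Hom E ?JT J) m e j"
      using gen[OF ph sh] by (elim exE conjE)
    let ?d = "\<lambda>k. if k < n then c k else e (k - n)"
    have dn: "(\<lambda>k. ?d (n + k)) = e" by simp
    have dc: "comb (Hom E T X) n ?d v = comb (Hom E T X) n c v"
      if X: "X \<in> Ob E" and v: "\<forall>k<n. v k \<in> mor E T X" for X v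
      by (rule complex_vectorspace.comb_cong[OF E.Hom_vs[OF T X]]) (use v in auto)
    have pz': "\<forall>k<n. p x \<cdot> z k x \<in> mor E T L" and sz': "\<forall>k<n. s x \<cdot> z k x \<in> mor E T J"
      using TL.rational_families_closed[OF pz x] TJ.rational_families_closed[OF sz x] by blast+
    have "comb (Hom E T L) (n + m) ?d (\<lambda>k. ?A k x) = p x \<cdot> zy x"
      unfolding splitA[OF x] dn dc[OF L pz'] e(1)[symmetric] zyx
        E.comp_add_right[OF T Y[OF x] L p[OF x] zc h\<iota>] comp_comb_left[OF T Y[OF x] L p[OF x] z'[OF x]]
        E.comp_assoc[OF T JT Y[OF x] L \<iota> h(1) p[OF x]] ..
    moreover have "comb (Hom E T J) (n + m) ?d (\<lambda>k. ?B k x) = s x \<cdot> zy x"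
      unfolding splitB[OF x] dn dc[OF J sz'] e(2)[symmetric] zyx
        E.comp_add_right[OF T Y[OF x] J s[OF x] zc h\<iota>] comp_comb_left[OF T Y[OF x] J s[OF x] z'[OF x]]
        E.comp_assoc[OF T JT Y[OF x] J \<iota> h(1) s[OF x]] ..
    moreover have "comb (Hom E ?JT SM) (n + m) ?d (\<lambda>k. ?D k x) = zmor E ?JT SM"
      unfolding splitD[OF x] dn eq[OF x] e[symmetric]
        E.comp_assoc[OF JT Y[OF x] J SM h(1) s[OF x] \<pi>, symmetric] square[OF x]
      by (rule E.comp_assoc[OF JT Y[OF x] L SM h(1) p[OF x] \<sigma>_mor[OF x]])
    ultimately show ?thesis by (intro exI[of _ ?d] conjI)
  qed
  obtain t c where t: "t \<in> piecewise_rational G" and c: "\<forall>k. c k \<in> piecewise_rational G"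
    and tc: "\<forall>x \<in> N. (t x = 0 \<longleftrightarrow> (\<exists>c'. ?Q x c')) \<and> (t x = 0 \<longrightarrow> ?Q x (\<lambda>k. c k x))"
    using linear_condition_solution[OF lin] by (elim exE conjE)
  show ?thesis
  proof (rule exI[of _ t], rule exI[of _ c], intro conjI ballI impI t c)
    fix x assume x: "x \<in> N"
    note tcx = bspec[OF tc x]
    show "y x = comb (Hom C T (Y x)) n (\<lambda>k. c k x) (\<lambda>k. w k x)" if "t x = 0"
      by (rule sound[OF x]) (rule mp[OF conjunct2[OF tcx] that])
    show "t x = 0 \<longleftrightarrow> (\<exists>c'. y x = comb (Hom C T (Y x)) n c' (\<lambda>k. w k x))"
    proof
      assume "t x = 0"
      then obtain c' where "?Q x c'" using conjunct1[OF tcx] by (elim iffD1[THEN exE])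
      from sound[OF x this] show "\<exists>c'. y x = comb (Hom C T (Y x)) n c' (\<lambda>k. w k x)" by (rule exI[of _ c'])
    next
      assume "\<exists>c'. y x = comb (Hom C T (Y x)) n c' (\<lambda>k. w k x)"
      then obtain c' where "y x = comb (Hom C T (Y x)) n c' (\<lambda>k. w k x)" by (elim exE)
      from complete[OF x this] show "t x = 0" by (rule iffD2[OF conjunct1[OF tcx]])
    qed
  qed
qed

lemma rational_bundle_lifted_sections:
  assumes T: "T \<in> Ob E"
  shows "rational_bundle G N (\<lambda>x. Hom C T (Y x)) (lifted_sections T)"
proof (rule rational_bundle.intro)
  fix x assume x: "x \<in> N"
  show "vectorspace class_ring (Hom C T (Y x))"
    using C.hom_vectorspace[of T "Y x"] T Y[OF x] by simp
  fix y assume "y \<in> lifted_sections T"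
  then show "y x \<in> mor C T (Y x)" by (rule lifted_sectionsE) (simp add: x class_closed)
next
  show "\<exists>n w. (\<forall>k<n. w k \<in> lifted_sections T) \<and> (\<forall>x \<in> N. spanning_family (Hom C T (Y x)) n (\<lambda>k. w k x))"
    by (rule lifted_sections_generated[OF T])
qed (rule lifted_sections_solvable[OF T])

end

section \<open>The constructible lift\<close>

lemma (in complex_vectorspace) rational_coordinate:
  assumes v: "basis_family V n v" and k: "k < n"
  shows "(\<lambda>x\<in>carrier V. coords V n v x k) \<in> linear_functionals V"
proof -
  have vc: "\<And>i. i < n \<Longrightarrow> v i \<in> carrier V" by (rule basis_family_closed[OF v])
  have comb: "comb V n (coords V n v x) v = x" if "x \<in> carrier V" for x
    by (rule comb_coords[OF _ that]) (use v in \<open>simp add: basis_family_def\<close>)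
  have "coords V n v (x \<oplus> y) k = coords V n v x k + coords V n v y k"
    if "x \<in> carrier V" "y \<in> carrier V" for x y
  proof -
    have "x \<oplus> y = comb V n (\<lambda>i. coords V n v x i + coords V n v y i) v"
      using comb_add[of n v "coords V n v x" "coords V n v y", OF vc] comb that by simp
    then show ?thesis by (simp add: coords_comb[OF v k])
  qed
  moreover have "coords V n v (c \<odot> x) k = c * coords V n v x k" if "x \<in> carrier V" for x c
  proof -
    have "c \<odot> x = comb V n (\<lambda>i. c * coords V n v x i) v"
      using comb_smult[of n v c "coords V n v x", OF vc] comb that by simp
    then show ?thesis by (simp add: coords_comb[OF v k])
  qed
  ultimately show ?thesis unfolding linear_functionals_def by simp
qed

lemma rational_families_linear:
  assumes V: "vectorspace class_ring V" and v: "basis_family V n v"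
    and w: "\<And>k. k < n \<Longrightarrow> w k \<in> carrier W"
  shows "(\<lambda>x. comb W n (coords V n v x) w) \<in> rational_families (linear_functionals V) (carrier V) W"
proof -
  interpret V: complex_vectorspace V using V by (simp add: complex_vectorspace_def)
  show ?thesis
  proof (rule rational_familiesI[of n "\<lambda>k. \<lambda>x\<in>carrier V. coords V n v x k" _ w])
    show "(\<lambda>x\<in>carrier V. coords V n v x k) \<in> piecewise_rational (linear_functionals V)" if "k < n" for k
      by (intro piecewise_rational.coord V.rational_coordinate[OF v that])
    show "comb W n (coords V n v x) w = comb W n (\<lambda>k. (\<lambda>x\<in>carrier V. coords V n v x k) x) w"
      if "x \<in> carrier V" for x using that by simp
  qed (rule w)
qed

context stable_triangulated
begin

text \<open>The sign is the one of \<open>pullback_of_susp_map\<close>: the pullback along \<open>\<sigma> \<epsilon>\<close> gives a triangle over \<open>\<epsilon>\<close>.\<close>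

lemma exists_linear_lift:
  assumes L: "L \<in> Ob E" and X: "X \<in> Ob E" and fin: "hom_finite C"
  shows "\<exists>\<sigma>. \<sigma> \<in> rational_families (linear_functionals (Hom C L X)) (mor C L X) (Hom E L X) \<and>
    (\<forall>\<epsilon> \<in> mor C L X. stable_class E L X (\<ominus>\<^bsub>Hom E L X\<^esub> \<sigma> \<epsilon>) = \<epsilon>)"
proof -
  have vC: "vectorspace class_ring (Hom C L X)" using C.hom_vectorspace[of L X] L X by simp
  interpret CLX: complex_vectorspace "Hom C L X" using vC by (simp add: complex_vectorspace_def)
  interpret ELX: complex_vectorspace "Hom E L X" by (rule E.Hom_vs[OF L X])
  have "CLX.fin_dim" using fin L X by (simp add: hom_finite_def)
  from CLX.exists_basis_family[OF this] obtain n e where e: "basis_family (Hom C L X) n e" by (elim exE)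
  have "\<exists>g. g \<in> mor E L X \<and> stable_class E L X g = e k" if "k < n" for k
    using CLX.basis_family_closed[OF e that] by (auto simp: mor_C)
  then have "\<forall>k. \<exists>g. k < n \<longrightarrow> g \<in> mor E L X \<and> stable_class E L X g = e k" by blast
  then obtain f where f: "\<forall>k. k < n \<longrightarrow> f k \<in> mor E L X \<and> stable_class E L X (f k) = e k"
    unfolding choice_iff by (elim exE)
  have fm: "\<And>k. k < n \<Longrightarrow> f k \<in> mor E L X" using f by blast
  let ?\<tau> = "\<lambda>\<epsilon>. comb (Hom E L X) n (coords (Hom C L X) n e \<epsilon>) f"
  have \<tau>: "?\<tau> \<in> rational_families (linear_functionals (Hom C L X)) (mor C L X) (Hom E L X)"
    by (rule rational_families_linear[OF vC e fm])
  have \<tau>m: "?\<tau> \<epsilon> \<in> mor E L X" for \<epsilon> by (rule ELX.comb_closed[OF fm])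
  show ?thesis
  proof (intro exI[of _ "\<lambda>\<epsilon>. \<ominus>\<^bsub>Hom E L X\<^esub> ?\<tau> \<epsilon>"] conjI ballI)
    show "(\<lambda>\<epsilon>. \<ominus>\<^bsub>Hom E L X\<^esub> ?\<tau> \<epsilon>) \<in> rational_families (linear_functionals (Hom C L X)) (mor C L X) (Hom E L X)"
      by (rule rational_families_cong[OF ELX.rational_families_smult[OF piecewise_rational.const[of "-1"] \<tau>]])
        (rule ELX.minus_one_smult[OF \<tau>m, symmetric])
    fix \<epsilon> assume \<epsilon>: "\<epsilon> \<in> mor C L X"
    have "stable_class E L X (?\<tau> \<epsilon>) = comb (Hom C L X) n (coords (Hom C L X) n e \<epsilon>) (\<lambda>k. stable_class E L X (f k))"
      by (rule comb_map[OF E.hom_vectorspace[OF L X] vC class_linear[OF L X] fm])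
    also have "\<dots> = comb (Hom C L X) n (coords (Hom C L X) n e \<epsilon>) e"
      by (rule CLX.comb_cong) (use f CLX.basis_family_closed[OF e] in auto)
    also have "\<dots> = \<epsilon>" by (rule CLX.comb_coords[OF _ \<epsilon>]) (use e in \<open>simp add: basis_family_def\<close>)
    finally show "stable_class E L X (\<ominus>\<^bsub>Hom E L X\<^esub> (\<ominus>\<^bsub>Hom E L X\<^esub> ?\<tau> \<epsilon>)) = \<epsilon>"
      using \<tau>m by simp
  qed
qed

text \<open>The pullbacks along a linear lift \<open>\<sigma>\<close> provide one triangle over every \<open>\<epsilon>\<close>. Their representations
  \<open>R \<epsilon>\<close> form a bundle, with the lifted sections at the vertex 2 and constant families of spaces at the
  others, and so they have constructible coordinates. The representation \<open>R'\<close> of an arbitrary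
  triangle over \<open>\<epsilon>\<close> is isomorphic to \<open>R \<epsilon>\<close> by \<open>triangle_comparison\<close>, and therefore has the same orbit.\<close>

lemma constructible_lift_of_representations:
  assumes T: "T \<in> Ob E" and L: "L \<in> Ob E" and M: "M \<in> Ob E"
    and finC: "hom_finite C" and finE: "hom_finite E"
  shows "\<exists>\<phi>. constructible_map (affine_space (Hom C L (Susp C M)))
      (coproduct (dim_vectors C T L M) (rep_variety (End_algebra C T) A4_quiver)) \<phi> \<and>
    (\<forall>\<epsilon> \<in> mor C L (Susp C M). \<forall>Y i p. (M, Y, L, i, p, \<epsilon>) \<in> Tri C \<longrightarrow>
      (let R = hom_representation C T M Y L (Susp C M) i p \<epsilon> in
        fst (\<phi> \<epsilon>) = dimension_vector A4_quiver R \<and>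
        snd (\<phi> \<epsilon>) \<in> representation_orbit (End_algebra C T) A4_quiver R))"
proof -
  let ?SM = "susp_ob S M" and ?J = "inj_ob S M"
  let ?B = "End_algebra C T"
  have SM: "?SM \<in> Ob E" and J: "?J \<in> Ob E" using E.susp_typed[OF M] by auto
  define N where "N = mor C L ?SM"
  define G where "G = linear_functionals (Hom C L ?SM)"
  have vC: "vectorspace class_ring (Hom C X X')" if "X \<in> Ob E" "X' \<in> Ob E" for X X'
    using C.hom_vectorspace[of X X'] that by simp
  have fdC: "vectorspace.fin_dim class_ring (Hom C X X')" if "X \<in> Ob E" "X' \<in> Ob E" for X X'
    using finC that by (simp add: hom_finite_def)
  obtain \<sigma> where \<sigma>: "\<sigma> \<in> rational_families G N (Hom E L ?SM)"
    and \<sigma>\<epsilon>: "\<And>\<epsilon>. \<epsilon> \<in> N \<Longrightarrow> stable_class E L ?SM (\<ominus>\<^bsub>Hom E L ?SM\<^esub> \<sigma> \<epsilon>) = \<epsilon>"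
    using exists_linear_lift[OF L SM finC] unfolding N_def G_def by auto
  have \<sigma>m: "\<sigma> \<epsilon> \<in> mor E L ?SM" if "\<epsilon> \<in> N" for \<epsilon>
    by (rule complex_vectorspace.rational_families_closed[OF E.Hom_vs[OF L SM] \<sigma> that])

  let ?P = "\<lambda>\<epsilon> Y p s i. Y \<in> Ob E \<and> p \<in> mor E Y L \<and> s \<in> mor E Y ?J \<and> i \<in> mor E M Y \<and>
    susp_map S M \<cdot> s = \<sigma> \<epsilon> \<cdot> p \<and> p \<cdot> i = zmor E M L \<and> s \<cdot> i = inj_map S M \<and>
    (\<forall>W \<in> Ob E. \<forall>x \<in> mor E W L. \<forall>j \<in> mor E W ?J. susp_map S M \<cdot> j = \<sigma> \<epsilon> \<cdot> x \<longrightarrow>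
      (\<exists>!h. h \<in> mor E W Y \<and> p \<cdot> h = x \<and> s \<cdot> h = j)) \<and>
    (M, Y, L, stable_class E M Y i, stable_class E Y L p, \<epsilon>) \<in> Tri C"
  define pb where "pb \<epsilon> = (SOME q. ?P \<epsilon> (fst q) (fst (snd q)) (fst (snd (snd q))) (snd (snd (snd q))))" for \<epsilon>
  define Y where "Y \<epsilon> = fst (pb \<epsilon>)" for \<epsilon>
  define p where "p \<epsilon> = fst (snd (pb \<epsilon>))" for \<epsilon>
  define s where "s \<epsilon> = fst (snd (snd (pb \<epsilon>)))" for \<epsilon>
  define i where "i \<epsilon> = snd (snd (snd (pb \<epsilon>)))" for \<epsilon>
  have P: "?P \<epsilon> (Y \<epsilon>) (p \<epsilon>) (s \<epsilon>) (i \<epsilon>)" if \<epsilon>: "\<epsilon> \<in> N" for \<epsilon>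
  proof -
    obtain Y' p' s' i' where q: "?P \<epsilon> Y' p' s' i'"
      using pullback_of_susp_map[OF M L \<sigma>m[OF \<epsilon>]] unfolding \<sigma>\<epsilon>[OF \<epsilon>] by (elim exE)
    have "\<exists>q. ?P \<epsilon> (fst q) (fst (snd q)) (fst (snd (snd q))) (snd (snd (snd q)))"
      by (rule exI[of _ "(Y', p', s', i')"], unfold fst_conv snd_conv) (rule q)
    then show ?thesis unfolding Y_def p_def s_def i_def pb_def by (rule someI_ex)
  qed
  have Y: "Y \<epsilon> \<in> Ob E" and p: "p \<epsilon> \<in> mor E (Y \<epsilon>) L" and s: "s \<epsilon> \<in> mor E (Y \<epsilon>) ?J" and i: "i \<epsilon> \<in> mor E M (Y \<epsilon>)"
    and sq: "susp_map S M \<cdot> s \<epsilon> = \<sigma> \<epsilon> \<cdot> p \<epsilon>" and pi: "p \<epsilon> \<cdot> i \<epsilon> = zmor E M L"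
    and si: "s \<epsilon> \<cdot> i \<epsilon> = inj_map S M"
    and tri: "(M, Y \<epsilon>, L, stable_class E M (Y \<epsilon>) (i \<epsilon>), stable_class E (Y \<epsilon>) L (p \<epsilon>), \<epsilon>) \<in> Tri C"
    if "\<epsilon> \<in> N" for \<epsilon> using P[OF that] by simp_all
  interpret pullback_family E S C G N M L \<sigma> Y p s
  proof
    fix \<epsilon> W a j assume "\<epsilon> \<in> N" "W \<in> Ob E" "a \<in> mor E W L" "j \<in> mor E W ?J"
      "susp_map S M \<cdot> j = \<sigma> \<epsilon> \<cdot> a"
    then show "\<exists>!h. h \<in> mor E W (Y \<epsilon>) \<and> p \<epsilon> \<cdot> h = a \<and> s \<epsilon> \<cdot> h = j" using P[of \<epsilon>] by simp
  qed (use M L \<sigma> Y p s sq finE in auto)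

  define R where "R \<epsilon> = hom_representation C T M (Y \<epsilon>) L ?SM (stable_class E M (Y \<epsilon>) (i \<epsilon>))
    (stable_class E (Y \<epsilon>) L (p \<epsilon>)) \<epsilon>" for \<epsilon>
  define \<S> where "\<S> v = (if v = 2 then lifted_sections T
    else rational_families G N (Hom C T (if v = 1 then M else if v = 3 then L else ?SM)))" for v :: nat
  have id_rat: "(\<lambda>\<epsilon>. \<epsilon>) \<in> rational_families G N (Hom C L ?SM)"
  proof -
    interpret V: complex_vectorspace "Hom C L ?SM" using vC[OF L SM] by (simp add: complex_vectorspace_def)
    obtain n e where e: "basis_family (Hom C L ?SM) n e" using V.exists_basis_family[OF fdC[OF L SM]] by (elim exE)
    show ?thesis unfolding G_def N_def
      by (rule rational_families_cong[OF rational_families_linear[OF vC[OF L SM] e V.basis_family_closed[OF e]]])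
        (use V.comb_coords e in \<open>auto simp: basis_family_def\<close>)
  qed
  have map_1: "(\<lambda>\<epsilon>. stable_class E M (Y \<epsilon>) (i \<epsilon>) \<cdot>\<^bsub>C\<^esub> y \<epsilon>) \<in> lifted_sections T"
    if y: "y \<in> rational_families G N (Hom C T M)" for y
    using y
  proof (rule rational_familiesE)
    fix n f v assume f: "\<And>k. k < n \<Longrightarrow> f k \<in> piecewise_rational G" and v: "\<And>k. k < n \<Longrightarrow> v k \<in> mor C T M"
      and yf: "\<And>\<epsilon>. \<epsilon> \<in> N \<Longrightarrow> y \<epsilon> = comb (Hom C T M) n (\<lambda>k. f k \<epsilon>) v"
    interpret ETM: complex_vectorspace "Hom E T M" by (rule E.Hom_vs[OF T M])
    interpret ETL: complex_vectorspace "Hom E T L" by (rule E.Hom_vs[OF T L])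
    interpret CTM: complex_vectorspace "Hom C T M" using vC[OF T M] by (simp add: complex_vectorspace_def)
    define u where "u k = (SOME g. g \<in> mor E T M \<and> stable_class E T M g = v k)" for k
    have u: "u k \<in> mor E T M \<and> stable_class E T M (u k) = v k" if "k < n" for k
    proof -
      have "\<exists>g. g \<in> mor E T M \<and> stable_class E T M g = v k" using v[OF that] by (auto simp: mor_C)
      then show ?thesis unfolding u_def by (rule someI_ex)
    qed
    have um: "\<And>k. k < n \<Longrightarrow> u k \<in> mor E T M" and um': "\<forall>k<n. u k \<in> mor E T M" using u by auto
    let ?u = "\<lambda>\<epsilon>. comb (Hom E T M) n (\<lambda>k. f k \<epsilon>) u"
    have uc: "?u \<epsilon> \<in> mor E T M" for \<epsilon> by (rule ETM.comb_closed[OF um])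
    have cu: "stable_class E T M (?u \<epsilon>) = y \<epsilon>" if "\<epsilon> \<in> N" for \<epsilon>
    proof -
      have "stable_class E T M (?u \<epsilon>) = comb (Hom C T M) n (\<lambda>k. f k \<epsilon>) (\<lambda>k. stable_class E T M (u k))"
        by (rule comb_map[OF E.hom_vectorspace[OF T M] vC[OF T M] class_linear[OF T M] um])
      also have "\<dots> = y \<epsilon>" unfolding yf[OF that] by (rule CTM.comb_cong) (use u v in auto)
      finally show ?thesis .
    qed
    show ?thesis
    proof (rule lifted_sectionsI[where z="\<lambda>\<epsilon>. i \<epsilon> \<cdot> ?u \<epsilon>"])
      fix \<epsilon> assume \<epsilon>: "\<epsilon> \<in> N"
      show "i \<epsilon> \<cdot> ?u \<epsilon> \<in> mor E T (Y \<epsilon>)" by (rule E.comp_closed[OF T M Y[OF \<epsilon>] uc i[OF \<epsilon>]])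
      show "stable_class E M (Y \<epsilon>) (i \<epsilon>) \<cdot>\<^bsub>C\<^esub> y \<epsilon> = stable_class E T (Y \<epsilon>) (i \<epsilon> \<cdot> ?u \<epsilon>)"
        using class_comp[OF T M Y[OF \<epsilon>] uc i[OF \<epsilon>]] cu[OF \<epsilon>] by simp
    next
      show "(\<lambda>\<epsilon>. p \<epsilon> \<cdot> (i \<epsilon> \<cdot> ?u \<epsilon>)) \<in> rational_families G N (Hom E T L)"
      proof (rule rational_families_cong[OF ETL.rational_families_const[OF E.zmor_closed[OF T L]]])
        fix \<epsilon> assume \<epsilon>: "\<epsilon> \<in> N"
        show "p \<epsilon> \<cdot> (i \<epsilon> \<cdot> ?u \<epsilon>) = zmor E T L"
          unfolding E.comp_assoc[OF T M Y[OF \<epsilon>] L uc i[OF \<epsilon>] p[OF \<epsilon>], symmetric] pi[OF \<epsilon>]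
          by (rule E.comp_zero_left[OF T M L uc])
      qed
      show "(\<lambda>\<epsilon>. s \<epsilon> \<cdot> (i \<epsilon> \<cdot> ?u \<epsilon>)) \<in> rational_families G N (Hom E T ?J)"
      proof (rule rational_familiesI[of n f _ "\<lambda>k. inj_map S M \<cdot> u k"])
        fix \<epsilon> assume \<epsilon>: "\<epsilon> \<in> N"
        show "s \<epsilon> \<cdot> (i \<epsilon> \<cdot> ?u \<epsilon>) = comb (Hom E T ?J) n (\<lambda>k. f k \<epsilon>) (\<lambda>k. inj_map S M \<cdot> u k)"
          unfolding E.comp_assoc[OF T M Y[OF \<epsilon>] J uc i[OF \<epsilon>] s[OF \<epsilon>], symmetric] si[OF \<epsilon>]
          by (rule comp_comb_left[OF T M J E.susp_typed(3)[OF M] um'])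
      qed (use f E.comp_closed[OF T M J um E.susp_typed(3)[OF M]] in auto)
    qed
  qed
  have map_2: "(\<lambda>\<epsilon>. stable_class E (Y \<epsilon>) L (p \<epsilon>) \<cdot>\<^bsub>C\<^esub> y \<epsilon>) \<in> rational_families G N (Hom C T L)"
    if y: "y \<in> lifted_sections T" for y
    using y
  proof (rule lifted_sectionsE)
    fix z assume z: "\<And>\<epsilon>. \<epsilon> \<in> N \<Longrightarrow> z \<epsilon> \<in> mor E T (Y \<epsilon>)" and yz: "\<And>\<epsilon>. \<epsilon> \<in> N \<Longrightarrow> y \<epsilon> = stable_class E T (Y \<epsilon>) (z \<epsilon>)"
      and pz: "(\<lambda>\<epsilon>. p \<epsilon> \<cdot> z \<epsilon>) \<in> rational_families G N (Hom E T L)"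
    show ?thesis
    proof (rule rational_families_cong[OF rational_families_image[OF E.hom_vectorspace[OF T L] vC[OF T L] class_linear[OF T L] pz]])
      fix \<epsilon> assume \<epsilon>: "\<epsilon> \<in> N"
      show "stable_class E (Y \<epsilon>) L (p \<epsilon>) \<cdot>\<^bsub>C\<^esub> y \<epsilon> = stable_class E T L (p \<epsilon> \<cdot> z \<epsilon>)"
        unfolding yz[OF \<epsilon>] by (rule class_comp[OF T Y[OF \<epsilon>] L z[OF \<epsilon>] p[OF \<epsilon>], symmetric])
    qed
  qed
  have map_3: "(\<lambda>\<epsilon>. \<epsilon> \<cdot>\<^bsub>C\<^esub> y \<epsilon>) \<in> rational_families G N (Hom C T ?SM)"
    if y: "y \<in> rational_families G N (Hom C T L)" for y
    using C.rational_families_comp[of T L ?SM y G N "\<lambda>\<epsilon>. \<epsilon>"] T L SM y id_rat by simp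
  have act_2: "(\<lambda>\<epsilon>. y \<epsilon> \<cdot>\<^bsub>C\<^esub> b) \<in> lifted_sections T" if y: "y \<in> lifted_sections T" and b: "b \<in> mor C T T" for y b
    using y
  proof (rule lifted_sectionsE)
    fix z assume z: "\<And>\<epsilon>. \<epsilon> \<in> N \<Longrightarrow> z \<epsilon> \<in> mor E T (Y \<epsilon>)" and yz: "\<And>\<epsilon>. \<epsilon> \<in> N \<Longrightarrow> y \<epsilon> = stable_class E T (Y \<epsilon>) (z \<epsilon>)"
      and pz: "(\<lambda>\<epsilon>. p \<epsilon> \<cdot> z \<epsilon>) \<in> rational_families G N (Hom E T L)"
      and sz: "(\<lambda>\<epsilon>. s \<epsilon> \<cdot> z \<epsilon>) \<in> rational_families G N (Hom E T ?J)"
    obtain c where c: "c \<in> mor E T T" "b = stable_class E T T c" using b by (auto simp: mor_C)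
    show ?thesis
    proof (rule lifted_sectionsI[where z="\<lambda>\<epsilon>. z \<epsilon> \<cdot> c"])
      fix \<epsilon> assume \<epsilon>: "\<epsilon> \<in> N"
      show "z \<epsilon> \<cdot> c \<in> mor E T (Y \<epsilon>)" by (rule E.comp_closed[OF T T Y[OF \<epsilon>] c(1) z[OF \<epsilon>]])
      show "y \<epsilon> \<cdot>\<^bsub>C\<^esub> b = stable_class E T (Y \<epsilon>) (z \<epsilon> \<cdot> c)"
        unfolding yz[OF \<epsilon>] c(2) by (rule class_comp[OF T T Y[OF \<epsilon>] c(1) z[OF \<epsilon>], symmetric])
    next
      show "(\<lambda>\<epsilon>. p \<epsilon> \<cdot> (z \<epsilon> \<cdot> c)) \<in> rational_families G N (Hom E T L)"
        by (rule rational_families_cong[OF rational_families_image[OF E.hom_vectorspace[OF T L] E.hom_vectorspace[OF T L]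
              E.comp_right_linear[OF T T L c(1)] pz]])
          (rule E.comp_assoc[OF T T Y L c(1) z p, symmetric])
      show "(\<lambda>\<epsilon>. s \<epsilon> \<cdot> (z \<epsilon> \<cdot> c)) \<in> rational_families G N (Hom E T ?J)"
        by (rule rational_families_cong[OF rational_families_image[OF E.hom_vectorspace[OF T J] E.hom_vectorspace[OF T J]
              E.comp_right_linear[OF T T J c(1)] sz]])
          (rule E.comp_assoc[OF T T Y J c(1) z s, symmetric])
    qed
  qed
  have act: "(\<lambda>\<epsilon>. y \<epsilon> \<cdot>\<^bsub>C\<^esub> b) \<in> rational_families G N (Hom C T X)"
    if X: "X \<in> Ob E" and y: "y \<in> rational_families G N (Hom C T X)" and b: "b \<in> mor C T T" for y b X
    by (rule rational_families_image[OF vC[OF T X] vC[OF T X] C.comp_right_linear[of T T X b] y])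
      (use T X b in simp_all)

  have rep: "right_module_representation ?B A4_quiver (R \<epsilon>)" if \<epsilon>: "\<epsilon> \<in> N" for \<epsilon>
    unfolding R_def
    by (rule C.right_module_representation_hom)
      (use T M Y[OF \<epsilon>] L SM class_closed[OF i[OF \<epsilon>]] class_closed[OF p[OF \<epsilon>]] \<epsilon> in \<open>simp_all add: N_def\<close>)
  interpret rb: representation_bundle G N ?B A4_quiver R \<S>
  proof (rule representation_bundle.intro)
    fix v :: nat assume v: "v \<in> verts A4_quiver"
    show "rational_bundle G N (\<lambda>\<epsilon>. space_at (R \<epsilon>) v) (\<S> v)"
    proof (cases "v = 2")
      case True
      then show ?thesis using rational_bundle_lifted_sections[OF T] by (simp add: R_def \<S>_def)
    next
      case False
      let ?X = "if v = 1 then M else if v = 3 then L else ?SM"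
      have X: "?X \<in> Ob E" using M L SM by simp
      from constant_rational_bundle[OF vC[OF T X] fdC[OF T X], of G N] False
      show ?thesis by (cases "v = 1"; cases "v = 3") (simp_all add: R_def \<S>_def)
    qed
    fix y b assume y: "y \<in> \<S> v" and b: "b \<in> carrier ?B"
    have b': "b \<in> mor C T T" using b by (simp add: End_algebra_def)
    show "(\<lambda>\<epsilon>. act_at (R \<epsilon>) v (y \<epsilon>) b) \<in> \<S> v"
    proof (cases "v = 2")
      case True
      then show ?thesis using act_2[OF _ b'] y by (simp add: R_def \<S>_def)
    next
      case False
      let ?X = "if v = 1 then M else if v = 3 then L else ?SM"
      have X: "?X \<in> Ob E" using M L SM by simp
      from act[OF X _ b', of y] y False show ?thesis by (simp add: R_def \<S>_def)
    qed
  next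
    fix a :: nat and y assume a: "a \<in> arcs A4_quiver" and y: "y \<in> \<S> (tail A4_quiver a)"
    consider "a = 1" | "a = 2" | "a = 3" using a by auto
    then show "(\<lambda>\<epsilon>. map_at (R \<epsilon>) a (y \<epsilon>)) \<in> \<S> (head A4_quiver a)"
    proof cases
      case 1
      then show ?thesis using map_1[of y] y by (simp add: R_def \<S>_def)
    next
      case 2
      then show ?thesis using map_2[of y] y by (simp add: R_def \<S>_def)
    next
      case 3
      then show ?thesis using map_3[of y] y by (simp add: R_def \<S>_def)
    qed
  next
    interpret V: complex_vectorspace "Hom C T T" using vC[OF T T] by (simp add: complex_vectorspace_def)
    obtain n e where "basis_family (Hom C T T) n e" using V.exists_basis_family[OF fdC[OF T T]] by (elim exE)
    then have "spanning_family ?B n e"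
      by (simp add: basis_family_def spanning_family_def comb_End_algebra) (simp add: End_algebra_def)
    then show "\<exists>m c. spanning_family ?B m c" by (intro exI)
  qed (use rep in auto)

  have dims: "\<forall>\<epsilon> \<in> N. dimension_vector A4_quiver (R \<epsilon>) \<in> dim_vectors C T L M"
  proof
    fix \<epsilon> assume \<epsilon>: "\<epsilon> \<in> N"
    show "dimension_vector A4_quiver (R \<epsilon>) \<in> dim_vectors C T L M"
      using C.triangle_dim_le[OF tri[OF \<epsilon>] _ finC, of T] T
      by (simp add: dim_vectors_def dimension_vector_def R_def)
  qed
  obtain \<phi> \<beta> where \<phi>: "constructible_map (affine_structure N G) (coproduct (dim_vectors C T L M) (rep_variety ?B A4_quiver)) \<phi>"
    and \<phi>N: "\<forall>\<epsilon> \<in> N. fst (\<phi> \<epsilon>) = dimension_vector A4_quiver (R \<epsilon>) \<and>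
      (\<forall>v \<in> verts A4_quiver. basis_family (space_at (R \<epsilon>) v) (fst (\<phi> \<epsilon>) v) (\<beta> \<epsilon> v)) \<and>
      coordinate_point ?B A4_quiver (fst (\<phi> \<epsilon>)) (R \<epsilon>) (\<beta> \<epsilon>) (snd (\<phi> \<epsilon>))"
    using rb.exists_constructible_coordinates[OF dims] by (elim exE conjE)
  show ?thesis
  proof (rule exI[of _ \<phi>], intro conjI ballI allI impI)
    show "constructible_map (affine_space (Hom C L (Susp C M)))
      (coproduct (dim_vectors C T L M) (rep_variety ?B A4_quiver)) \<phi>"
      using \<phi> by (simp add: affine_space_def N_def G_def)
    fix \<epsilon> Y' i' p' assume "\<epsilon> \<in> mor C L (Susp C M)" and t': "(M, Y', L, i', p', \<epsilon>) \<in> Tri C"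
    then have \<epsilon>: "\<epsilon> \<in> N" by (simp add: N_def)
    note \<phi>\<epsilon> = bspec[OF \<phi>N \<epsilon>]
    have Y': "Y' \<in> Ob E" and i': "i' \<in> mor C M Y'" and p': "p' \<in> mor C Y' L"
      using C.tri_typed[OF t'] by auto
    define R' where "R' = hom_representation C T M Y' L ?SM i' p' \<epsilon>"
    have rep': "right_module_representation ?B A4_quiver R'"
      unfolding R'_def
      by (rule C.right_module_representation_hom)
        (use T M Y' L SM i' p' \<epsilon> in \<open>simp_all add: N_def\<close>)
    obtain b where b: "b \<in> mor C (Y \<epsilon>) Y'" "b \<cdot>\<^bsub>C\<^esub> stable_class E M (Y \<epsilon>) (i \<epsilon>) = i'"
      "p' \<cdot>\<^bsub>C\<^esub> b = stable_class E (Y \<epsilon>) L (p \<epsilon>)"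
      using C.triangle_comparison[OF tri[OF \<epsilon>] t'] by blast
    have bij: "bij_betw (\<lambda>f. b \<cdot>\<^bsub>C\<^esub> f) (mor C T (Y \<epsilon>)) (mor C T Y')"
      by (rule C.triangle_comparison_bij[OF tri[OF \<epsilon>] t' b]) (use T in simp)
    have blin: "(\<lambda>f. b \<cdot>\<^bsub>C\<^esub> f) \<in> module_hom class_ring (Hom C T (Y \<epsilon>)) (Hom C T Y')"
      using C.comp_left_linear[of T "Y \<epsilon>" Y' b] T Y[OF \<epsilon>] Y' b(1) by simp
    let ?\<theta> = "\<lambda>v f. if v = 2 then b \<cdot>\<^bsub>C\<^esub> f else f"
    have id_lin: "(\<lambda>f. f) \<in> module_hom class_ring V V" for V :: "(complex, ('o, 'e) stable_mor) module"
      by (simp add: LinearCombinations.module_hom_def)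
    have transport: "(\<forall>v \<in> verts A4_quiver. basis_family (space_at R' v) (fst (\<phi> \<epsilon>) v) (\<lambda>k. ?\<theta> v (\<beta> \<epsilon> v k))) \<and>
      coordinate_point ?B A4_quiver (fst (\<phi> \<epsilon>)) R' (\<lambda>v k. ?\<theta> v (\<beta> \<epsilon> v k)) (snd (\<phi> \<epsilon>))"
    proof -
      have th: "a \<in> arcs A4_quiver \<Longrightarrow> tail A4_quiver a \<in> verts A4_quiver \<and> head A4_quiver a \<in> verts A4_quiver" for a
        by auto
      have V: "v \<in> verts A4_quiver \<Longrightarrow> vectorspace class_ring (space_at (R \<epsilon>) v)" for v
        by (rule right_module_representation.space[OF rep[OF \<epsilon>]])
      have V': "v \<in> verts A4_quiver \<Longrightarrow> vectorspace class_ring (space_at R' v)" for v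
        by (rule right_module_representation.space[OF rep'])
      have \<theta>: "?\<theta> v \<in> module_hom class_ring (space_at (R \<epsilon>) v) (space_at R' v)" for v
        using blin id_lin by (simp add: R_def R'_def)
      have bij\<theta>: "bij_betw (?\<theta> v) (carrier (space_at (R \<epsilon>) v)) (carrier (space_at R' v))" for v
        using bij by (cases "v = 2") (simp_all add: R_def R'_def bij_betw_def)
      have actc: "?\<theta> v (act_at (R \<epsilon>) v x c) = act_at R' v (?\<theta> v x) c"
        if "x \<in> carrier (space_at (R \<epsilon>) v)" "c \<in> carrier ?B" for v x c
        using that C.comp_assoc[of T T "Y \<epsilon>" Y' c x b] T Y[OF \<epsilon>] Y' b(1)
        by (cases "v = 2") (simp_all add: R_def R'_def End_algebra_def)
      have mapc: "?\<theta> (head A4_quiver a) (map_at (R \<epsilon>) a x) = map_at R' a (?\<theta> (tail A4_quiver a) x)"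
        if a: "a \<in> arcs A4_quiver" and x: "x \<in> carrier (space_at (R \<epsilon>) (tail A4_quiver a))" for a x
      proof -
        consider "a = 1" | "a = 2" | "a = 3" using a by auto
        then show ?thesis
        proof cases
          case 1
          then show ?thesis
            using x C.comp_assoc[of T M "Y \<epsilon>" Y' x "stable_class E M (Y \<epsilon>) (i \<epsilon>)" b] T M Y[OF \<epsilon>] Y' b(1)
              class_closed[OF i[OF \<epsilon>]] b(2) by (simp add: R_def R'_def)
        next
          case 2
          then show ?thesis
            using x C.comp_assoc[of T "Y \<epsilon>" Y' L x b p'] T L Y[OF \<epsilon>] Y' b(1) p' b(3) by (simp add: R_def R'_def)
        next
          case 3
          then show ?thesis by (simp add: R_def R'_def)
        qed
      qed
      have pt: "coordinate_point ?B A4_quiver (fst (\<phi> \<epsilon>)) (R \<epsilon>) (\<beta> \<epsilon>) (snd (\<phi> \<epsilon>))"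
        and ba: "\<And>v. v \<in> verts A4_quiver \<Longrightarrow> basis_family (space_at (R \<epsilon>) v) (fst (\<phi> \<epsilon>) v) (\<beta> \<epsilon> v)"
        using \<phi>\<epsilon> by blast+
      note tr = coordinate_point_transport[where \<theta>="?\<theta>", OF pt th V V' ba \<theta> bij\<theta> actc mapc]
      show ?thesis by (intro conjI ballI tr)
    qed
    have dim: "fst (\<phi> \<epsilon>) = dimension_vector A4_quiver R'"
    proof -
      have "fst (\<phi> \<epsilon>) v = vdim (space_at R' v)" if "v \<in> verts A4_quiver" for v
        using complex_vectorspace.basis_family_basis(2)[of "space_at R' v"] transport that
          right_module_representation.space[OF rep' that] by (auto simp: complex_vectorspace_def)
      moreover have "fst (\<phi> \<epsilon>) \<in> extensional (verts A4_quiver)"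
        using \<phi>\<epsilon> by (simp only: dimension_vector_def restrict_extensional)
      ultimately show ?thesis unfolding dimension_vector_def by (intro extensionalityI) auto
    qed
    have "snd (\<phi> \<epsilon>) \<in> rep_set ?B A4_quiver (fst (\<phi> \<epsilon>))"
      using conjunct2[OF transport] unfolding coordinate_point_def by (rule conjunct1)
    then have "snd (\<phi> \<epsilon>) \<in> GL_orbit ?B A4_quiver (fst (\<phi> \<epsilon>)) (snd (\<phi> \<epsilon>))"
      by (rule rep_point_in_GL_orbit) auto
    then have "snd (\<phi> \<epsilon>) \<in> representation_orbit ?B A4_quiver R'"
      unfolding representation_orbit_def dim[symmetric] using conjunct2[OF transport] by blast
    then show "let R = hom_representation C T M Y' L (Susp C M) i' p' \<epsilon> in
        fst (\<phi> \<epsilon>) = dimension_vector A4_quiver R \<and> snd (\<phi> \<epsilon>) \<in> representation_orbit ?B A4_quiver R"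
      using dim by (simp add: R'_def Let_def)
  qed
qed

end

theorem proposition2p10:
  fixes C :: "('o, ('o, 'e) stable_mor) tri_category"
    and E :: "('o, 'e) exact_category"
    and S :: "('o, 'e) susp_choice"
    and T L M :: 'o
  assumes "triangulated_category C" and "hom_finite C" and "two_calabi_yau C"
    and "krull_schmidt C"
    and "\<exists>T\<^sub>0. basic_object C T\<^sub>0 \<and> cluster_tilting C T\<^sub>0"
    and "frobenius_category E" and "hom_finite E" and "krull_schmidt E"
    and "valid_susp_choice E S" and "C = stable_category E S"
    and "T \<in> Ob C" and "L \<in> Ob C" and "M \<in> Ob C"
  shows "\<exists>\<phi>.
    constructible_map (affine_space (Hom C L (Susp C M)))
      (coproduct (dim_vectors C T L M) (rep_variety (End_algebra C T) A4_quiver)) \<phi> \<and>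
    (\<forall>\<epsilon> \<in> mor C L (Susp C M). \<forall>Y i p. (M, Y, L, i, p, \<epsilon>) \<in> Tri C \<longrightarrow>
      (let R = hom_representation C T M Y L (Susp C M) i p \<epsilon> in
        fst (\<phi> \<epsilon>) = dimension_vector A4_quiver R \<and>
        snd (\<phi> \<epsilon>) \<in> representation_orbit (End_algebra C T) A4_quiver R))"
proof -
  interpret stable_triangulated E S C
    by (intro stable_triangulated.intro stable_triangulated_axioms.intro frobenius_with_suspension.intro
        frobenius_with_suspension_axioms.intro assms)
  show ?thesis
    by (rule constructible_lift_of_representations) (use assms(2,7,11-13) in simp_all)
qed

end
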